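(* Every Kochen-Specker vector system contains at least $18$ vectors.
   Context: Let $\mathbb{H}^2=\{(x,y,z)\in\mathbb{R}^3 : x^2+y^2+z^2=1,\ z>0\}$. A vector system is a finite subset $\mathcal{K}\subseteq\mathbb{H}^2$. It is 101-colourable if one can assign $0$ or $1$ to each vector of $\mathcal{K}$ such that (i) no two orthogonal vectors are both assigned $0$, and (ii) no three mutually orthogonal vectors are all assigned $1$. A Kochen-Specker vector system is a vector system that is not 101-colourable; its size is its number of vectors. *)

theory Defs
  imports "HOL-Analysis.Analysis"
begin

definition upper_hemisphere :: "(real^3) set" where
  "upper_hemisphere = {v. norm v = 1 \<and> v $ 3 > 0}"

definition vector_system :: "(real^3) set \<Rightarrow> bool" where
  "vector_system K \<longleftrightarrow> finite K \<and> K \<subseteq> upper_hemisphere"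

definition orth :: "real^3 \<Rightarrow> real^3 \<Rightarrow> bool" where
  "orth u v \<longleftrightarrow> inner u v = 0"

definition colourable_101 :: "(real^3) set \<Rightarrow> bool" where
  "colourable_101 K \<longleftrightarrow> (\<exists>f :: real^3 \<Rightarrow> nat.
     (\<forall>v\<in>K. f v \<in> {0, 1}) \<and>
     (\<forall>u\<in>K. \<forall>v\<in>K. orth u v \<longrightarrow> \<not> (f u = 0 \<and> f v = 0)) \<and>
     (\<forall>u\<in>K. \<forall>v\<in>K. \<forall>w\<in>K. orth u v \<and> orth v w \<and> orth u w \<longrightarrow>
        \<not> (f u = 1 \<and> f v = 1 \<and> f w = 1)))"

definition KS_system :: "(real^3) set \<Rightarrow> bool" where
  "KS_system K \<longleftrightarrow> vector_system K \<and> \<not> colourable_101 K"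

end

(*
  Call two vectors adjacent if they are orthogonal.  Two distinct lines have only one common perpendicular, so
  this graph has no 4-cycle; in particular its triangles are pairwise edge-disjoint.  A 101-colouring is given
  by its class of zeros: an independent set that meets every triangle.

  Let V be a minimal system without a colouring.  Every vector lies in a triangle, and has a neighbour outside
  of each of its triangles.

  V has at least nine triangles.  For a random direction p give the value 0 to the vectors at an angle of less
  than 45 degrees to the line of p.  No two of them are orthogonal, and an orthonormal basis is missed with
  probability 1 - 3 (1 - 1/sqrt 2) < 1/8, so that up to eight triangles can be met simultaneously.

  There are few ways in which nine or more triangles can be arranged on at most 17 points without closing a
  4-cycle.  They are enumerated up to isomorphism by adding one triangle at a time; since one may always
  take away a triangle with the largest number of private points (points in no other triangle), the
  intermediate systems have few points too.  For each arrangement one searches for further edges: they must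
  join points at distance at least four, every point in only one triangle needs one, and every set of zeros
  must contain one.  A single graph survives, with 17 points and 11 triangles, and it has no orthogonal
  representation in space.
*)
theory Submission
  imports Defs
begin

section \<open>Systems of triples and their certificates\<close>

text \<open>The point bound of each list comes from counting incidences. If each of s triangles has
  at most p private points, twice the number of points is at most s (3 + p). Removing a triangle
  with most private points therefore leads from k <= 7 triangles on 2 k + 1 points to at most 2 k -
  1 points, from eight triangles on 16 points to 15, and from nine, ten or eleven triangles on 17
  points to 16, as 3 * 11 = 33 < 34. So systems of nine or ten triangles are listed on 16 points
  only, and their companions on 17 points are refuted without being listed. Eleven triangles are
  listed on 17 points, in order to see that no twelfth can be added.

  The number nine is what the random direction yields: 8 (3/sqrt 2 - 2) < 1 < 9 (3/sqrt 2 - 2).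

  Representatives, relabellings and trees are guessed data that are only checked. What must be
  proved is completeness: every possible extension, and every possible edge, occurs in the computed
  lists.\<close>

text \<open>These functions are evaluated by rewriting.  Conditionals with large branches are avoided in favour of
  auxiliary functions with a Boolean argument, because the simplifier normalises the chosen branch of a
  conditional once more from scratch.\<close>

fun memb :: "'p \<Rightarrow> 'p list \<Rightarrow> bool"
  and memb_if :: "bool \<Rightarrow> 'p \<Rightarrow> 'p list \<Rightarrow> bool" where
  "memb x [] = False"
| "memb x (y # ys) = memb_if (x = y) x ys"
| "memb_if True x ys = True"
| "memb_if False x ys = memb x ys"

fun cons_if :: "bool \<Rightarrow> 'b \<Rightarrow> 'b list \<Rightarrow> 'b list" where
  "cons_if True x xs = x # xs"
| "cons_if False x xs = xs"

section \<open>Neighbourhoods in a partly known graph\<close>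

type_synonym 'p triple = "'p \<times> 'p \<times> 'p"

fun tset :: "'p triple \<Rightarrow> 'p set" where
  "tset (a, b, c) = {a, b, c}"

fun in3 :: "'p \<Rightarrow> 'p triple \<Rightarrow> bool" where
  "in3 x (a, b, c) \<longleftrightarrow> x = a \<or> x = b \<or> x = c"

text \<open>In each triple only the first place of \<open>x\<close> counts, so the three points have
  to be different; \<open>copy_distinct\<close> provides this.\<close>

fun nbt :: "'p triple list \<Rightarrow> 'p \<Rightarrow> 'p list" where
  "nbt [] x = []"
| "nbt ((a, b, c) # hs) x =
     (if x = a then b # c # nbt hs x
      else if x = b then a # c # nbt hs x
      else if x = c then a # b # nbt hs x
      else nbt hs x)"

fun nbe :: "('p \<times> 'p) list \<Rightarrow> 'p \<Rightarrow> 'p list" where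
  "nbe [] x = []"
| "nbe ((a, b) # es) x = (if x = a then b # nbe es x else if x = b then a # nbe es x else nbe es x)"

definition nb :: "'p triple list \<Rightarrow> ('p \<times> 'p) list \<Rightarrow> 'p \<Rightarrow> 'p list" where
  "nb hs es x = nbt hs x @ nbe es x"

definition star :: "'p triple list \<Rightarrow> ('p \<times> 'p) list \<Rightarrow> 'p \<Rightarrow> 'p list" where
  "star hs es x = x # nb hs es x"

fun stars :: "'p triple list \<Rightarrow> ('p \<times> 'p) list \<Rightarrow> 'p list \<Rightarrow> 'p list" where
  "stars hs es [] = []"
| "stars hs es (x # xs) = star hs es x @ stars hs es xs"

definition star2 :: "'p triple list \<Rightarrow> ('p \<times> 'p) list \<Rightarrow> 'p \<Rightarrow> 'p list" where
  "star2 hs es x = stars hs es (star hs es x)"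

text \<open>Points at distance at least four.  A further edge can join only such points, because it would complete a
  shorter path to a square or to a triangle, and all triangles are known.\<close>

definition far :: "'p triple list \<Rightarrow> ('p \<times> 'p) list \<Rightarrow> 'p \<Rightarrow> 'p \<Rightarrow> bool" where
  "far hs es x y \<longleftrightarrow> (\<forall>w\<in>set (star2 hs es x). y \<notin> set (star hs es w))"

text \<open>A row of a matrix over the points \<^term>\<open>us\<close> marks the closed neighbourhood of a point.\<close>

fun orm :: "bool list \<Rightarrow> bool list \<Rightarrow> bool list" where
  "orm (True # bs) (c # cs) = True # orm bs cs"
| "orm (False # bs) (c # cs) = c # orm bs cs"
| "orm [] cs = []"
| "orm (b # bs) [] = []"

fun gather :: "bool list \<Rightarrow> bool list list \<Rightarrow> bool list \<Rightarrow> bool list" where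
  "gather (True # bs) (m # ms) acc = gather bs ms (orm m acc)"
| "gather (False # bs) (m # ms) acc = gather bs ms acc"
| "gather [] ms acc = acc"
| "gather (b # bs) [] acc = acc"

definition spread :: "bool list list \<Rightarrow> bool list \<Rightarrow> bool list" where
  "spread ms bs = gather bs ms bs"

fun bit_row :: "'p list \<Rightarrow> bool list list \<Rightarrow> 'p \<Rightarrow> bool list"
  and bit_row_if :: "bool \<Rightarrow> bool list \<Rightarrow> 'p list \<Rightarrow> bool list list \<Rightarrow> 'p \<Rightarrow> bool list" where
  "bit_row (u # us) (m # ms) x = bit_row_if (x = u) m us ms x"
| "bit_row [] ms x = []"
| "bit_row (u # us) [] x = []"
| "bit_row_if True m us ms x = m"
| "bit_row_if False m us ms x = bit_row us ms x"

text \<open>The row of \<open>x\<close> marks distance at most one and each \<open>spread\<close>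
  adds a step. When the rows are exact, the bits left unset are the points at distance at least
  four.\<close>

definition reach :: "'p list \<Rightarrow> bool list list \<Rightarrow> 'p \<Rightarrow> bool list" where
  "reach us ms x = spread ms (spread ms (bit_row us ms x))"

fun offs :: "'p list \<Rightarrow> bool list \<Rightarrow> 'p list" where
  "offs (u # us) (True # bs) = offs us bs"
| "offs (u # us) (False # bs) = u # offs us bs"
| "offs [] bs = []"
| "offs (u # us) [] = u # us"

text \<open>Dropping the points up to \<open>x\<close> makes \<open>free_pairs\<close> list each
  unordered pair once, in the order of \<open>us\<close>.\<close>

fun later :: "'p \<Rightarrow> 'p list \<Rightarrow> bool list \<Rightarrow> 'p list"
  and later_if :: "bool \<Rightarrow> 'p \<Rightarrow> 'p list \<Rightarrow> bool list \<Rightarrow> 'p list" where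
  "later x [] bs = []"
| "later x (u # us) [] = later_if (x = u) x us []"
| "later x (u # us) (b # bs) = later_if (x = u) x us bs"
| "later_if True x us bs = offs us bs"
| "later_if False x us bs = later x us bs"

fun tag :: "'p \<Rightarrow> 'p list \<Rightarrow> ('p \<times> 'p) list" where
  "tag x [] = []"
| "tag x (y # ys) = (x, y) # tag x ys"

fun common :: "'p \<Rightarrow> 'p list \<Rightarrow> 'p list \<Rightarrow> ('p \<times> 'p) list" where
  "common x fs [] = []"
| "common x fs (y # ys) = cons_if (memb y fs) (x, y) (common x fs ys)"

fun inner_pairs :: "'p list \<Rightarrow> bool list list \<Rightarrow> 'p list \<Rightarrow> ('p \<times> 'p) list" where
  "inner_pairs us ms [] = []"
| "inner_pairs us ms (x # xs) = common x (offs us (reach us ms x)) xs @ inner_pairs us ms xs"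

fun free_pairs :: "'p list \<Rightarrow> bool list list \<Rightarrow> 'p list \<Rightarrow> ('p \<times> 'p) list" where
  "free_pairs us ms [] = []"
| "free_pairs us ms (x # xs) = tag x (later x us (reach us ms x)) @ free_pairs us ms xs"

fun set_bit :: "'p list \<Rightarrow> bool list \<Rightarrow> 'p \<Rightarrow> bool list" where
  "set_bit (u # us) (b # bs) y = (y = u \<or> b) # set_bit us bs y"
| "set_bit [] bs y = []"
| "set_bit (u # us) [] y = []"

fun set_bit_if :: "bool \<Rightarrow> 'p list \<Rightarrow> bool list \<Rightarrow> 'p \<Rightarrow> bool list" where
  "set_bit_if True us bs y = set_bit us bs y"
| "set_bit_if False us bs y = bs"

fun set_row :: "'p list \<Rightarrow> 'p list \<Rightarrow> bool list list \<Rightarrow> 'p \<Rightarrow> 'p \<Rightarrow> bool list list" where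
  "set_row vs (u # us) (m # ms) x y = set_bit_if (x = u) vs m y # set_row vs us ms x y"
| "set_row vs [] ms x y = ms"
| "set_row vs (u # us) [] x y = []"

fun link :: "'p list \<Rightarrow> bool list list \<Rightarrow> 'p \<times> 'p \<Rightarrow> bool list list" where
  "link us ms (x, y) = set_row us us (set_row us us ms x y) y x"

fun unit_row :: "'p list \<Rightarrow> 'p \<Rightarrow> bool list" where
  "unit_row [] x = []"
| "unit_row (u # us) x = (x = u) # unit_row us x"

fun unit_rows :: "'p list \<Rightarrow> 'p list \<Rightarrow> bool list list" where
  "unit_rows us [] = []"
| "unit_rows us (x # xs) = unit_row us x # unit_rows us xs"

fun build :: "'p list \<Rightarrow> 'p triple list \<Rightarrow> bool list list" where
  "build us [] = unit_rows us us"
| "build us ((a, b, c) # hs) = link us (link us (link us (build us hs) (a, b)) (a, c)) (b, c)"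

fun pairs :: "'p list \<Rightarrow> ('p \<times> 'p) list" where
  "pairs [] = []"
| "pairs (x # xs) = map (Pair x) xs @ pairs xs"

section \<open>Soundness of the distance computation\<close>

lemma memb_iff [simp]: "memb x xs \<longleftrightarrow> x \<in> set xs"
proof (induction xs)
  case (Cons y ys)
  then show ?case by (cases "x = y") auto
qed simp

lemma memb_if_iff [simp]: "memb_if b x xs \<longleftrightarrow> b \<or> x \<in> set xs"
  by (cases b) auto

lemma cons_if_eq [simp]: "cons_if b x xs = (if b then x # xs else xs)"
  by (cases b) auto

lemma in3_iff [simp]: "in3 x h \<longleftrightarrow> x \<in> tset h"
  by (cases h) auto

lemma nbe_iff: "y \<in> set (nbe es x) \<longleftrightarrow> (x, y) \<in> set es \<or> (y, x) \<in> set es"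
  by (induction es) (auto split: if_splits)

lemma set_stars: "set (stars hs es xs) = (\<Union>x\<in>set xs. set (star hs es x))"
  by (induction xs) auto

text \<open>Only the bits that are set need a justification: a missing one merely adds a case to be refuted.\<close>

definition sound_rows :: "'p triple list \<Rightarrow> ('p \<times> 'p) list \<Rightarrow> 'p list \<Rightarrow> bool list list \<Rightarrow> bool" where
  "sound_rows hs es us ms \<longleftrightarrow> length ms = length us \<and>
     (\<forall>(x, m)\<in>set (zip us ms). \<forall>y. (y, True) \<in> set (zip us m) \<longrightarrow> y \<in> set (star hs es x))"

lemma orm_True: "(y, True) \<in> set (zip us (orm a b)) \<Longrightarrow> (y, True) \<in> set (zip us a) \<or> (y, True) \<in> set (zip us b)"
proof (induction a b arbitrary: us rule: orm.induct)
  case (1 bs c cs)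
  then show ?case by (cases us) auto
next
  case (2 bs c cs)
  then show ?case by (cases us) auto
qed auto

lemma gather_True:
  "(y, True) \<in> set (zip us (gather bs ms acc)) \<Longrightarrow>
   (y, True) \<in> set (zip us acc) \<or> (\<exists>m. (True, m) \<in> set (zip bs ms) \<and> (y, True) \<in> set (zip us m))"
proof (induction bs ms acc rule: gather.induct)
  case (1 bs m ms acc)
  then show ?case using orm_True[of y us m acc] by auto
qed auto

lemma spread_True:
  assumes "sound_rows hs es us ms" "(y, True) \<in> set (zip us (spread ms bs))"
  shows "(y, True) \<in> set (zip us bs) \<or> (\<exists>w. (w, True) \<in> set (zip us bs) \<and> y \<in> set (star hs es w))"
proof (cases "(y, True) \<in> set (zip us bs)")
  case False
  then obtain m where m: "(True, m) \<in> set (zip bs ms)" "(y, True) \<in> set (zip us m)"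
    using assms(2) gather_True[of y us bs ms bs] by (auto simp: spread_def)
  then obtain i where i: "i < length bs" "i < length ms" "bs ! i = True" "ms ! i = m"
    by (auto simp: set_zip)
  moreover have "length ms = length us" using assms(1) by (simp add: sound_rows_def)
  ultimately have "(us ! i, True) \<in> set (zip us bs)" "(us ! i, m) \<in> set (zip us ms)"
    by (auto simp: set_zip intro!: exI[of _ i])
  then show ?thesis using assms(1) m(2) by (fastforce simp: sound_rows_def)
qed simp

lemma bit_row_simp [simp]: "bit_row (u # us) (m # ms) x = (if x = u then m else bit_row us ms x)"
  by (cases "x = u") auto

declare bit_row.simps(1) [simp del]

lemma bit_row_in: "bit_row us ms x = [] \<or> (x, bit_row us ms x) \<in> set (zip us ms)"
proof (induction us arbitrary: ms)
  case (Cons u us)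
  then show ?case by (cases ms) auto
qed simp

text \<open>Every set bit comes with a walk: one step for the row of \<open>x\<close>, and one more
  for each of the two uses of \<open>spread\<close>.\<close>

lemma reach_not_far:
  assumes "sound_rows hs es us ms" "(y, True) \<in> set (zip us (reach us ms x))"
  shows "\<not> far hs es x y"
proof -
  have r: "w \<in> set (star hs es x)" if "(w, True) \<in> set (zip us (bit_row us ms x))" for w
    using that bit_row_in[of us ms x] assms(1) by (fastforce simp: sound_rows_def)
  have self: "w \<in> set (star hs es w)" for w by (simp add: star_def)
  have s: "w \<in> set (star2 hs es x)" if "(w, True) \<in> set (zip us (spread ms (bit_row us ms x)))" for w
    using spread_True[OF assms(1) that] r self by (auto simp: star2_def set_stars)
  have "\<exists>w. w \<in> set (star2 hs es x) \<and> y \<in> set (star hs es w)"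
    using spread_True[OF assms(1), of y "spread ms (bit_row us ms x)"] assms(2) s self by (auto simp: reach_def)
  then obtain w where w: "w \<in> set (star2 hs es x)" "y \<in> set (star hs es w)" by blast
  show ?thesis using w unfolding far_def by auto
qed

lemma offs_cover: "y \<in> set us \<Longrightarrow> (y, True) \<notin> set (zip us bs) \<Longrightarrow> y \<in> set (offs us bs)"
  by (induction us bs rule: offs.induct) (auto split: if_splits)

lemma set_tag [simp]: "set (tag x ys) = Pair x ` set ys"
  by (induction ys) auto

lemma set_common: "set (common x fs ys) = Pair x ` (set fs \<inter> set ys)"
  by (induction ys) auto

lemma later_cover:
  "(x, y) \<in> set (pairs us) \<Longrightarrow> (y, True) \<notin> set (zip us bs) \<Longrightarrow> y \<in> set (later x us bs)"
proof (induction us arbitrary: bs)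
  case (Cons u us)
  have snd: "(x, y) \<in> set (pairs us) \<Longrightarrow> y \<in> set us" for us :: "'a list" by (induction us) auto
  show ?case
  proof (cases bs)
    case Nil
    then show ?thesis using Cons snd offs_cover[of y us "[]"] by (cases "x = u") auto
  next
    case (Cons b bs')
    then show ?thesis using Cons.IH[of bs'] Cons.prems snd offs_cover[of y us bs'] by (cases "x = u") auto
  qed
qed simp

lemma far_offs:
  assumes "sound_rows hs es us ms" "far hs es x y" "y \<in> set us"
  shows "y \<in> set (offs us (reach us ms x))"
  by (rule offs_cover[OF assms(3)]) (use assms(2) reach_not_far[OF assms(1)] in metis)

lemma inner_pairs_cover:
  assumes "sound_rows hs es us ms" "far hs es x y" "y \<in> set us" "(x, y) \<in> set (pairs xs)"
  shows "(x, y) \<in> set (inner_pairs us ms xs)"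
  using assms(4) far_offs[OF assms(1-3)] by (induction xs) (auto simp: set_common)

lemma pairs_fst: "(x, y) \<in> set (pairs xs) \<Longrightarrow> x \<in> set xs"
  by (induction xs) auto

lemma free_pairs_cover:
  assumes "sound_rows hs es us ms" "far hs es x y" "(x, y) \<in> set (pairs us)"
  shows "(x, y) \<in> set (free_pairs us ms us)"
proof -
  have "(x, y) \<in> set (free_pairs us ms xs)" if "x \<in> set xs" for xs
    using that later_cover[OF assms(3)] reach_not_far[OF assms(1)] assms(2) by (induction xs) auto
  then show ?thesis using pairs_fst[OF assms(3)] by simp
qed

lemma set_bit_True: "(z, True) \<in> set (zip us (set_bit us bs y)) \<Longrightarrow> z = y \<or> (z, True) \<in> set (zip us bs)"
  by (induction us bs y rule: set_bit.induct) (auto split: if_splits)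

lemma set_row_cases:
  "(z, m) \<in> set (zip us (set_row vs us ms x y)) \<Longrightarrow>
   (z, m) \<in> set (zip us ms) \<or> z = x \<and> (\<exists>m'. (z, m') \<in> set (zip us ms) \<and> m = set_bit vs m' y)"
proof (induction vs us ms x y rule: set_row.induct)
  case (1 vs u us m ms x y)
  then show ?case by (cases "x = u") auto
qed auto

lemma length_set_row [simp]: "length (set_row vs us ms x y) = length ms"
  by (induction vs us ms x y rule: set_row.induct) auto

text \<open>The matrix may be reinterpreted over a larger graph at the same time: stars only grow,
  so old bits stay justified and only the new one needs a witness.\<close>

lemma sound_set_row:
  assumes "sound_rows hs es us ms" "y \<in> set (star hs' es' x)"
    "\<And>z. set (star hs es z) \<subseteq> set (star hs' es' z)"
  shows "sound_rows hs' es' us (set_row us us ms x y)"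
  unfolding sound_rows_def
proof (intro conjI ballI, goal_cases)
  case 1
  then show ?case using assms(1) by (simp add: sound_rows_def)
next
  case (2 zm)
  obtain z m where zm: "zm = (z, m)" by (cases zm)
  from set_row_cases[of z m us us ms x y] 2 zm
  have "(z, m) \<in> set (zip us ms) \<or> z = x \<and> (\<exists>m'. (z, m') \<in> set (zip us ms) \<and> m = set_bit us m' y)" by simp
  then show ?case
    using assms set_bit_True unfolding zm sound_rows_def by fast
qed

lemma sound_link:
  assumes "sound_rows hs es us ms" "y \<in> set (star hs' es' x)" "x \<in> set (star hs' es' y)"
    "\<And>z. set (star hs es z) \<subseteq> set (star hs' es' z)"
  shows "sound_rows hs' es' us (link us ms (x, y))"
  using sound_set_row[OF sound_set_row[OF assms(1,2,4)] assms(3)] by simp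

lemma unit_row_True: "(z, True) \<in> set (zip us (unit_row us x)) \<Longrightarrow> z = x"
  by (induction us) auto

lemma unit_rows_map: "unit_rows us xs = map (unit_row us) xs"
  by (induction xs) auto

lemma sound_build: "sound_rows hs [] us (build us hs)"
proof (induction hs)
  case Nil
  have "y = x" if "(x, m) \<in> set (zip us (map (unit_row us) us))" "(y, True) \<in> set (zip us m)" for x y m
  proof -
    have "m = unit_row us x" using that(1) by (auto simp: set_zip)
    then show ?thesis using unit_row_True that(2) by simp
  qed
  then show ?case by (auto simp: sound_rows_def unit_rows_map star_def)
next
  case (Cons h hs)
  obtain a b c where h: "h = (a, b, c)" by (cases h)
  have sub: "set (star hs [] z) \<subseteq> set (star (h # hs) [] z)" for z by (auto simp: h star_def nb_def)
  have mem: "x \<in> tset h \<Longrightarrow> y \<in> tset h \<Longrightarrow> y \<in> set (star (h # hs) [] x)" for x y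
    by (auto simp: h star_def nb_def)
  have "sound_rows (h # hs) [] us (link us (build us hs) (a, b))"
    by (rule sound_link[OF Cons]) (use mem sub h in auto)
  then have "sound_rows (h # hs) [] us (link us (link us (build us hs) (a, b)) (a, c))"
    by (rule sound_link) (use mem h in auto)
  then have "sound_rows (h # hs) [] us (link us (link us (link us (build us hs) (a, b)) (a, c)) (b, c))"
    by (rule sound_link) (use mem h in auto)
  then show ?case by (simp only: h build.simps)
qed

lemma sound_link_edge:
  assumes "sound_rows hs es us ms"
  shows "sound_rows hs (p # es) us (link us ms p)"
proof -
  obtain x y where p: "p = (x, y)" by (cases p)
  show ?thesis unfolding p
    by (rule sound_link[OF assms]) (auto simp: star_def nb_def)
qed

lemma pairs_cover:
  assumes "x \<in> set xs" "y \<in> set xs" "x \<noteq> y"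
  shows "(x, y) \<in> set (pairs xs) \<or> (y, x) \<in> set (pairs xs)"
  using assms by (induction xs) auto

text \<open>\<open>cliques\<close> finds three points only when their pairs follow the order of the
  list; some arrangement of the three does.\<close>

lemma pairs_cover3:
  assumes "x \<in> set xs" "y \<in> set xs" "z \<in> set xs" "x \<noteq> y" "y \<noteq> z" "x \<noteq> z"
  shows "\<exists>a b c. {a, b, c} = {x, y, z} \<and> (a, b) \<in> set (pairs xs) \<and> (b, c) \<in> set (pairs xs) \<and> (a, c) \<in> set (pairs xs)"
  using assms
proof (induction xs)
  case (Cons w ws)
  have sub: ?case if ws: "b \<in> set ws" "c \<in> set ws" "b \<noteq> c" and eq: "{w, b, c} = {x, y, z}" for b c
    using pairs_cover[OF ws]
  proof
    assume "(b, c) \<in> set (pairs ws)"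
    then show ?thesis using ws eq by (intro exI[of _ w] exI[of _ b] exI[of _ c]) simp
  next
    assume "(c, b) \<in> set (pairs ws)"
    moreover have "{w, c, b} = {x, y, z}" using eq by blast
    ultimately show ?thesis using ws by (intro exI[of _ w] exI[of _ c] exI[of _ b]) simp
  qed
  consider "w = x" | "w = y" | "w = z" | "w \<noteq> x" "w \<noteq> y" "w \<noteq> z" by blast
  then show ?case
  proof cases
    case 1
    show ?thesis by (rule sub[of y z]) (use Cons.prems 1 in auto)
  next
    case 2
    show ?thesis by (rule sub[of x z]) (use Cons.prems 2 in auto)
  next
    case 3
    show ?thesis by (rule sub[of x y]) (use Cons.prems 3 in auto)
  next
    case 4
    then have "x \<in> set ws" "y \<in> set ws" "z \<in> set ws" using Cons.prems by auto
    from Cons.IH[OF this Cons.prems(4-6)] show ?thesis by auto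
  qed
qed simp

text \<open>A tree refutes a graph whose triangles are given by triples, and whose other edges are known in part.
  \<^term>\<open>Split z\<close> distinguishes the possible edges inside of the set \<^term>\<open>z\<close>, which has exactly one point in each
  triangle and therefore cannot be independent, \<^term>\<open>Hang v\<close> those at the point \<^term>\<open>v\<close>, which lies in one triangle
  and needs an edge outside of it, and \<^term>\<open>Rigid ss\<close> finds the forbidden pattern at the points \<^term>\<open>ss\<close>.\<close>

datatype 'p tree = Split "'p list" "'p tree list" | Hang 'p "'p tree list" | Rigid "'p list"

fun one_of3 :: "bool \<Rightarrow> bool \<Rightarrow> bool \<Rightarrow> bool" where
  "one_of3 True p q = (\<not> (p \<or> q))"
| "one_of3 False True q = (\<not> q)"
| "one_of3 False False q = q"

fun once :: "'p triple \<Rightarrow> 'p list \<Rightarrow> bool" where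
  "once (a, b, c) z = one_of3 (memb a z) (memb b z) (memb c z)"

fun all_once :: "'p triple list \<Rightarrow> 'p list \<Rightarrow> bool" where
  "all_once [] z = True"
| "all_once (h # hs) z = (once h z \<and> all_once hs z)"

fun no_edge :: "('p \<times> 'p) list \<Rightarrow> 'p list \<Rightarrow> bool" where
  "no_edge [] z = True"
| "no_edge ((a, b) # es) z = (\<not> (memb a z \<and> memb b z) \<and> no_edge es z)"

fun holders :: "'p triple list \<Rightarrow> 'p \<Rightarrow> 'p triple list" where
  "holders [] x = []"
| "holders (h # hs) x = cons_if (in3 x h) h (holders hs x)"

fun is_single :: "'b list \<Rightarrow> bool" where
  "is_single [] = False"
| "is_single [x] = True"
| "is_single (x # y # ys) = False"

fun is_nil :: "'b list \<Rightarrow> bool" where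
  "is_nil [] = True"
| "is_nil (x # xs) = False"

fun look :: "'p list \<Rightarrow> 'p list \<Rightarrow> 'p \<Rightarrow> 'p"
  and look_if :: "bool \<Rightarrow> 'p \<Rightarrow> 'p list \<Rightarrow> 'p list \<Rightarrow> 'p \<Rightarrow> 'p" where
  "look (u # us) (s # ss) x = look_if (x = u) s us ss x"
| "look [] ss x = x"
| "look (u # us) [] x = x"
| "look_if True s us ss x = s"
| "look_if False s us ss x = look us ss x"

fun has_edges :: "'p triple list \<Rightarrow> ('p \<times> 'p) list \<Rightarrow> 'p list \<Rightarrow> 'p list \<Rightarrow> ('p \<times> 'p) list \<Rightarrow> bool" where
  "has_edges hs es us ss [] = True"
| "has_edges hs es us ss ((x, y) # ps) =
     (memb (look us ss y) (nb hs es (look us ss x)) \<and> has_edges hs es us ss ps)"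

text \<open>The subtrees follow the order of the candidate edges; in each branch the edge is added
  and the matrix updated. An empty list of subtrees asserts that no candidate is left, so
  \<open>Split z []\<close> and \<open>Hang v []\<close> are immediate contradictions.\<close>

fun closes :: "('p \<times> 'p) list \<Rightarrow> 'p list \<Rightarrow> 'p triple list \<Rightarrow> ('p \<times> 'p) list \<Rightarrow> bool list list \<Rightarrow> 'p tree \<Rightarrow> bool"
  and closes_all :: "('p \<times> 'p) list \<Rightarrow> 'p list \<Rightarrow> 'p triple list \<Rightarrow> ('p \<times> 'p) list \<Rightarrow> bool list list
    \<Rightarrow> ('p \<times> 'p) list \<Rightarrow> 'p tree list \<Rightarrow> bool" where
  "closes pat us hs es ms (Split z ts) =
     (all_once hs z \<and> no_edge es z \<and> closes_all pat us hs es ms (inner_pairs us ms z) ts)"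
| "closes pat us hs es ms (Hang v ts) =
     (is_single (holders hs v) \<and> is_nil (nbe es v)
      \<and> closes_all pat us hs es ms (tag v (offs us (reach us ms v))) ts)"
| "closes pat us hs es ms (Rigid ss) = has_edges hs es us ss pat"
| "closes_all pat us hs es ms [] ts = True"
| "closes_all pat us hs es ms (p # ps) [] = False"
| "closes_all pat us hs es ms (p # ps) (t # ts) =
     (closes pat us hs (p # es) (link us ms p) t \<and> closes_all pat us hs es ms ps ts)"

section \<open>Square-free graphs and copies of triple systems\<close>

locale square_free_graph =
  fixes V :: "'a set" and E :: "'a \<Rightarrow> 'a \<Rightarrow> bool"
  assumes finite_V: "finite V"
    and E_V: "E u v \<Longrightarrow> u \<in> V \<and> v \<in> V"
    and E_sym: "E u v \<Longrightarrow> E v u"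
    and E_irrefl: "\<not> E u u"
    and square_free: "E u w \<Longrightarrow> E v w \<Longrightarrow> E u w' \<Longrightarrow> E v w' \<Longrightarrow> u \<noteq> v \<Longrightarrow> w = w'"
begin

definition triangles :: "'a set set" where
  "triangles = {{u, v, w} | u v w. E u v \<and> E v w \<and> E u w}"

lemma triangle_edge: "t \<in> triangles \<Longrightarrow> u \<in> t \<Longrightarrow> v \<in> t \<Longrightarrow> u \<noteq> v \<Longrightarrow> E u v"
  by (auto simp: triangles_def dest: E_sym)

lemma triangle_card: "t \<in> triangles \<Longrightarrow> card t = 3"
  using E_irrefl unfolding triangles_def by (auto simp: card_insert_if)

lemma triangle_finite: "t \<in> triangles \<Longrightarrow> finite t"
  by (auto simp: triangles_def)

lemma triangle_V: "t \<in> triangles \<Longrightarrow> t \<subseteq> V"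
  using E_V by (auto simp: triangles_def)

lemma finite_triangles: "finite triangles"
  by (rule finite_subset[of _ "Pow V"]) (use triangle_V finite_V in auto)

lemma triangle_third:
  assumes "t \<in> triangles" "u \<in> t" "v \<in> t" "u \<noteq> v"
  obtains w where "t = {u, v, w}" "E u w" "E v w" "w \<noteq> u" "w \<noteq> v"
proof -
  have "\<exists>w. t = {u, v, w} \<and> E u w \<and> E v w"
    using assms by (auto simp: triangles_def insert_commute dest: E_sym)
  then show ?thesis using that E_irrefl by blast
qed

lemma triangle_eqI:
  assumes "t \<in> triangles" "t' \<in> triangles" "u \<in> t" "v \<in> t" "u \<in> t'" "v \<in> t'" "u \<noteq> v"
  shows "t = t'"
proof -
  obtain w where w: "t = {u, v, w}" "E u w" "E v w" using triangle_third[OF assms(1,3,4,7)] .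
  obtain w' where w': "t' = {u, v, w'}" "E u w'" "E v w'" using triangle_third[OF assms(2,5,6,7)] .
  show ?thesis using square_free[OF w(2,3) w'(2,3) assms(7)] w(1) w'(1) by simp
qed

text \<open>Equality of length and cardinality forces different entries of \<open>hs\<close> to have
  different images.\<close>

definition copy :: "('p \<Rightarrow> 'a) \<Rightarrow> 'p triple list \<Rightarrow> 'a set set \<Rightarrow> bool" where
  "copy f hs T \<longleftrightarrow> inj_on f (\<Union>(tset ` set hs)) \<and> (\<lambda>h. f ` tset h) ` set hs = T \<and> length hs = card T"

lemma copyD:
  assumes "copy f hs T" "T \<subseteq> triangles"
  shows "inj_on f (\<Union>(tset ` set hs))" "h \<in> set hs \<Longrightarrow> f ` tset h \<in> T"
    "t \<in> T \<Longrightarrow> \<exists>h\<in>set hs. t = f ` tset h" "length hs = card T"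
    "f ` (\<Union>(tset ` set hs)) = \<Union>T"
  using assms by (auto simp: copy_def)

lemma copy_distinct:
  assumes "copy f hs T" "T \<subseteq> triangles" "(a, b, c) \<in> set hs"
  shows "a \<noteq> b" "b \<noteq> c" "a \<noteq> c"
proof -
  have "card (f ` {a, b, c}) = 3"
    using copyD(2)[OF assms] assms(2) triangle_card by fastforce
  then have "3 \<le> card {a, b, c}"
    using card_image_le[of "{a, b, c}" f] by simp
  then show "a \<noteq> b" "b \<noteq> c" "a \<noteq> c"
    by (auto simp: card_insert_if split: if_splits)
qed

lemma nbt_iff:
  assumes "\<And>a b c. (a, b, c) \<in> set hs \<Longrightarrow> a \<noteq> b \<and> b \<noteq> c \<and> a \<noteq> c"
  shows "y \<in> set (nbt hs x) \<longleftrightarrow> x \<noteq> y \<and> (\<exists>h\<in>set hs. x \<in> tset h \<and> y \<in> tset h)"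
  using assms
proof (induction hs)
  case (Cons h hs)
  obtain a b c where h: "h = (a, b, c)" by (cases h)
  have ne: "a \<noteq> b" "b \<noteq> c" "a \<noteq> c" using Cons.prems[of a b c] h by auto
  have "y \<in> set (nbt hs x) \<longleftrightarrow> x \<noteq> y \<and> (\<exists>h\<in>set hs. x \<in> tset h \<and> y \<in> tset h)"
    using Cons by auto
  then show ?case using ne unfolding h by auto
qed auto

end

locale labelled_graph = square_free_graph V E for V :: "'a set" and E +
  fixes f :: "'p \<Rightarrow> 'a" and hs :: "'p triple list" and T :: "'a set set"
  assumes T: "T \<subseteq> triangles" and cp: "copy f hs T"
begin

abbreviation points :: "'p set" where "points \<equiv> \<Union>(tset ` set hs)"

lemma inj: "inj_on f points" using copyD(1)[OF cp T] .

definition edges_ok :: "('p \<times> 'p) list \<Rightarrow> bool" where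
  "edges_ok es \<longleftrightarrow> (\<forall>(x, y)\<in>set es. x \<in> points \<and> y \<in> points \<and> E (f x) (f y))"

lemma nbt_char: "y \<in> set (nbt hs x) \<longleftrightarrow> x \<noteq> y \<and> (\<exists>h\<in>set hs. x \<in> tset h \<and> y \<in> tset h)"
  by (rule nbt_iff) (use copy_distinct[OF cp T] in blast)

lemma nb_points:
  assumes "edges_ok es" "y \<in> set (nb hs es x)"
  shows "x \<in> points" "y \<in> points" "E (f x) (f y)"
proof -
  have "x \<in> points \<and> y \<in> points \<and> E (f x) (f y)"
  proof (cases "y \<in> set (nbt hs x)")
    case True
    then obtain h where h: "x \<noteq> y" "h \<in> set hs" "x \<in> tset h" "y \<in> tset h" by (auto simp: nbt_char)
    have "x \<in> points" "y \<in> points" using h by auto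
    moreover have "f x \<noteq> f y" using calculation h(1) inj by (auto dest: inj_onD)
    moreover have "f ` tset h \<in> triangles" using copyD(2)[OF cp T h(2)] T by auto
    ultimately show ?thesis using triangle_edge h by blast
  next
    case False
    then have "(x, y) \<in> set es \<or> (y, x) \<in> set es" using assms(2) by (auto simp: nb_def nbe_iff)
    then show ?thesis using assms(1) E_sym by (auto simp: edges_ok_def)
  qed
  then show "x \<in> points" "y \<in> points" "E (f x) (f y)" by auto
qed

text \<open>A walk of length three between the ends of an edge would close up to a square.\<close>

lemma not_far_edge:
  assumes es: "edges_ok es" and xy: "x \<in> points" "y \<in> points" "E (f x) (f y)" and "\<not> far hs es x y"
  shows "y \<in> set (nb hs es x) \<or> (\<exists>m. m \<in> set (nb hs es x) \<and> y \<in> set (nb hs es m))"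
proof (rule ccontr)
  assume neg: "\<not> ?thesis"
  obtain a w where aw: "a \<in> set (star hs es x)" "w \<in> set (star hs es a)" "y \<in> set (star hs es w)"
    using assms(5) by (auto simp: far_def star2_def set_stars)
  have xny: "x \<noteq> y" using xy E_irrefl by auto
  have y0: "y \<notin> set (nb hs es x)" and yn: "\<And>m. m \<in> set (nb hs es x) \<Longrightarrow> y \<notin> set (nb hs es m)"
    using neg by blast+
  have "w = y \<or> y \<in> set (nb hs es w)" "w = a \<or> w \<in> set (nb hs es a)" "a = x \<or> a \<in> set (nb hs es x)"
    using aw by (auto simp: star_def)
  \<comment> \<open>A walk with a pause would already put \<open>y\<close> within two steps of
    \<open>x\<close>, so all three steps are proper.\<close>
  then have a: "a \<in> set (nb hs es x)" and w: "w \<in> set (nb hs es a)" and y: "y \<in> set (nb hs es w)"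
    using y0 yn xny by metis+
  have ne: "x \<noteq> w" "a \<noteq> y" using y0 a y by metis+
  note A = nb_points[OF es a] and W = nb_points[OF es w] and Y = nb_points[OF es y]
  have "f x \<noteq> f w" using ne A W inj by (auto dest: inj_onD)
  moreover have "f a \<noteq> f y" using ne A Y inj by (auto dest: inj_onD)
  ultimately show False
    using square_free[OF A(3) E_sym[OF W(3)] xy(3) Y(3)] by simp
qed

lemma far_from_cover:
  assumes "edges_ok es" "x \<in> points" "y \<in> points" "E (f x) (f y)" "y \<notin> set (nb hs es x)"
    "\<And>m. m \<in> set (nb hs es x) \<Longrightarrow> y \<notin> set (nb hs es m)"
  shows "far hs es x y"
  using not_far_edge[OF assms(1-4)] assms(5,6) by blast

end

section \<open>Extensions by one triple and their certificates\<close>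

fun singles :: "'p triple list \<Rightarrow> 'p list \<Rightarrow> 'p list" where
  "singles hs [] = []"
| "singles hs (x # xs) = cons_if (is_single (holders hs x)) x (singles hs xs)"

fun cons_nonempty :: "'b list \<Rightarrow> 'b list list \<Rightarrow> 'b list list" where
  "cons_nonempty [] xss = xss"
| "cons_nonempty (x # xs) xss = (x # xs) # xss"

text \<open>Triples without private points are dropped, because they can never violate the
  maximality tested by \<open>max_private\<close>.\<close>

fun privates :: "'p triple list \<Rightarrow> 'p triple list \<Rightarrow> 'p list list" where
  "privates hs [] = []"
| "privates hs ((a, b, c) # r) = cons_nonempty (singles hs [a, b, c]) (privates hs r)"

fun minus3 :: "'p list \<Rightarrow> 'p triple \<Rightarrow> 'p list" where
  "minus3 [] e = []"
| "minus3 (x # xs) e = cons_if (\<not> in3 x e) x (minus3 xs e)"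

fun no_longer :: "'b list \<Rightarrow> 'c list \<Rightarrow> bool" where
  "no_longer [] ys = True"
| "no_longer (x # xs) [] = False"
| "no_longer (x # xs) (y # ys) = no_longer xs ys"

text \<open>Whether no triple of the old system, whose private points are listed in \<^term>\<open>vs\<close>, has more private
  points in the new system than the added triple \<^term>\<open>e\<close> with its fresh points \<^term>\<open>fr\<close>.\<close>

fun max_private :: "'p list list \<Rightarrow> 'p triple \<Rightarrow> 'p list \<Rightarrow> bool" where
  "max_private [] e fr = True"
| "max_private (v # vs) e fr = (no_longer (minus3 v e) fr \<and> max_private vs e fr)"

fun keep :: "'p list list \<Rightarrow> 'p list \<Rightarrow> 'p triple list \<Rightarrow> 'p triple list" where
  "keep vs fr [] = []"
| "keep vs fr (e # es) = cons_if (max_private vs e fr) e (keep vs fr es)"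

fun with1 :: "'p \<Rightarrow> ('p \<times> 'p) list \<Rightarrow> 'p triple list" where
  "with1 a [] = []"
| "with1 a ((x, y) # ps) = (x, y, a) # with1 a ps"

fun with2 :: "'p \<Rightarrow> 'p \<Rightarrow> 'p list \<Rightarrow> 'p triple list" where
  "with2 a b [] = []"
| "with2 a b (x # xs) = (x, a, b) # with2 a b xs"

fun third_if :: "bool \<Rightarrow> 'p \<Rightarrow> 'p \<Rightarrow> 'p \<Rightarrow> ('p \<times> 'p) list \<Rightarrow> 'p triple list \<Rightarrow> 'p triple list" where
  "third_if True x y z ps es = cons_if (memb (x, z) ps) (x, y, z) es"
| "third_if False x y z ps es = es"

fun thirds :: "'p \<Rightarrow> 'p \<Rightarrow> ('p \<times> 'p) list \<Rightarrow> ('p \<times> 'p) list \<Rightarrow> 'p triple list" where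
  "thirds x y [] ps = []"
| "thirds x y ((u, z) # qs) ps =
     third_if (u = y) x y z ps (thirds x y qs ps)"

fun cliques :: "('p \<times> 'p) list \<Rightarrow> ('p \<times> 'p) list \<Rightarrow> 'p triple list" where
  "cliques [] ps = []"
| "cliques ((x, y) # qs) ps = thirds x y ps ps @ cliques qs ps"

fun exts3 :: "'p list list \<Rightarrow> 'p list \<Rightarrow> 'p triple list" where
  "exts3 vs (a # b # c # qs) = keep vs [a, b, c] [(a, b, c)]"
| "exts3 vs _ = []"

fun exts2 :: "'p list list \<Rightarrow> 'p list \<Rightarrow> 'p list \<Rightarrow> 'p triple list" where
  "exts2 vs ps (a # b # qs) = keep vs [a, b] (with2 a b ps)"
| "exts2 vs ps _ = []"

fun exts1 :: "'p list list \<Rightarrow> ('p \<times> 'p) list \<Rightarrow> 'p list \<Rightarrow> 'p triple list" where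
  "exts1 vs fs (a # qs) = keep vs [a] (with1 a fs)"
| "exts1 vs fs [] = []"

text \<open>The new triple has three, two, one or no fresh points. Fresh labels are interchangeable,
  so the first ones of \<open>qs\<close> suffice. Any two old points of the triple must form a pair
  of \<open>fs\<close>, that is, lie at distance at least four in the old system.\<close>

definition exts_of :: "'p list list \<Rightarrow> 'p list \<Rightarrow> ('p \<times> 'p) list \<Rightarrow> 'p list \<Rightarrow> 'p triple list" where
  "exts_of vs ps fs qs = exts3 vs qs @ exts2 vs ps qs @ exts1 vs fs qs @ keep vs [] (cliques fs fs)"

fun olds :: "'p triple list \<Rightarrow> 'p list \<Rightarrow> 'p list" where
  "olds hs [] = []"
| "olds hs (x # xs) = cons_if (\<not> is_nil (holders hs x)) x (olds hs xs)"

fun news :: "'p triple list \<Rightarrow> 'p list \<Rightarrow> 'p list" where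
  "news hs [] = []"
| "news hs (x # xs) = cons_if (is_nil (holders hs x)) x (news hs xs)"

definition exts_from :: "'p triple list \<Rightarrow> 'p list \<Rightarrow> 'p list \<Rightarrow> 'p triple list" where
  "exts_from hs os qs = exts_of (privates hs hs) os (free_pairs os (build os hs) os) qs"

definition exts :: "'p list \<Rightarrow> 'p triple list \<Rightarrow> 'p triple list" where
  "exts us hs = exts_from hs (olds hs us) (news hs us)"

fun same_length :: "'b list \<Rightarrow> 'c list \<Rightarrow> bool" where
  "same_length [] [] = True"
| "same_length (x # xs) (y # ys) = same_length xs ys"
| "same_length _ _ = False"

fun no_dup :: "'p list \<Rightarrow> bool" where
  "no_dup [] = True"
| "no_dup (x # xs) = (\<not> memb x xs \<and> no_dup xs)"

fun same3_if :: "bool \<Rightarrow> 'p \<Rightarrow> 'p \<Rightarrow> 'p triple \<Rightarrow> bool" where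
  "same3_if True b c h \<longleftrightarrow> in3 b h \<and> in3 c h"
| "same3_if False b c h \<longleftrightarrow> False"

fun same3 :: "'p triple \<Rightarrow> 'p triple \<Rightarrow> bool" where
  "same3 (a, b, c) h = same3_if (in3 a h) b c h"

fun some_same :: "'p triple \<Rightarrow> 'p triple list \<Rightarrow> bool"
  and some_same_if :: "bool \<Rightarrow> 'p triple \<Rightarrow> 'p triple list \<Rightarrow> bool" where
  "some_same r [] = False"
| "some_same r (h # hs) = some_same_if (same3 r h) r hs"
| "some_same_if True r hs = True"
| "some_same_if False r hs = some_same r hs"

fun relabel :: "'p list \<Rightarrow> 'p list \<Rightarrow> 'p triple \<Rightarrow> 'p triple" where
  "relabel us ss (a, b, c) = (look us ss a, look us ss b, look us ss c)"

fun maps_into :: "'p list \<Rightarrow> 'p list \<Rightarrow> 'p triple list \<Rightarrow> 'p triple list \<Rightarrow> bool" where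
  "maps_into us ss [] hs = True"
| "maps_into us ss (r # rs) hs = (some_same (relabel us ss r) hs \<and> maps_into us ss rs hs)"

text \<open>Only inclusions of triples are tested; that the relabelling hits every triple of
  \<open>hs\<close> follows by counting in \<open>copy_iso\<close>.\<close>

definition iso_ok :: "'p list \<Rightarrow> 'p triple list \<Rightarrow> 'p triple list \<Rightarrow> 'p list \<Rightarrow> bool" where
  "iso_ok us rs hs ss \<longleftrightarrow> same_length rs hs \<and> same_length us ss \<and> no_dup ss \<and> maps_into us ss rs hs"

fun wf_triples :: "'p list \<Rightarrow> 'p triple list \<Rightarrow> bool" where
  "wf_triples us [] = True"
| "wf_triples us ((a, b, c) # rs) =
     (no_dup [a, b, c] \<and> \<not> some_same (a, b, c) rs \<and> memb a us \<and> memb b us \<and> memb c us \<and> wf_triples us rs)"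

text \<open>Points serve as numerals here: the place of \<open>p\<close> in \<open>us\<close>
  selects an entry of \<open>xs\<close>, and the empty list signals that there is none.\<close>

fun pick :: "'p list \<Rightarrow> 'p \<Rightarrow> 'b list \<Rightarrow> 'b list"
  and pick_if :: "bool \<Rightarrow> 'b \<Rightarrow> 'p list \<Rightarrow> 'p \<Rightarrow> 'b list \<Rightarrow> 'b list" where
  "pick (u # us) p (x # xs) = pick_if (p = u) x us p xs"
| "pick [] p xs = []"
| "pick (u # us) p [] = []"
| "pick_if True x us p xs = [x]"
| "pick_if False x us p xs = pick us p xs"

fun pick_in :: "'p list \<Rightarrow> 'p \<Rightarrow> 'b list list \<Rightarrow> 'b list" where
  "pick_in us p [] = []"
| "pick_in us p (xs # xss) = pick us p xs"

fun iso_any :: "'p list \<Rightarrow> 'p triple list list \<Rightarrow> 'p triple list \<Rightarrow> 'p list \<Rightarrow> bool" where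
  "iso_any us [] hs ss = False"
| "iso_any us (rs # Rs) hs ss = iso_ok us rs hs ss"

text \<open>A certificate $(p, q, \mathit{ss})$ selects the representative in row $p$ and column $q$ of \<^term>\<open>L\<close>, and
  \<^term>\<open>ss\<close> lists the images of the points \<^term>\<open>us\<close>; a missing tail of the list stands for fixed points.\<close>

fun fill :: "'p list \<Rightarrow> 'p list \<Rightarrow> 'p list" where
  "fill [] us = us"
| "fill (s # ss) [] = []"
| "fill (s # ss) (u # us) = s # fill ss us"

fun isos :: "'p list \<Rightarrow> 'p list \<Rightarrow> 'p triple list list list \<Rightarrow> 'p triple list \<Rightarrow> 'p triple list
    \<Rightarrow> ('p \<times> 'p \<times> 'p list) list \<Rightarrow> bool" where
  "isos ix us L hs [] cs = True"
| "isos ix us L hs (e # es) [] = False"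
| "isos ix us L hs (e # es) ((p, q, ss) # cs) =
     (iso_any us (pick_in ix q (pick ix p L)) (e # hs) (fill ss us) \<and> isos ix us L hs es cs)"

fun all_isos :: "'p list \<Rightarrow> 'p list \<Rightarrow> 'p triple list list list \<Rightarrow> 'p triple list list
    \<Rightarrow> ('p \<times> 'p \<times> 'p list) list list \<Rightarrow> bool" where
  "all_isos ix us L [] cs = True"
| "all_isos ix us L (hs # Hs) [] = False"
| "all_isos ix us L (hs # Hs) (c # cs) =
     (isos ix us L hs (exts us hs) c \<and> all_isos ix us L Hs cs)"

definition closes0 :: "('p \<times> 'p) list \<Rightarrow> 'p list \<Rightarrow> 'p triple list \<Rightarrow> 'p tree \<Rightarrow> bool" where
  "closes0 pat os hs t = closes pat os hs [] (build os hs) t"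

text \<open>The extensions are refuted as they stand, without passing to representatives, since no
  further system is built on them.\<close>

fun shut :: "('p \<times> 'p) list \<Rightarrow> 'p list \<Rightarrow> 'p triple list \<Rightarrow> 'p triple list \<Rightarrow> 'p tree list \<Rightarrow> bool" where
  "shut pat us hs [] ts = True"
| "shut pat us hs (e # es) [] = False"
| "shut pat us hs (e # es) (t # ts) =
     (closes0 pat (olds (e # hs) us) (e # hs) t \<and> shut pat us hs es ts)"

fun all_shut :: "('p \<times> 'p) list \<Rightarrow> 'p list \<Rightarrow> 'p triple list list \<Rightarrow> 'p tree list list \<Rightarrow> bool" where
  "all_shut pat us [] cs = True"
| "all_shut pat us (hs # Hs) [] = False"
| "all_shut pat us (hs # Hs) (c # cs) =
     (shut pat us hs (exts us hs) c \<and> all_shut pat us Hs cs)"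

section \<open>Soundness of the refutation trees\<close>

lemma set_holders: "set (holders hs x) = {h \<in> set hs. x \<in> tset h}"
  by (induction hs) auto

lemma is_single_iff: "is_single xs \<longleftrightarrow> (\<exists>x. xs = [x])"
  by (cases xs rule: is_single.cases) auto

lemma is_nil_iff: "is_nil xs \<longleftrightarrow> xs = []"
  by (cases xs) auto

lemma all_onceD: "all_once hs z \<Longrightarrow> h \<in> set hs \<Longrightarrow> once h z"
  by (induction hs) auto

lemma one_of3_iff: "one_of3 p q r \<longleftrightarrow> (p \<and> \<not> q \<and> \<not> r) \<or> (\<not> p \<and> q \<and> \<not> r) \<or> (\<not> p \<and> \<not> q \<and> r)"
  by (cases p; cases q; cases r) auto

lemma once_ex: "once h z \<Longrightarrow> \<exists>x\<in>tset h. x \<in> set z"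
  by (cases h) (auto simp: one_of3_iff)

lemma once_unique: "once h z \<Longrightarrow> x \<in> tset h \<Longrightarrow> y \<in> tset h \<Longrightarrow> x \<in> set z \<Longrightarrow> y \<in> set z \<Longrightarrow> x = y"
  by (cases h) (auto simp: one_of3_iff)

lemma no_edgeD: "no_edge es z \<Longrightarrow> (x, y) \<in> set es \<Longrightarrow> \<not> (x \<in> set z \<and> y \<in> set z)"
  by (induction es) auto

lemma closes_all_elem:
  "closes_all pat us hs es ms ps ts \<Longrightarrow> p \<in> set ps \<Longrightarrow> \<exists>t\<in>set ts. closes pat us hs (p # es) (link us ms p) t"
proof (induction ps arbitrary: ts)
  case (Cons q qs)
  then show ?case by (cases ts) auto
qed simp

lemma has_edgesD:
  "has_edges hs es us ss ps \<Longrightarrow> (x, y) \<in> set ps \<Longrightarrow> look us ss y \<in> set (nb hs es (look us ss x))"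
  by (induction ps) auto

context labelled_graph
begin

lemma edges_ok_Nil: "edges_ok []"
  by (simp add: edges_ok_def)

lemma mem_image: "x \<in> points \<Longrightarrow> h \<in> set hs \<Longrightarrow> f x \<in> f ` tset h \<Longrightarrow> x \<in> tset h"
  using inj by (auto dest!: inj_onD)

text \<open>Since \<open>T\<close> consists of all triangles, an edge demanded by criticality cannot
  close a known path of length two: that would be a triangle, hence a listed triple, which the
  checks of \<open>Split\<close> and \<open>Hang\<close> exclude. So the edge joins far points, is
  among the candidates, and one of the subtrees refutes it.\<close>

lemma closes_sound:
  assumes all: "T = triangles"
    and V: "V = \<Union>triangles"
    and uncol: "\<And>Z. Z \<subseteq> V \<Longrightarrow> (\<And>t. t \<in> triangles \<Longrightarrow> t \<inter> Z \<noteq> {}) \<Longrightarrow> \<exists>u\<in>Z. \<exists>v\<in>Z. E u v"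
    and deg: "\<And>v t. t \<in> triangles \<Longrightarrow> v \<in> t \<Longrightarrow> \<exists>u. E v u \<and> u \<notin> t"
    and pat: "\<And>g :: 'p \<Rightarrow> 'a. \<exists>(x, y)\<in>set pat. \<not> E (g x) (g y)"
    and us: "points \<subseteq> set us"
  shows "edges_ok es \<Longrightarrow> sound_rows hs es us ms \<Longrightarrow> closes pat us hs es ms t \<Longrightarrow> False"
proof (induction t arbitrary: es ms)
  case (Split z ts)
  then have once: "h \<in> set hs \<Longrightarrow> once h z" for h by (auto dest: all_onceD)
  have ne: "no_edge es z" and cl: "closes_all pat us hs es ms (inner_pairs us ms z) ts"
    using Split.prems by auto
  \<comment> \<open>The intersection discards labels in \<open>z\<close> that stand for no point of
    the graph.\<close>
  define Z where "Z = f ` (set z \<inter> points)"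
  have "Z \<subseteq> V" using copyD(5)[OF cp T] by (auto simp: Z_def V all)
  moreover have "t \<inter> Z \<noteq> {}" if "t \<in> triangles" for t
    using copyD(3)[OF cp T] that once_ex once all by (fastforce simp: Z_def)
  ultimately obtain x y where xy: "x \<in> set z" "x \<in> points" "y \<in> set z" "y \<in> points" "E (f x) (f y)"
    using uncol[of Z] by (auto simp: Z_def)
  \<comment> \<open>\<open>inner_pairs\<close> contains a pair in one order only. The claim is
    proved for that order and later used for both, by symmetry of \<open>E\<close>.\<close>
  have no: False if "x \<in> set z" "x \<in> points" "y \<in> set z" "y \<in> points" "E (f x) (f y)" "(x, y) \<in> set (pairs z)" for x y
  proof -
    have xny: "x \<noteq> y" using that E_irrefl by auto
    have sep: "\<not> (x \<in> tset h \<and> y \<in> tset h)" if "h \<in> set hs" for h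
      using once_unique[OF once[OF that]] xny \<open>x \<in> set z\<close> \<open>y \<in> set z\<close> by blast
    have "y \<notin> set (nb hs es x)"
      using sep no_edgeD[OF ne] that by (auto simp: nb_def nbt_char nbe_iff)
    moreover have "y \<notin> set (nb hs es m)" if m: "m \<in> set (nb hs es x)" for m
    proof
      assume y: "y \<in> set (nb hs es m)"
      have "{f x, f m, f y} \<in> triangles"
        using nb_points[OF Split.prems(1) m] nb_points[OF Split.prems(1) y] \<open>E (f x) (f y)\<close>
        unfolding triangles_def by blast
      then obtain h where h: "h \<in> set hs" "{f x, f m, f y} = f ` tset h"
        using copyD(3)[OF cp T] all by blast
      have "f x \<in> f ` tset h" "f y \<in> f ` tset h" using h(2) by blast+
      then have "x \<in> tset h" "y \<in> tset h"
        using mem_image[OF \<open>x \<in> points\<close> h(1)] mem_image[OF \<open>y \<in> points\<close> h(1)] by auto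
      then show False using sep[OF h(1)] by simp
    qed
    ultimately have "far hs es x y"
      using far_from_cover[OF Split.prems(1) \<open>x \<in> points\<close> \<open>y \<in> points\<close> \<open>E (f x) (f y)\<close>] by blast
    then have "(x, y) \<in> set (inner_pairs us ms z)"
      using inner_pairs_cover[OF Split.prems(2)] us that by blast
    then obtain t where t: "t \<in> set ts" "closes pat us hs ((x, y) # es) (link us ms (x, y)) t"
      using closes_all_elem[OF cl] by blast
    show False
    proof (rule Split.IH[OF t(1) _ _ t(2)])
      show "edges_ok ((x, y) # es)" using Split.prems(1) that by (auto simp: edges_ok_def)
    qed (rule sound_link_edge[OF Split.prems(2)])
  qed
  have "x \<noteq> y" using xy E_irrefl by auto
  from pairs_cover[OF xy(1,3) this] show False
    using no[OF xy] no[OF xy(3,4,1,2) E_sym[OF xy(5)]] by blast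
next
  case (Hang v ts)
  then obtain h where hv: "holders hs v = [h]" and nil: "nbe es v = []"
    and cl: "closes_all pat us hs es ms (tag v (offs us (reach us ms v))) ts"
    by (auto simp: is_single_iff is_nil_iff)
  have h: "h \<in> set hs" "v \<in> tset h" and uniq: "\<And>h'. h' \<in> set hs \<Longrightarrow> v \<in> tset h' \<Longrightarrow> h' = h"
    using set_holders[of hs v] hv by auto
  have v: "v \<in> points" using h by auto
  have tri: "f ` tset h \<in> triangles" using copyD(2)[OF cp T h(1)] T by auto
  obtain u where u: "E (f v) u" "u \<notin> f ` tset h" using deg[OF tri] h(2) by blast
  \<comment> \<open>The neighbour has a label because every vertex of \<open>V\<close> lies in a
    triangle and every triangle is labelled.\<close>
  then have "u \<in> f ` points" using E_V V copyD(5)[OF cp T] all by auto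
  then obtain y where y: "u = f y" "y \<in> points" by auto
  have yh: "y \<notin> tset h" using u y by auto
  have "y \<notin> set (nb hs es v)" using nil uniq yh by (auto simp: nb_def nbt_char)
  moreover have "y \<notin> set (nb hs es m)" if m: "m \<in> set (nb hs es v)" for m
  proof
    assume ym: "y \<in> set (nb hs es m)"
    have "{f v, f m, f y} \<in> triangles"
      using nb_points[OF Hang.prems(1) m] nb_points[OF Hang.prems(1) ym] u(1) y(1)
      unfolding triangles_def by blast
    then obtain h' where h': "h' \<in> set hs" "{f v, f m, f y} = f ` tset h'"
      using copyD(3)[OF cp T] all by blast
    have "f v \<in> f ` tset h'" "f y \<in> f ` tset h'" using h'(2) by blast+
    then have "v \<in> tset h'" "y \<in> tset h'"
      using mem_image[OF v h'(1)] mem_image[OF y(2) h'(1)] by auto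
    then show False using uniq[OF h'(1)] yh by auto
  qed
  ultimately have "far hs es v y"
    using far_from_cover[OF Hang.prems(1) v y(2)] u(1) y(1) by blast
  then have "(v, y) \<in> set (tag v (offs us (reach us ms v)))"
    using far_offs[OF Hang.prems(2)] us y(2) by auto
  then obtain t where t: "t \<in> set ts" "closes pat us hs ((v, y) # es) (link us ms (v, y)) t"
    using closes_all_elem[OF cl] by blast
  show False
  proof (rule Hang.IH[OF t(1) _ _ t(2)])
    show "edges_ok ((v, y) # es)" using Hang.prems(1) v y u(1) by (auto simp: edges_ok_def)
  qed (rule sound_link_edge[OF Hang.prems(2)])
next
  case (Rigid ss)
  \<comment> \<open>The relabelling \<open>look us ss\<close> carries each pair of the pattern to a
    known edge.\<close>
  then have "E (f (look us ss x)) (f (look us ss y))" if "(x, y) \<in> set pat" for x y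
    using nb_points(3)[OF Rigid.prems(1)] has_edgesD that by fastforce
  then show False using pat[of "\<lambda>x. f (look us ss x)"] by blast
qed

end

section \<open>Completeness of the generated lists\<close>

lemma olds_filter: "olds hs us = filter (\<lambda>x. \<exists>h\<in>set hs. x \<in> tset h) us"
proof (induction us)
  case (Cons u us)
  have "is_nil (holders hs u) \<longleftrightarrow> \<not> (\<exists>h\<in>set hs. u \<in> tset h)"
    unfolding is_nil_iff set_empty[symmetric] set_holders by auto
  then show ?case using Cons by simp
qed simp

lemma news_filter: "news hs us = filter (\<lambda>x. \<not> (\<exists>h\<in>set hs. x \<in> tset h)) us"
proof (induction us)
  case (Cons u us)
  have "is_nil (holders hs u) \<longleftrightarrow> \<not> (\<exists>h\<in>set hs. u \<in> tset h)"
    unfolding is_nil_iff set_empty[symmetric] set_holders by auto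
  then show ?case using Cons by simp
qed simp

lemma set_keep: "set (keep vs fr es) = {e \<in> set es. max_private vs e fr}"
  by (induction es) auto

lemma set_with1: "set (with1 a ps) = (\<lambda>(x, y). (x, y, a)) ` set ps"
  by (induction ps) auto

lemma set_with2: "set (with2 a b xs) = (\<lambda>x. (x, a, b)) ` set xs"
  by (induction xs) auto

lemma thirds_cover: "(y, z) \<in> set qs \<Longrightarrow> (x, z) \<in> set ps \<Longrightarrow> (x, y, z) \<in> set (thirds x y qs ps)"
proof (induction qs)
  case (Cons q qs)
  obtain u w where q: "q = (u, w)" by (cases q)
  show ?case using Cons by (cases "u = y") (auto simp: q)
qed simp

lemma cliques_cover:
  "(x, y) \<in> set qs \<Longrightarrow> (y, z) \<in> set ps \<Longrightarrow> (x, z) \<in> set ps \<Longrightarrow> (x, y, z) \<in> set (cliques qs ps)"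
  by (induction qs) (auto simp: thirds_cover)

lemma no_longer_iff: "no_longer xs ys \<longleftrightarrow> length xs \<le> length ys"
  by (induction xs ys rule: no_longer.induct) auto

lemma minus3_filter: "minus3 xs e = filter (\<lambda>x. x \<notin> tset e) xs"
  by (induction xs) auto

lemma singles_filter: "singles hs xs = filter (\<lambda>x. is_single (holders hs x)) xs"
  by (induction xs) auto

lemma max_privateI: "(\<And>v. v \<in> set vs \<Longrightarrow> length (minus3 v e) \<le> length fr) \<Longrightarrow> max_private vs e fr"
  by (induction vs) (auto simp: no_longer_iff)

lemma set_cons_nonempty: "set (cons_nonempty xs xss) \<subseteq> insert xs (set xss)"
  by (cases xs) auto

lemma privates_elem: "v \<in> set (privates hs rs) \<Longrightarrow> \<exists>a b c. (a, b, c) \<in> set rs \<and> v = singles hs [a, b, c]"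
proof (induction rs)
  case (Cons r rs)
  obtain a b c where r: "r = (a, b, c)" by (cases r)
  show ?case using Cons set_cons_nonempty[of "singles hs [a, b, c]" "privates hs rs"]
    unfolding r by (auto simp del: singles.simps)
qed simp

lemma inj_on_update1:
  "inj_on g X \<Longrightarrow> w \<notin> g ` X \<Longrightarrow> q \<notin> X \<Longrightarrow> inj_on (g(q := w)) (insert q X)"
  by (auto simp: inj_on_def)

lemma inj_on_update2:
  assumes "inj_on g X" "w \<notin> g ` X" "w' \<notin> g ` X" "w \<noteq> w'" "q \<notin> X" "q' \<notin> X" "q \<noteq> q'"
  shows "inj_on (g(q := w, q' := w')) (insert q' (insert q X))"
proof (rule inj_on_update1[OF inj_on_update1[OF assms(1,2,5)]])
  have "(g(q := w)) ` insert q X = insert w (g ` X)" using assms(5) by auto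
  then show "w' \<notin> (g(q := w)) ` insert q X" using assms(3,4) by simp
qed (use assms in simp)

lemma inj_on_update3:
  assumes "inj_on g X" "w \<notin> g ` X" "w' \<notin> g ` X" "w'' \<notin> g ` X" "w \<noteq> w'" "w' \<noteq> w''" "w \<noteq> w''"
    "q \<notin> X" "q' \<notin> X" "q'' \<notin> X" "q \<noteq> q'" "q \<noteq> q''" "q' \<noteq> q''"
  shows "inj_on (g(q := w, q' := w', q'' := w'')) (insert q'' (insert q' (insert q X)))"
proof (rule inj_on_update1[OF inj_on_update2[OF assms(1,2,3,5,8,9,11)]])
  have "(g(q := w, q' := w')) ` insert q' (insert q X) = insert w' (insert w (g ` X))"
    using assms by auto
  then show "w'' \<notin> (g(q := w, q' := w')) ` insert q' (insert q X)" using assms by simp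
qed (use assms in simp)

section \<open>Private points and removal of a triangle\<close>

context square_free_graph
begin

definition own :: "'a set set \<Rightarrow> 'a set \<Rightarrow> 'a set" where
  "own S t = t - \<Union>(S - {t})"

text \<open>Every point lies in two triangles or is private to one, so counting it once for each of its
  triangles, and once more if it is private, counts it at least twice.\<close>

lemma private_count:
  assumes S: "S \<subseteq> triangles" and max: "\<And>t. t \<in> S \<Longrightarrow> card (own S t) \<le> k"
  shows "2 * card (\<Union>S) \<le> 3 * card S + card S * k"
proof -
  have fin: "finite S" "finite (\<Union>S)"
    using S finite_triangles triangle_finite by (auto intro: finite_subset)
  have "2 * card (\<Union>S) = (\<Sum>x\<in>\<Union>S. 2)" by simp
  also have "\<dots> \<le> (\<Sum>x\<in>\<Union>S. \<Sum>t\<in>S. of_bool (x \<in> t) + of_bool (x \<in> own S t))"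
  proof (rule sum_mono)
    fix x assume "x \<in> \<Union>S"
    then obtain t where t: "t \<in> S" "x \<in> t" by auto
    let ?g = "\<lambda>t. of_bool (x \<in> t) + of_bool (x \<in> own S t) :: nat"
    show "2 \<le> sum ?g S"
    proof (cases "x \<in> own S t")
      case True
      then have "2 = sum ?g {t}" using t by simp
      also have "\<dots> \<le> sum ?g S" by (rule sum_mono2) (use fin t in auto)
      finally show ?thesis .
    next
      case False
      then obtain t' where t': "t' \<in> S" "t' \<noteq> t" "x \<in> t'" using t by (auto simp: own_def)
      have "2 \<le> sum ?g {t, t'}" using t t' by simp
      also have "\<dots> \<le> sum ?g S" by (rule sum_mono2) (use fin t t' in auto)
      finally show ?thesis .
    qed
  qed
  also have "\<dots> = (\<Sum>t\<in>S. \<Sum>x\<in>\<Union>S. of_bool (x \<in> t) + of_bool (x \<in> own S t))"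
    by (rule sum.swap)
  also have "\<dots> = (\<Sum>t\<in>S. card t + card (own S t))"
  proof (rule sum.cong[OF refl])
    fix t assume "t \<in> S"
    then have "\<Union>S \<inter> t = t" "\<Union>S \<inter> own S t = own S t" by (auto simp: own_def)
    then show "(\<Sum>x\<in>\<Union>S. of_bool (x \<in> t) + of_bool (x \<in> own S t)) = card t + card (own S t)"
      using fin by (simp add: sum.distrib Int_def flip: sum.inter_filter)
  qed
  also have "\<dots> \<le> (\<Sum>t\<in>S. 3 + k)"
    by (rule sum_mono) (use max S triangle_card in fastforce)
  finally show ?thesis by (simp add: algebra_simps)
qed

definition covers :: "nat \<Rightarrow> nat \<Rightarrow> 'p triple list list \<Rightarrow> bool" where
  "covers k N L \<longleftrightarrow>
     (\<forall>S\<subseteq>triangles. card S = k \<longrightarrow> card (\<Union>S) \<le> N \<longrightarrow> (\<exists>hs\<in>set L. \<exists>f. copy f hs S))"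

text \<open>The private points were computed before \<open>e\<close> was added. Taking away the
  points of \<open>e\<close> leaves those that are private in the new system, and they inject into
  \<open>own S\<close> of the corresponding triangle.\<close>

lemma max_private_privates:
  assumes S: "S \<subseteq> triangles" and cp: "copy f (e # hs) S"
    and max: "\<And>t. t \<in> S \<Longrightarrow> card (own S t) \<le> length fr"
  shows "max_private (privates hs hs) e fr"
proof (rule max_privateI)
  interpret X: labelled_graph V E f "e # hs" S by unfold_locales (use S cp in auto)
  fix v assume "v \<in> set (privates hs hs)"
  then obtain a b c where abc: "(a, b, c) \<in> set hs" and v: "v = singles hs [a, b, c]"
    using privates_elem by blast
  let ?t = "f ` {a, b, c}"
  have ne: "a \<noteq> b" "b \<noteq> c" "a \<noteq> c" using copy_distinct[OF cp S, of a b c] abc by auto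
  have tS: "?t \<in> S" using copyD(2)[OF cp S, of "(a, b, c)"] abc by auto
  have pts: "{a, b, c} \<subseteq> X.points" using abc by fastforce
  define w where "w = minus3 v e"
  have set_w: "set w = {x \<in> {a, b, c}. is_single (holders hs x) \<and> x \<notin> tset e}"
    unfolding w_def v singles_filter minus3_filter set_filter by auto
  have w: "set w \<subseteq> {a, b, c}" unfolding set_w by auto
  have distinct_w: "distinct w"
    unfolding w_def v singles_filter minus3_filter by (intro distinct_filter) (use ne in auto)
  have "f ` set w \<subseteq> own S ?t"
  proof
    fix y assume "y \<in> f ` set w"
    then obtain x where x: "x \<in> set w" "y = f x" by auto
    then have xs: "is_single (holders hs x)" "x \<notin> tset e" "x \<in> {a, b, c}"
      unfolding set_w by auto
    have "f x \<notin> t'" if t': "t' \<in> S" "t' \<noteq> ?t" for t'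
    proof
      assume fx: "f x \<in> t'"
      obtain h where h: "h \<in> set (e # hs)" "t' = f ` tset h" using copyD(3)[OF cp S t'(1)] by blast
      have "x \<in> tset h" using X.mem_image[OF _ h(1)] fx h(2) pts xs(3) by blast
      then have "h \<in> set (holders hs x)" "(a, b, c) \<in> set (holders hs x)"
        using h(1) xs(2,3) abc by (auto simp: set_holders)
      then have "h = (a, b, c)" using xs(1) by (auto simp: is_single_iff)
      then show False using h(2) t'(2) by simp
    qed
    then show "y \<in> own S ?t" using x(2) xs(3) by (auto simp: own_def)
  qed
  moreover have "finite (own S ?t)" by (simp add: own_def)
  ultimately have "card (f ` set w) \<le> card (own S ?t)" by (rule card_mono[rotated])
  moreover have "inj_on f (set w)" using X.inj w pts by (meson inj_on_subset subset_trans)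
  ultimately have "length w \<le> card (own S ?t)"
    using distinct_w by (simp add: card_image distinct_card)
  then show "length (minus3 v e) \<le> length fr" using max[OF tS] by (simp add: w_def)
qed

lemma copy_insert:
  assumes cp: "copy g hs S'" and S': "S' = S - {t}" and S: "S \<subseteq> triangles" and t: "t \<in> S"
    and agree: "\<And>x. x \<in> \<Union>(tset ` set hs) \<Longrightarrow> f x = g x" and im: "f ` tset e = t"
    and inj: "inj_on f (\<Union>(tset ` set hs) \<union> tset e)"
  shows "copy f (e # hs) S"
proof -
  have "f ` tset h = g ` tset h" if "h \<in> set hs" for h
    by (rule image_cong) (use agree that in auto)
  then have "(\<lambda>h. f ` tset h) ` set hs = (\<lambda>h. g ` tset h) ` set hs" by (rule image_cong[OF refl])
  then have 1: "(\<lambda>h. f ` tset h) ` set hs = S'" using cp unfolding copy_def by metis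
  have "finite S" by (rule finite_subset[OF S finite_triangles])
  then have 2: "card S = Suc (card S')" unfolding S' by (rule card.remove[OF _ t])
  show ?thesis unfolding copy_def
  proof (intro conjI)
    show "inj_on f (\<Union>(tset ` set (e # hs)))" using inj by (simp add: Un_commute)
    show "(\<lambda>h. f ` tset h) ` set (e # hs) = S" using 1 im t S' by auto
    show "length (e # hs) = card S" using cp 2 by (simp add: copy_def)
  qed
qed

text \<open>Remove a triangle \<open>t\<close> with most private points. The rest is a copy of a
  listed system, and \<open>t\<close> reappears as an extension whose fresh labels stand for its
  private points. Because \<open>t\<close> was chosen maximal, this extension passes the filter
  \<open>max_private\<close>.\<close>

theorem extend:
  assumes cov: "covers k M L"
    and arith: "\<And>m. m \<le> N \<Longrightarrow> M < m \<Longrightarrow> 3 * Suc k + Suc k * (m - Suc M) < 2 * m"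
    and S: "S \<subseteq> triangles" "card S = Suc k" "card (\<Union>S) \<le> N"
    and us: "distinct us" "length us = N" "\<And>hs. hs \<in> set L \<Longrightarrow> \<Union>(tset ` set hs) \<subseteq> set us"
  shows "\<exists>hs\<in>set L. \<exists>e\<in>set (exts us hs). \<exists>f. copy f (e # hs) S"
proof -
  have fin: "finite S" "finite (\<Union>S)"
    using S finite_triangles triangle_finite by (auto intro: finite_subset)
  have "S \<noteq> {}" using S(2) by auto
  then obtain t where t: "t \<in> S" and tmax: "\<And>t'. t' \<in> S \<Longrightarrow> card (own S t') \<le> card (own S t)"
  proof -
    have "Max ((\<lambda>t. card (own S t)) ` S) \<in> (\<lambda>t. card (own S t)) ` S"
      using fin(1) \<open>S \<noteq> {}\<close> by (intro Max_in) auto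
    then obtain t where "t \<in> S" "card (own S t) = Max ((\<lambda>t. card (own S t)) ` S)" by auto
    then show ?thesis using that[of t] fin(1) by simp
  qed
  define S' where "S' = S - {t}"
  define P' where "P' = own S t"
  have tT: "t \<in> triangles" using t S by auto
  have S'T: "S' \<subseteq> triangles" using S by (auto simp: S'_def)
  have cS': "card S' = k" using S t fin by (simp add: S'_def)
  have split: "\<Union>S = \<Union>S' \<union> P'" "\<Union>S' \<inter> P' = {}" "t \<subseteq> \<Union>S' \<union> P'" "P' \<subseteq> t"
    using t by (auto simp: S'_def P'_def own_def)
  have card_split: "card (\<Union>S) = card (\<Union>S') + card P'"
    using split fin by (simp add: card_Un_disjoint)
  have count: "2 * card (\<Union>S) \<le> 3 * Suc k + Suc k * card P'"
    using private_count[OF S(1) tmax] S(2) by (simp add: P'_def)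
  \<comment> \<open>Were more than \<open>M\<close> points left, \<open>t\<close> would have at most
    \<open>m - Suc M\<close> private points out of \<open>m\<close> points in total; as no triangle
    has more, \<open>count\<close> would contradict \<open>arith\<close>.\<close>
  have M: "card (\<Union>S') \<le> M"
  proof (rule ccontr)
    assume "\<not> card (\<Union>S') \<le> M"
    then have "card P' \<le> card (\<Union>S) - Suc M" "M < card (\<Union>S)" using card_split by linarith+
    then have "Suc k * card P' \<le> Suc k * (card (\<Union>S) - Suc M)" by (intro mult_le_mono2)
    moreover have "3 * Suc k + Suc k * (card (\<Union>S) - Suc M) < 2 * card (\<Union>S)"
      using arith[OF S(3)] \<open>M < card (\<Union>S)\<close> by blast
    ultimately show False using count by linarith
  qed
  obtain hs g where hs: "hs \<in> set L" and cp: "copy g hs S'"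
    using cov S'T cS' M by (auto simp: covers_def)
  interpret G: labelled_graph V E g hs S' by unfold_locales (use S'T cp in auto)
  note pts = us(3)[OF hs]
  define os qs where "os = olds hs us" and "qs = news hs us"
  have os: "set os = G.points" using pts by (auto simp: os_def olds_filter)
  have qs: "set qs = set us - G.points" "distinct qs" using us(1) by (auto simp: qs_def news_filter)
  have gP: "g ` G.points = \<Union>S'" using copyD(5)[OF cp S'T] .
  have cP: "card G.points = card (\<Union>S')" using card_image[OF G.inj] gP by simp
  have "length qs = card (set us - G.points)" using qs by (metis distinct_card)
  also have "\<dots> = N - card G.points"
    using card_Diff_subset[OF finite_subset[OF pts] pts] us(1,2) by (simp add: distinct_card)
  finally have lq: "card P' \<le> length qs" using cP card_split S(3) by linarith
  have cP3: "card P' \<le> 3" using card_mono[OF triangle_finite[OF tT] split(4)] triangle_card[OF tT] by simp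
  have finP': "finite P'" using split(4) triangle_finite[OF tT] by (rule finite_subset)
  have exts: "exts us hs = exts_of (privates hs hs) os (free_pairs os (build os hs) os) qs"
    by (simp add: exts_def exts_from_def os_def qs_def)
  \<comment> \<open>If two old points of \<open>t\<close> shared an old triangle, or were joined by
    a path of two old edges, then \<open>t\<close> would share an edge with an old triangle and
    coincide with it. But \<open>t\<close> has been removed.\<close>
  have far: "far hs [] x y" if xy: "x \<in> G.points" "y \<in> G.points" "x \<noteq> y" "g x \<in> t" "g y \<in> t" for x y
  proof -
    have gxy: "g x \<noteq> g y" using xy G.inj by (auto dest: inj_onD)
    have E: "E (g x) (g y)" using triangle_edge[OF tT] xy gxy by auto
    have new: "t \<noteq> g ` tset h" if "h \<in> set hs" for h
      using copyD(2)[OF cp S'T that] by (auto simp: S'_def)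
    have "y \<notin> set (nb hs [] x)"
    proof
      assume "y \<in> set (nb hs [] x)"
      then obtain h where h: "h \<in> set hs" "x \<in> tset h" "y \<in> tset h" by (auto simp: nb_def G.nbt_char)
      have ht: "g ` tset h \<in> triangles" by (rule subsetD[OF S'T copyD(2)[OF cp S'T h(1)]])
      have "t = g ` tset h" by (rule triangle_eqI[OF tT ht xy(4,5) _ _ gxy]) (use h in auto)
      then show False using new[OF h(1)] by simp
    qed
    moreover have "y \<notin> set (nb hs [] m)" if m: "m \<in> set (nb hs [] x)" for m
    proof
      assume ym: "y \<in> set (nb hs [] m)"
      have tri: "{g x, g m, g y} \<in> triangles"
        using G.nb_points[OF G.edges_ok_Nil m] G.nb_points[OF G.edges_ok_Nil ym] E
        unfolding triangles_def by blast
      have eq: "t = {g x, g m, g y}" by (rule triangle_eqI[OF tT tri]) (use xy gxy in auto)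
      obtain h where h: "h \<in> set hs" "x \<in> tset h" "m \<in> tset h" using m by (auto simp: nb_def G.nbt_char)
      have ht: "g ` tset h \<in> triangles" by (rule subsetD[OF S'T copyD(2)[OF cp S'T h(1)]])
      have "g x \<noteq> g m" using G.nb_points(3)[OF G.edges_ok_Nil m] E_irrefl by metis
      then have "t = g ` tset h" by (intro triangle_eqI[OF tT ht, of "g x" "g m"]) (use eq h in auto)
      then show False using new[OF h(1)] by simp
    qed
    ultimately show ?thesis using G.far_from_cover[OF G.edges_ok_Nil xy(1,2) E] by blast
  qed
  define fs where "fs = free_pairs os (build os hs) os"
  have fs: "(x, y) \<in> set fs"
    if "(x, y) \<in> set (pairs os)" "x \<in> G.points" "y \<in> G.points" "x \<noteq> y" "g x \<in> t" "g y \<in> t" for x y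
    unfolding fs_def by (rule free_pairs_cover[OF sound_build far[OF that(2-6)] that(1)])
  have key: "\<exists>f. copy f (e # hs) S \<and> max_private (privates hs hs) e fr"
    if "inj_on f (G.points \<union> tset e)" "\<And>x. x \<in> G.points \<Longrightarrow> f x = g x" "f ` tset e = t" "length fr = card P'"
    for e f fr
  proof -
    have c: "copy f (e # hs) S" by (rule copy_insert[OF cp S'_def S(1) t that(2,3,1)])
    have "max_private (privates hs hs) e fr"
      by (rule max_private_privates[OF S(1) c]) (use tmax that(4) in \<open>simp add: P'_def\<close>)
    with c show ?thesis by blast
  qed
  \<comment> \<open>The points of \<open>t\<close> are either old, with labels in \<open>Q\<close>,
    or private.\<close>
  have tdec: "t = (t \<inter> \<Union>S') \<union> P'" using split(3,4) by blast
  have old: "t \<inter> \<Union>S' = g ` {x \<in> G.points. g x \<in> t}" unfolding gP[symmetric] by auto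
  define Q where "Q = {x \<in> G.points. g x \<in> t}"
  have Q: "t = g ` Q \<union> P'" "Q \<subseteq> G.points" using tdec unfolding old Q_def by auto
  have gQ: "g ` Q \<inter> P' = {}" using split(2) image_mono[OF Q(2), of g] unfolding gP by blast
  have finQ: "finite Q" by (rule finite_subset[OF Q(2)]) (simp add: os[symmetric])
  have "inj_on g Q" using G.inj Q(2) by (rule inj_on_subset)
  then have cQ: "card Q + card P' = 3"
    using triangle_card[OF tT] Q(1) card_Un_disjoint[OF finite_imageI[OF finQ] finP' gQ] by (simp add: card_image)
  have m0: "e \<in> set (exts us hs)" if "e \<in> set (cliques fs fs)" "max_private (privates hs hs) e []" for e
    using that by (simp add: exts exts_of_def fs_def set_keep)
  have m1: "e \<in> set (exts us hs)"
    if "qs = q # qs'" "e \<in> set (with1 q fs)" "max_private (privates hs hs) e [q]" for e q qs'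
    using that by (simp add: exts exts_of_def fs_def set_keep)
  have m2: "e \<in> set (exts us hs)"
    if "qs = q # q' # qs'" "e \<in> set (with2 q q' os)" "max_private (privates hs hs) e [q, q']" for e q q' qs'
    using that by (simp add: exts exts_of_def set_keep)
  have m3: "(q, q', q'') \<in> set (exts us hs)"
    if "qs = q # q' # q'' # qs'" "max_private (privates hs hs) (q, q', q'') [q, q', q'']" for q q' q'' qs'
    using that by (simp add: exts exts_of_def set_keep)
  have Q_points: "x \<in> G.points" "g x \<in> t" if "x \<in> Q" for x
    using that by (simp_all add: Q_def)
  have "\<exists>e\<in>set (exts us hs). \<exists>f. copy f (e # hs) S"
  proof -
    consider "card P' = 0" | "card P' = 1" | "card P' = 2" | "card P' = 3" using cP3 by linarith
    then show ?thesis
    proof cases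
      case 1
      then have P0: "P' = {}" using finP' by simp
      have "card Q = 3" using cQ 1 by simp
      then obtain x y z where xyz: "Q = {x, y, z}" "x \<noteq> y" "y \<noteq> z" "x \<noteq> z"
        unfolding card_3_iff by blast
      have "x \<in> set os" "y \<in> set os" "z \<in> set os" using Q_points(1) xyz(1) os by simp_all
      \<comment> \<open>The three old points are put in the order in which the computed list of
        triples contains them.\<close>
      from pairs_cover3[OF this xyz(2-4)] obtain a b c where abc: "{a, b, c} = {x, y, z}"
        "(a, b) \<in> set (pairs os)" "(b, c) \<in> set (pairs os)" "(a, c) \<in> set (pairs os)" by blast
      have Qabc: "Q = {a, b, c}" unfolding abc(1) xyz(1) by (rule refl)
      have ne: "a \<noteq> b" "b \<noteq> c" "a \<noteq> c"
        using \<open>card Q = 3\<close> unfolding Qabc by (auto simp: card_insert_if split: if_splits)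
      have pt: "a \<in> G.points" "b \<in> G.points" "c \<in> G.points" "g a \<in> t" "g b \<in> t" "g c \<in> t"
        by (rule Q_points, simp add: Qabc)+
      have mem: "(a, b, c) \<in> set (cliques fs fs)"
        by (intro cliques_cover fs abc ne pt)
      have "\<exists>f. copy f ((a, b, c) # hs) S \<and> max_private (privates hs hs) (a, b, c) []"
      proof (rule key[of g])
        have "G.points \<union> tset (a, b, c) = G.points" using pt(1-3) by (simp add: insert_absorb)
        then show "inj_on g (G.points \<union> tset (a, b, c))" using G.inj by simp
        show "g ` tset (a, b, c) = t" unfolding Q(1) Qabc P0 by simp
      qed (use 1 in simp_all)
      then show ?thesis using m0[OF mem] by blast
    next
      case 2
      then obtain w where w: "P' = {w}" by (rule card_1_singletonE)
      obtain q qs' where q: "qs = q # qs'" using lq 2 by (cases qs) auto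
      have qn: "q \<notin> G.points" using qs(1) unfolding q by auto
      have "card Q = 2" using cQ 2 by simp
      then obtain x y where xy: "Q = {x, y}" "x \<noteq> y" unfolding card_2_iff by blast
      have "x \<in> set os" "y \<in> set os" using Q_points(1) xy(1) os by simp_all
      from pairs_cover[OF this xy(2)] obtain a b where ab: "{a, b} = {x, y}" "(a, b) \<in> set (pairs os)" by blast
      have Qab: "Q = {a, b}" unfolding ab(1) xy(1) by (rule refl)
      have ne: "a \<noteq> b" using \<open>card Q = 2\<close> unfolding Qab by auto
      have pab: "a \<in> G.points" "b \<in> G.points" "g a \<in> t" "g b \<in> t"
        by (rule Q_points, simp add: Qab)+
      have "(a, b) \<in> set fs" by (rule fs[OF ab(2) pab(1,2) ne pab(3,4)])
      then have m: "(a, b, q) \<in> set (with1 q fs)" by (force simp: set_with1)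
      have wn: "w \<notin> g ` G.points" using split(2) unfolding w gP by auto
      have "\<exists>f. copy f ((a, b, q) # hs) S \<and> max_private (privates hs hs) (a, b, q) [q]"
      \<comment> \<open>The fresh label takes the private point as its value; old labels keep
        theirs. The cases of two and three private points are alike.\<close>
      proof (rule key[of "g(q := w)"])
        have "inj_on (g(q := w)) (insert q G.points)"
          by (rule inj_on_update1[OF G.inj wn qn])
        moreover have "G.points \<union> tset (a, b, q) = insert q G.points" using pab(1,2) by auto
        ultimately show "inj_on (g(q := w)) (G.points \<union> tset (a, b, q))" by simp
        have "a \<noteq> q" "b \<noteq> q" using qn pab(1,2) by auto
        then show "(g(q := w)) ` tset (a, b, q) = t" unfolding Q(1) Qab w by auto
        show "(g(q := w)) x = g x" if "x \<in> G.points" for x using that qn by auto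
      qed (use 2 in simp)
      then show ?thesis using m1[OF q m] by blast
    next
      case 3
      then obtain w w' where w: "P' = {w, w'}" "w \<noteq> w'" unfolding card_2_iff by blast
      obtain q q' qs' where q: "qs = q # q' # qs'" using lq 3
        by (metis Suc_le_length_iff numeral_2_eq_2)
      have qn: "q \<notin> G.points" "q' \<notin> G.points" "q \<noteq> q'" using qs unfolding q by auto
      have "card Q = 1" using cQ 3 by simp
      then obtain a where Qa: "Q = {a}" by (rule card_1_singletonE)
      have pa: "a \<in> G.points" "g a \<in> t" by (rule Q_points, simp add: Qa)+
      have m: "(a, q, q') \<in> set (with2 q q' os)" using pa(1) by (simp add: set_with2 os)
      have wn: "w \<notin> g ` G.points" "w' \<notin> g ` G.points" using split(2) unfolding w(1) gP by auto
      have "\<exists>f. copy f ((a, q, q') # hs) S \<and> max_private (privates hs hs) (a, q, q') [q, q']"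
      proof (rule key[of "g(q := w, q' := w')"])
        have "inj_on (g(q := w, q' := w')) (insert q' (insert q G.points))"
          by (rule inj_on_update2[OF G.inj wn w(2) qn])
        moreover have "G.points \<union> tset (a, q, q') = insert q' (insert q G.points)" using pa(1) by auto
        ultimately show "inj_on (g(q := w, q' := w')) (G.points \<union> tset (a, q, q'))" by simp
        have "a \<noteq> q" "a \<noteq> q'" using qn pa(1) by auto
        then show "(g(q := w, q' := w')) ` tset (a, q, q') = t" unfolding Q(1) Qa w(1) using qn(3) by auto
        show "(g(q := w, q' := w')) x = g x" if "x \<in> G.points" for x using that qn by auto
      qed (use 3 in simp)
      then show ?thesis using m2[OF q m] by blast
    next
      case 4
      then obtain w w' w'' where w: "P' = {w, w', w''}" "w \<noteq> w'" "w' \<noteq> w''" "w \<noteq> w''"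
        unfolding card_3_iff by blast
      obtain q q' q'' qs' where q: "qs = q # q' # q'' # qs'" using lq 4
        by (metis Suc_le_length_iff numeral_3_eq_3)
      have qn: "q \<notin> G.points" "q' \<notin> G.points" "q'' \<notin> G.points" "q \<noteq> q'" "q \<noteq> q''" "q' \<noteq> q''"
        using qs unfolding q by auto
      have Q0: "Q = {}" using cQ 4 finQ by simp
      have wn: "w \<notin> g ` G.points" "w' \<notin> g ` G.points" "w'' \<notin> g ` G.points"
        using split(2) unfolding w(1) gP by auto
      have "\<exists>f. copy f ((q, q', q'') # hs) S \<and> max_private (privates hs hs) (q, q', q'') [q, q', q'']"
      proof (rule key[of "g(q := w, q' := w', q'' := w'')"])
        have "inj_on (g(q := w, q' := w', q'' := w'')) (insert q'' (insert q' (insert q G.points)))"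
          by (rule inj_on_update3[OF G.inj wn w(2-4) qn])
        moreover have "G.points \<union> tset (q, q', q'') = insert q'' (insert q' (insert q G.points))" by auto
        ultimately show "inj_on (g(q := w, q' := w', q'' := w'')) (G.points \<union> tset (q, q', q''))" by simp
        show "(g(q := w, q' := w', q'' := w'')) ` tset (q, q', q'') = t"
          unfolding Q(1) Q0 w(1) using qn(4-6) by auto
        show "(g(q := w, q' := w', q'' := w'')) x = g x" if "x \<in> G.points" for x using that qn by auto
      qed (use 4 in simp)
      then show ?thesis using m3[OF q] by blast
    qed
  qed
  then show ?thesis using hs by blast
qed

end

section \<open>Correctness of the certificates for lists\<close>

lemma same_length_iff: "same_length xs ys \<longleftrightarrow> length xs = length ys"
  by (induction xs ys rule: same_length.induct) auto

lemma no_dup_iff: "no_dup xs \<longleftrightarrow> distinct xs"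
  by (induction xs) auto

lemma same3_iff: "same3 r h \<longleftrightarrow> tset r \<subseteq> tset h"
proof -
  obtain a b c where r: "r = (a, b, c)" by (cases r)
  show ?thesis unfolding r by (cases "in3 a h") auto
qed

lemma some_same_iff: "some_same r hs \<longleftrightarrow> (\<exists>h\<in>set hs. tset r \<subseteq> tset h)"
proof (induction hs)
  case (Cons h hs)
  then show ?case by (cases "same3 r h") (auto simp: same3_iff)
qed simp

lemma maps_into_iff: "maps_into us ss rs hs \<longleftrightarrow> (\<forall>r\<in>set rs. \<exists>h\<in>set hs. tset (relabel us ss r) \<subseteq> tset h)"
  by (induction rs) (auto simp: some_same_iff)

lemma tset_relabel: "tset (relabel us ss r) = look us ss ` tset r"
  by (cases r) auto

lemma look_nth: "distinct us \<Longrightarrow> length us = length ss \<Longrightarrow> i < length us \<Longrightarrow> look us ss (us ! i) = ss ! i"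
proof (induction us arbitrary: ss i)
  case (Cons u us)
  obtain s ss' where ss: "ss = s # ss'" using Cons.prems by (cases ss) auto
  show ?case
  proof (cases i)
    case (Suc j)
    then have "us ! j \<noteq> u" using Cons.prems by auto
    then show ?thesis using Cons Suc ss by simp
  qed (simp add: ss)
qed simp

lemma inj_on_look:
  assumes "distinct us" "length us = length ss" "distinct ss"
  shows "inj_on (look us ss) (set us)"
proof (rule inj_onI)
  fix x y assume xy: "x \<in> set us" "y \<in> set us" "look us ss x = look us ss y"
  obtain i j where "i < length us" "x = us ! i" "j < length us" "y = us ! j"
    using xy(1,2) by (auto simp: in_set_conv_nth)
  then show "x = y" using xy(3) look_nth[OF assms(1,2)] assms(2,3) by (simp add: nth_eq_iff_index_eq)
qed

lemma wf_triplesD: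
  assumes "wf_triples us rs"
  shows "\<Union>(tset ` set rs) \<subseteq> set us" "r \<in> set rs \<Longrightarrow> card (tset r) = 3" "distinct rs" "inj_on tset (set rs)"
proof -
  have "\<Union>(tset ` set rs) \<subseteq> set us \<and> (\<forall>r\<in>set rs. card (tset r) = 3) \<and> distinct rs \<and> inj_on tset (set rs)"
    using assms
  proof (induction rs)
    case (Cons r rs)
    obtain a b c where r: "r = (a, b, c)" by (cases r)
    have "tset r \<notin> tset ` set rs" using Cons.prems r by (auto simp: some_same_iff)
    moreover from this have "r \<notin> set rs" by auto
    ultimately show ?case using Cons r by (auto simp: no_dup_iff)
  qed simp
  then show "\<Union>(tset ` set rs) \<subseteq> set us" "r \<in> set rs \<Longrightarrow> card (tset r) = 3" "distinct rs" "inj_on tset (set rs)"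
    by auto
qed

lemma pick_subset: "set (pick us p xs) \<subseteq> set xs"
proof (induction us arbitrary: xs)
  case (Cons u us)
  show ?case
  proof (cases xs)
    case (Cons x xs')
    then show ?thesis using Cons.IH[of xs'] by (cases "p = u") auto
  qed simp
qed simp

lemma isosD:
  "isos ix us L hs es cs \<Longrightarrow> e \<in> set es \<Longrightarrow> \<exists>rs\<in>set (concat L). \<exists>ss. iso_ok us rs (e # hs) ss"
proof (induction es arbitrary: cs)
  case (Cons e' es)
  then obtain p q ss cs' where cs: "cs = (p, q, ss) # cs'" by (cases cs) auto
  have any: "\<exists>rs\<in>set (concat L). \<exists>ss. iso_ok us rs (e' # hs) ss"
  proof -
    have *: "iso_any us (pick_in ix q (pick ix p L)) (e' # hs) (fill ss us)" using Cons.prems cs by simp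
    then obtain rs Rs where R: "pick_in ix q (pick ix p L) = rs # Rs"
      by (cases "pick_in ix q (pick ix p L)") auto
    then obtain xs xss where x: "pick ix p L = xs # xss" by (cases "pick ix p L") auto
    have "xs \<in> set L" using pick_subset[of ix p L] x by auto
    moreover have "rs \<in> set xs" using R x pick_subset[of ix q xs] by auto
    ultimately show ?thesis using * R by auto
  qed
  show ?case
  proof (cases "e = e'")
    case False
    then show ?thesis using Cons.IH[of cs'] Cons.prems cs by simp
  qed (use any in simp)
qed simp

lemma all_isosD:
  "all_isos ix us L Hs cs \<Longrightarrow> hs \<in> set Hs \<Longrightarrow> e \<in> set (exts us hs) \<Longrightarrow>
   \<exists>rs\<in>set (concat L). \<exists>ss. iso_ok us rs (e # hs) ss"
proof (induction Hs arbitrary: cs)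
  case (Cons h Hs)
  obtain c cs' where cs: "cs = c # cs'" using Cons.prems by (cases cs) auto
  then have "isos ix us L h (exts us h) c" "all_isos ix us L Hs cs'" using Cons.prems(1) by simp_all
  then show ?case using isosD[of ix us L h "exts us h" c e] Cons.IH[of cs'] Cons.prems(2,3)
    by (cases "hs = h") simp_all
qed simp

lemma rows_isosD:
  assumes "list_all2 (all_isos ix us L) Hss css" "hs \<in> set (concat Hss)" "e \<in> set (exts us hs)"
  shows "\<exists>rs\<in>set (concat L). \<exists>ss. iso_ok us rs (e # hs) ss"
proof -
  obtain Hs where Hs: "Hs \<in> set Hss" "hs \<in> set Hs" using assms(2) by auto
  then obtain cs where "all_isos ix us L Hs cs" using assms(1) by (auto simp: list_all2_conv_all_nth in_set_conv_nth)
  then show ?thesis using all_isosD[OF _ Hs(2) assms(3)] by blast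
qed

lemma shutD: "shut pat us hs es ts \<Longrightarrow> e \<in> set es \<Longrightarrow> \<exists>t. closes0 pat (olds (e # hs) us) (e # hs) t"
proof (induction es arbitrary: ts)
  case (Cons e' es)
  then show ?case by (cases ts) auto
qed simp

lemma all_shutD:
  "all_shut pat us Hs cs \<Longrightarrow> hs \<in> set Hs \<Longrightarrow> e \<in> set (exts us hs) \<Longrightarrow>
   \<exists>t. closes0 pat (olds (e # hs) us) (e # hs) t"
proof (induction Hs arbitrary: cs)
  case (Cons h Hs)
  obtain c cs' where cs: "cs = c # cs'" using Cons.prems by (cases cs) auto
  then have "shut pat us h (exts us h) c" "all_shut pat us Hs cs'" using Cons.prems(1) by simp_all
  then show ?case using shutD[of pat us h "exts us h" c e] Cons.IH[of cs'] Cons.prems(2,3)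
    by (cases "hs = h") simp_all
qed simp

lemma rows_shutD:
  assumes "list_all2 (all_shut pat us) Hss css" "hs \<in> set (concat Hss)" "e \<in> set (exts us hs)"
  shows "\<exists>t. closes0 pat (olds (e # hs) us) (e # hs) t"
proof -
  obtain Hs where Hs: "Hs \<in> set Hss" "hs \<in> set Hs" using assms(2) by auto
  then obtain cs where "all_shut pat us Hs cs" using assms(1) by (auto simp: list_all2_conv_all_nth in_set_conv_nth)
  then show ?thesis using all_shutD[OF _ Hs(2) assms(3)] by blast
qed

lemma offs_subset: "set (offs us bs) \<subseteq> set us"
  by (induction us bs rule: offs.induct) auto

lemma later_subset: "set (later x us bs) \<subseteq> set us"
proof (induction us arbitrary: bs)
  case (Cons u us)
  show ?case
  proof (cases bs)
    case Nil
    then show ?thesis using Cons[of "[]"] offs_subset[of us "[]"] by (cases "x = u") auto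
  next
    case (Cons b bs')
    then show ?thesis using Cons.IH[of bs'] offs_subset[of us bs'] by (cases "x = u") auto
  qed
qed simp

lemma free_pairs_subset: "set (free_pairs us ms xs) \<subseteq> set xs \<times> set us"
proof (induction xs)
  case (Cons x xs)
  then show ?case using later_subset[of x us "reach us ms x"] by auto
qed simp

lemma thirds_subset: "e \<in> set (thirds x y qs ps) \<Longrightarrow> tset e \<subseteq> {x, y} \<union> snd ` set qs"
proof (induction qs)
  case (Cons q qs)
  obtain u w where q: "q = (u, w)" by (cases q)
  show ?case using Cons by (cases "u = y") (auto simp: q split: if_splits)
qed simp

lemma cliques_subset:
  "e \<in> set (cliques qs ps) \<Longrightarrow> set qs \<subseteq> X \<times> X \<Longrightarrow> set ps \<subseteq> X \<times> X \<Longrightarrow> tset e \<subseteq> X"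
proof (induction qs)
  case (Cons q qs)
  obtain x y where q: "q = (x, y)" by (cases q)
  show ?case
  proof (cases "e \<in> set (thirds x y ps ps)")
    case True
    have "snd ` set ps \<subseteq> X" using Cons.prems(3) by auto
    moreover have "{x, y} \<subseteq> X" using Cons.prems(2) q by auto
    ultimately show ?thesis using thirds_subset[OF True] by blast
  qed (use Cons q in auto)
qed simp

text \<open>Extensions stay within the labels \<open>us\<close>; hence \<open>olds\<close> loses no
  point of the extended system.\<close>

lemma exts_subset:
  assumes "e \<in> set (exts us hs)"
  shows "tset e \<subseteq> set us"
proof -
  define os qs fs where "os = olds hs us" and "qs = news hs us" and "fs = free_pairs os (build os hs) os"
  have sub: "set os \<subseteq> set us" "set qs \<subseteq> set us" by (auto simp: os_def qs_def olds_filter news_filter)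
  have fs: "set fs \<subseteq> set us \<times> set us" using free_pairs_subset sub(1) unfolding fs_def by fast
  have "e \<in> set (exts3 (privates hs hs) qs) \<or> e \<in> set (exts2 (privates hs hs) os qs)
      \<or> e \<in> set (exts1 (privates hs hs) fs qs) \<or> e \<in> set (cliques fs fs)"
    using assms by (auto simp: exts_def exts_from_def exts_of_def set_keep os_def qs_def fs_def)
  then show ?thesis
  proof (elim disjE)
    assume "e \<in> set (exts3 (privates hs hs) qs)"
    then show ?thesis using sub(2)
      by (cases "(privates hs hs, qs)" rule: exts3.cases) (auto simp: set_keep split: if_splits)
  next
    assume "e \<in> set (exts2 (privates hs hs) os qs)"
    then show ?thesis using sub
      by (cases "(privates hs hs, os, qs)" rule: exts2.cases) (auto simp: set_keep set_with2)
  next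
    assume "e \<in> set (exts1 (privates hs hs) fs qs)"
    then show ?thesis using sub fs
      by (cases "(privates hs hs, fs, qs)" rule: exts1.cases) (auto simp: set_keep set_with1)
  next
    assume "e \<in> set (cliques fs fs)"
    then show ?thesis using cliques_subset fs by blast
  qed
qed

section \<open>Covering lists and critical graphs\<close>

context square_free_graph
begin

text \<open>The image of a triple has three points and lies in a triple, so it is equal to it. Thus
  \<open>rs\<close> is mapped injectively into \<open>S\<close>, and equal lengths make this map
  onto.\<close>

lemma copy_iso:
  assumes S: "S \<subseteq> triangles" and cp: "copy f hs S" and us: "distinct us"
    and iso: "iso_ok us rs hs ss" and wf: "wf_triples us rs"
  shows "copy (f \<circ> look us ss) rs S"
proof -
  have len: "length rs = length hs" "length us = length ss" and ss: "distinct ss"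
    and into: "\<And>r. r \<in> set rs \<Longrightarrow> \<exists>h\<in>set hs. look us ss ` tset r \<subseteq> tset h"
    using iso by (auto simp: iso_ok_def same_length_iff no_dup_iff maps_into_iff tset_relabel)
  note wfD = wf_triplesD[OF wf]
  have inj_look: "inj_on (look us ss) (\<Union>(tset ` set rs))"
    by (rule inj_on_subset[OF inj_on_look[OF us len(2) ss] wfD(1)])
  have eq: "\<exists>h\<in>set hs. look us ss ` tset r = tset h" if r: "r \<in> set rs" for r
  proof -
    obtain h where h: "h \<in> set hs" "look us ss ` tset r \<subseteq> tset h" using into[OF r] by blast
    have "inj_on (look us ss) (tset r)" using inj_look by (rule inj_on_subset) (use r in auto)
    then have "card (look us ss ` tset r) = 3" using wfD(2)[OF r] by (simp add: card_image)
    moreover have "finite (tset h)" "card (tset h) \<le> 3"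
      by (cases h; simp add: card_insert_if)+
    ultimately have "look us ss ` tset r = tset h" using h(2) by (intro card_seteq) auto
    then show ?thesis using h(1) by blast
  qed
  have "look us ss ` \<Union>(tset ` set rs) \<subseteq> \<Union>(tset ` set hs)" using into by blast
  then have inj: "inj_on (f \<circ> look us ss) (\<Union>(tset ` set rs))"
    by (intro comp_inj_on[OF inj_look] inj_on_subset[OF copyD(1)[OF cp S]])
  have sub: "(\<lambda>r. (f \<circ> look us ss) ` tset r) ` set rs \<subseteq> S"
  proof
    fix t assume "t \<in> (\<lambda>r. (f \<circ> look us ss) ` tset r) ` set rs"
    then obtain r where r: "r \<in> set rs" "t = f ` (look us ss ` tset r)" by (auto simp: image_comp)
    then show "t \<in> S" using eq[OF r(1)] copyD(2)[OF cp S] by auto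
  qed
  have "inj_on (\<lambda>r. (f \<circ> look us ss) ` tset r) (set rs)"
  proof (rule inj_onI)
    fix r r' assume r: "r \<in> set rs" "r' \<in> set rs" "(f \<circ> look us ss) ` tset r = (f \<circ> look us ss) ` tset r'"
    have "tset r \<subseteq> \<Union>(tset ` set rs)" "tset r' \<subseteq> \<Union>(tset ` set rs)" using r by auto
    then have "tset r = tset r'" using inj_on_image_eq_iff[OF inj] r(3) by metis
    then show "r = r'" using wfD(4) r(1,2) by (auto dest: inj_onD)
  qed
  then have "card ((\<lambda>r. (f \<circ> look us ss) ` tset r) ` set rs) = card S"
    using wfD(3) len(1) copyD(4)[OF cp S] by (simp add: card_image distinct_card)
  then have "(\<lambda>r. (f \<circ> look us ss) ` tset r) ` set rs = S"
    using sub finite_subset[OF S finite_triangles] by (metis card_subset_eq)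
  then show ?thesis
    using inj len(1) copyD(4)[OF cp S] by (simp add: copy_def)
qed

lemma covers_base:
  assumes "a \<noteq> b" "b \<noteq> c" "a \<noteq> c"
  shows "covers 1 3 [[(a, b, c)]]"
  unfolding covers_def
proof (intro allI impI)
  fix S assume S: "S \<subseteq> triangles" "card S = 1"
  then obtain t where t: "S = {t}" by (metis card_1_singletonE)
  then obtain u v w where uvw: "t = {u, v, w}" "E u v" "E v w" "E u w" using S(1) by (auto simp: triangles_def)
  define f where "f x = (if x = a then u else if x = b then v else w)" for x
  have "u \<noteq> v" "v \<noteq> w" "u \<noteq> w" using uvw E_irrefl by auto
  then have "copy f [(a, b, c)] S" using assms by (auto simp: copy_def t uvw(1) f_def inj_on_def)
  then show "\<exists>hs\<in>set [[(a, b, c)]]. \<exists>f. copy f hs S" by auto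
qed

theorem covers_step:
  assumes cov: "covers k M (concat Hss)"
    and arith: "\<And>m. m \<le> N \<Longrightarrow> M < m \<Longrightarrow> 3 * Suc k + Suc k * (m - Suc M) < 2 * m"
    and wf: "list_all (wf_triples vs) (concat Hss)" "set vs \<subseteq> set us" and us: "distinct us" "length us = N"
    and isos: "list_all2 (all_isos ix us L) Hss css" and wf': "list_all (wf_triples us) (concat L)"
  shows "covers (Suc k) N (concat L)"
  unfolding covers_def
proof (intro allI impI)
  fix S assume S: "S \<subseteq> triangles" "card S = Suc k" "card (\<Union>S) \<le> N"
  have pts: "\<Union>(tset ` set hs) \<subseteq> set us" if "hs \<in> set (concat Hss)" for hs
    using wf_triplesD(1)[of vs hs] that wf unfolding list_all_iff by blast
  obtain hs e f where e: "hs \<in> set (concat Hss)" "e \<in> set (exts us hs)" and f: "copy f (e # hs) S"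
    using extend[OF cov arith S us pts] by blast
  obtain rs ss where rs: "rs \<in> set (concat L)" "iso_ok us rs (e # hs) ss"
    using rows_isosD[OF isos e] by blast
  then have "wf_triples us rs" using wf' unfolding list_all_iff by blast
  from copy_iso[OF S(1) f us(1) rs(2) this] show "\<exists>hs\<in>set (concat L). \<exists>f. copy f hs S"
    using rs(1) by blast
qed

text \<open>What is used of a minimal set without a 101-colouring; all that remains of its geometry is a forbidden
  pattern of orthogonalities.\<close>

definition critical :: "('p \<times> 'p) list \<Rightarrow> bool" where
  "critical pat \<longleftrightarrow> V = \<Union>triangles
     \<and> (\<forall>Z\<subseteq>V. (\<forall>t\<in>triangles. t \<inter> Z \<noteq> {}) \<longrightarrow> (\<exists>u\<in>Z. \<exists>v\<in>Z. E u v))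
     \<and> (\<forall>t\<in>triangles. \<forall>v\<in>t. \<exists>u. E v u \<and> u \<notin> t)
     \<and> (\<forall>g :: 'p \<Rightarrow> 'a. \<exists>(x, y)\<in>set pat. \<not> E (g x) (g y))"

lemma not_closes0:
  assumes crit: "critical pat" and cp: "copy f hs triangles" and us: "\<Union>(tset ` set hs) \<subseteq> set us"
  shows "\<not> closes0 pat us hs t"
proof
  interpret G: labelled_graph V E f hs triangles by unfold_locales (use cp in auto)
  assume "closes0 pat us hs t"
  then have c: "closes pat us hs [] (build us hs) t" by (simp add: closes0_def)
  have V: "V = \<Union>triangles"
    and uncol: "\<forall>Z\<subseteq>V. (\<forall>t\<in>triangles. t \<inter> Z \<noteq> {}) \<longrightarrow> (\<exists>u\<in>Z. \<exists>v\<in>Z. E u v)"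
    and deg: "\<forall>t\<in>triangles. \<forall>v\<in>t. \<exists>u. E v u \<and> u \<notin> t"
    and pat: "\<forall>g :: 'b \<Rightarrow> 'a. \<exists>(x, y)\<in>set pat. \<not> E (g x) (g y)"
    using crit unfolding critical_def by simp_all
  have uncol': "\<exists>u\<in>Z. \<exists>v\<in>Z. E u v" if "Z \<subseteq> V" "\<And>t. t \<in> triangles \<Longrightarrow> t \<inter> Z \<noteq> {}" for Z
    using uncol that by simp
  have deg': "\<exists>u. E v u \<and> u \<notin> t" if "t \<in> triangles" "v \<in> t" for v t
    using deg that by simp
  show False
    by (rule G.closes_sound[OF refl V uncol' deg' spec[OF pat] us G.edges_ok_Nil sound_build c])
qed

text \<open>Applied to the set of all triangles, \<open>extend\<close> yields an extension of a
  listed system. Each such extension is refuted on the points it uses, which by criticality are all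
  of \<open>V\<close>.\<close>

theorem no_critical:
  assumes cov: "covers k M (concat Hss)"
    and arith: "\<And>m. m \<le> N \<Longrightarrow> M < m \<Longrightarrow> 3 * Suc k + Suc k * (m - Suc M) < 2 * m"
    and wf: "list_all (wf_triples vs) (concat Hss)" "set vs \<subseteq> set us" and us: "distinct us" "length us = N"
    and shut: "list_all2 (all_shut pat us) Hss css" and crit: "critical pat" and V: "card V \<le> N"
  shows "card triangles \<noteq> Suc k"
proof
  assume k: "card triangles = Suc k"
  have hus: "\<Union>(tset ` set hs) \<subseteq> set us" if "hs \<in> set (concat Hss)" for hs
    using wf_triplesD(1)[of vs hs] that wf unfolding list_all_iff by blast
  have "card (\<Union>triangles) \<le> N" using crit V by (simp add: critical_def)
  then obtain hs e f where e: "hs \<in> set (concat Hss)" "e \<in> set (exts us hs)" and f: "copy f (e # hs) triangles"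
    using extend[OF cov arith subset_refl k _ us hus] by blast
  obtain t where t: "closes0 pat (olds (e # hs) us) (e # hs) t" using rows_shutD[OF shut e] by blast
  have "\<Union>(tset ` set (e # hs)) \<subseteq> set us"
    using hus[OF e(1)] exts_subset[OF e(2)] by auto
  then have "\<Union>(tset ` set (e # hs)) \<subseteq> set (olds (e # hs) us)" by (auto simp: olds_filter)
  then show False using not_closes0[OF crit f] t by blast
qed

theorem no_critical_listed:
  assumes cov: "covers k N (concat Hss)" and wf: "list_all (wf_triples us) (concat Hss)"
    and shut: "list_all2 (closes0 pat us) (concat Hss) ts" and crit: "critical pat" and V: "card V \<le> N"
  shows "card triangles \<noteq> k"
proof
  assume k: "card triangles = k"
  have "card (\<Union>triangles) \<le> N" using crit V by (simp add: critical_def)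
  then obtain hs f where hs: "hs \<in> set (concat Hss)" and f: "copy f hs triangles"
    using cov k unfolding covers_def by blast
  obtain i where "i < length (concat Hss)" "hs = concat Hss ! i" using hs by (metis in_set_conv_nth)
  then obtain t where t: "closes0 pat us hs t" using shut unfolding list_all2_conv_all_nth by blast
  have "wf_triples us hs" using wf hs unfolding list_all_iff by blast
  from not_closes0[OF crit f wf_triplesD(1)[OF this]] show False using t by blast
qed

text \<open>Any \<open>Suc k\<close> triangles would be an extension of a listed system, but none of
  these systems can be extended.\<close>

theorem no_more:
  assumes cov: "covers k M (concat Hss)"
    and arith: "\<And>m. m \<le> N \<Longrightarrow> M < m \<Longrightarrow> 3 * Suc k + Suc k * (m - Suc M) < 2 * m"
    and wf: "list_all (wf_triples vs) (concat Hss)" "set vs \<subseteq> set us" and us: "distinct us" "length us = N"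
    and none: "list_all (\<lambda>hs. is_nil (exts us hs)) (concat Hss)" and V: "card V \<le> N"
  shows "card triangles \<le> k"
proof (rule ccontr)
  assume "\<not> card triangles \<le> k"
  then obtain S where S: "S \<subseteq> triangles" "card S = Suc k"
    by (metis not_less_eq_eq obtain_subset_with_card_n)
  have hus: "\<Union>(tset ` set hs) \<subseteq> set us" if "hs \<in> set (concat Hss)" for hs
    using wf_triplesD(1)[of vs hs] that wf unfolding list_all_iff by blast
  have "\<Union>S \<subseteq> V" using S(1) triangle_V by blast
  then have "card (\<Union>S) \<le> N" using card_mono[OF finite_V] V by (meson le_trans)
  from extend[OF cov arith S this us hus] obtain hs e where "hs \<in> set (concat Hss)" "e \<in> set (exts us hs)"
    by blast
  then show False using none unfolding list_all_iff is_nil_iff by auto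
qed

end

section \<open>At least nine triangles\<close>

lemma prod_UNIV_3: "(\<Prod>i\<in>(UNIV :: 3 set). f i) = f 1 * f 2 * f 3"
proof -
  have "(\<Prod>i\<in>{1, 2, 3 :: 3}. f i) = f 1 * f 2 * f 3" by (simp add: mult.assoc)
  then show ?thesis by (simp only: UNIV_3)
qed

section \<open>Volume of a double cone\<close>

text \<open>Separates the axis of the cone from the plane perpendicular to it, so that the volume
  can be found by slicing.\<close>

definition axis_split :: "real^3 \<Rightarrow> real \<times> (real \<times> real)" where
  "axis_split v = (v $ 3, (v $ 1, v $ 2))"

lemma axis_split_measurable: "axis_split \<in> borel_measurable borel"
  unfolding axis_split_def by measurable

text \<open>A permutation of coordinates preserves the volume of boxes, and Lebesgue measure is
  determined by these.\<close>

lemma distr_axis_split: "distr lborel borel axis_split = (lborel :: (real \<times> real \<times> real) measure)"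
proof (rule lborel_eqI[symmetric])
  fix l u :: "real \<times> real \<times> real"
  assume lu: "\<And>b. b \<in> Basis \<Longrightarrow> l \<bullet> b \<le> u \<bullet> b"
  obtain l3 l1 l2 u3 u1 u2 where l: "l = (l3, l1, l2)" and u: "u = (u3, u1, u2)"
    by (metis prod_cases3)
  have le: "l3 \<le> u3" "l1 \<le> u1" "l2 \<le> u2"
    using lu[of "(1, 0)"] lu[of "(0, 1, 0)"] lu[of "(0, 0, 1)"] by (auto simp: Basis_prod_def l u)
  have vim: "axis_split -` box l u = box (vector [l1, l2, l3]) (vector [u1, u2, u3])"
    by (auto simp: axis_split_def mem_box_cart mem_box Basis_prod_def l u vector_3 forall_3)
  have "emeasure (distr lborel borel axis_split) (box l u) = emeasure lborel (axis_split -` box l u)"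
    using axis_split_measurable by (subst emeasure_distr) auto
  also have "\<dots> = emeasure lborel (box (vector [l1, l2, l3]) (vector [u1, u2, u3] :: real^3))"
    by (simp add: vim)
  also have "\<dots> = ennreal (measure lborel (box (vector [l1, l2, l3]) (vector [u1, u2, u3] :: real^3)))"
    by (rule emeasure_eq_ennreal_measure) (use emeasure_lborel_box_finite in \<open>simp add: less_top\<close>)
  also have "measure lborel (box (vector [l1, l2, l3]) (vector [u1, u2, u3] :: real^3)) =
      measure lborel (cbox (vector [l1, l2, l3]) (vector [u1, u2, u3] :: real^3))"
    by (simp only: measure_lborel_box_eq measure_lborel_cbox_eq)
  also have "\<dots> = (\<Prod>i\<in>UNIV. (vector [u1, u2, u3] :: real^3) $ i - (vector [l1, l2, l3] :: real^3) $ i)"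
    by (rule content_cbox_cart) (use le in \<open>simp add: interval_ne_empty_cart forall_3\<close>)
  also have "\<dots> = (u1 - l1) * (u2 - l2) * (u3 - l3)" 
    unfolding prod_UNIV_3 vector_3 ..
  also have "\<dots> = (\<Prod>b\<in>Basis. (u - l) \<bullet> b)"
  proof -
    have basis: "Basis = {(1, 0, 0), (0, 1, 0), (0, 0, 1) :: real \<times> real \<times> real}"
      by (auto simp: Basis_prod_def zero_prod_def)
    show ?thesis unfolding basis l u by (simp add: ac_simps)
  qed
  finally show "emeasure (distr lborel borel axis_split) (box l u) = (\<Prod>b\<in>Basis. (u - l) \<bullet> b)" .
qed simp

text \<open>The solid double cone of directions at less than 45 degrees to the line of
  \<open>u\<close>, since the squared cosine of 45 degrees is 1/2. Volume in the unit ball takes the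
  place of area on the sphere; the proportions are the same.\<close>

definition sector :: "real^3 \<Rightarrow> (real^3) set" where
  "sector u = {p. norm p < 1 \<and> (norm p)\<^sup>2 < 2 * (p \<bullet> u)\<^sup>2}"

lemma open_sector: "open (sector u)"
  unfolding sector_def by (intro open_Collect_conj open_Collect_less continuous_intros)

lemma sector_measurable [simp]: "sector u \<in> lmeasurable"
  by (rule bounded_set_imp_lmeasurable)
    (auto simp: open_sector borel_open sets_completionI_sets bounded_iff sector_def intro: exI[of _ 1])

lemma sector_image:
  assumes "orthogonal_transformation f"
  shows "f ` sector u = sector (f u)"
proof -
  have 1: "f ` sector u \<subseteq> sector (f u)" if "orthogonal_transformation f" for f u
    using that by (auto simp: sector_def orthogonal_transformation_norm orthogonal_transformation_def norm_eq_sqrt_inner)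
  have inv: "orthogonal_transformation (inv f)" "\<And>x. f (inv f x) = x" "\<And>x. inv f (f x) = x"
    using orthogonal_transformation_inv[OF assms] orthogonal_transformation_bij[OF assms]
    by (auto simp: bij_is_surj surj_f_inv_f bij_is_inj)
  have "sector (f u) \<subseteq> f ` sector u"
  proof
    fix p assume "p \<in> sector (f u)"
    then have "inv f p \<in> sector u" using 1[OF inv(1), of "f u"] inv(3) by auto
    then show "p \<in> f ` sector u" using inv(2) by (metis image_eqI)
  qed
  with 1[OF assms, of u] show ?thesis by blast
qed

lemma sector_axis: "sector (axis 3 1) = axis_split -` {(z, w). z\<^sup>2 + (norm w)\<^sup>2 < 1 \<and> (norm w)\<^sup>2 < z\<^sup>2}"
proof -
  have "norm p < 1 \<longleftrightarrow> (norm p)\<^sup>2 < 1" for p :: "real^3"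
    by (simp add: power_less_one_iff abs_square_less_1)
  moreover have "(norm p)\<^sup>2 = (p$1)\<^sup>2 + (p$2)\<^sup>2 + (p$3)\<^sup>2" for p :: "real^3"
    unfolding power2_norm_eq_inner by (simp add: inner_vec_def sum_3 power2_eq_square)
  ultimately show ?thesis
    by (auto simp: sector_def axis_split_def inner_axis norm_Pair)
qed

text \<open>The slice at height z is a disc whose squared radius is the smaller of z^2 (the cone)
  and 1 - z^2 (the ball). Integrating its area over z gives the fraction 1 - 1/sqrt 2 of the
  ball.\<close>

lemma sector_volume: "measure lebesgue (sector (axis 3 1)) = 4 / 3 * pi * (1 - 1 / sqrt 2)"
proof -
  define X :: "(real \<times> real \<times> real) set" where "X = {(z, w). z\<^sup>2 + (norm w)\<^sup>2 < 1 \<and> (norm w)\<^sup>2 < z\<^sup>2}"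
  define g :: "real \<Rightarrow> real" where "g z = pi * max 0 (min (z\<^sup>2) (1 - z\<^sup>2))" for z
  have "open X" unfolding X_def case_prod_beta
    by (intro open_Collect_conj open_Collect_less continuous_intros)
  then have X: "X \<in> sets borel" by simp
  have slice: "emeasure lborel (Pair z -` X) = ennreal (g z)" for z
  proof -
    \<comment> \<open>The maximum with 0 makes the slice an empty ball when |z| > 1.\<close>
    define r where "r = max 0 (min (z\<^sup>2) (1 - z\<^sup>2))"
    have "Pair z -` X = ball 0 (sqrt r)"
    proof (intro set_eqI)
      fix w :: "real \<times> real"
      have "norm w < sqrt r \<longleftrightarrow> (norm w)\<^sup>2 < r"
        using real_sqrt_less_iff[of "(norm w)\<^sup>2" r] by simp
      also have "\<dots> \<longleftrightarrow> (norm w)\<^sup>2 < z\<^sup>2 \<and> (norm w)\<^sup>2 < 1 - z\<^sup>2"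
        by (simp add: r_def less_max_iff_disj)
      finally show "w \<in> Pair z -` X \<longleftrightarrow> w \<in> ball 0 (sqrt r)" by (auto simp: X_def)
    qed
    moreover have "0 \<le> r" by (simp add: r_def)
    ultimately show ?thesis
      by (simp add: emeasure_ball unit_ball_vol_2 g_def r_def[symmetric])
  qed
  have "emeasure lborel (sector (axis 3 1)) = emeasure (distr lborel borel axis_split) X"
    using X axis_split_measurable by (subst emeasure_distr) (auto simp: sector_axis X_def)
  also have "\<dots> = emeasure (lborel \<Otimes>\<^sub>M lborel) X"
    by (simp add: distr_axis_split lborel_prod)
  also have "\<dots> = (\<integral>\<^sup>+z. emeasure lborel (Pair z -` X) \<partial>lborel)"
    by (rule lborel.emeasure_pair_measure_alt) (use X in \<open>simp only: lborel_prod sets_lborel\<close>)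
  also have "\<dots> = (\<integral>\<^sup>+z. ennreal (g z) \<partial>lborel)" by (simp add: slice)
  also have "\<dots> = ennreal (4 / 3 * pi * (1 - 1 / sqrt 2))"
  proof (rule nn_integral_has_integral_lborel)
    show "g \<in> borel_measurable borel" unfolding g_def by measurable
    show "0 \<le> g z" for z by (simp add: g_def)
    \<comment> \<open>At |z| = s the two bounds z^2 and 1 - z^2 agree: the cone limits the slice in
      the middle piece, the ball in the two outer ones.\<close>
    define s where "s = 1 / sqrt (2 :: real)"
    have s: "0 < s" "s < 1" "s\<^sup>2 = 1 / 2" by (auto simp: s_def power_divide real_sqrt_gt_1_iff)
    have inner: "((\<lambda>z. z\<^sup>2) has_integral s ^ 3 / 3 - (- s) ^ 3 / 3) {- s..s}"
      by (rule fundamental_theorem_of_calculus)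
        (use s in \<open>auto intro!: derivative_eq_intros simp flip: has_real_derivative_iff_has_vector_derivative\<close>)
    have outer: "((\<lambda>z. 1 - z\<^sup>2) has_integral (b - b ^ 3 / 3) - (a - a ^ 3 / 3)) {a..b}" if "a \<le> b" for a b :: real
      by (rule fundamental_theorem_of_calculus)
        (use that in \<open>auto intro!: derivative_eq_intros simp flip: has_real_derivative_iff_has_vector_derivative\<close>)
    have le: "z\<^sup>2 \<le> 1 / 2 \<longleftrightarrow> - s \<le> z \<and> z \<le> s" for z
      using abs_le_square_iff[of z s] s by auto
    have le1: "z\<^sup>2 \<le> 1 \<longleftrightarrow> - 1 \<le> z \<and> z \<le> 1" for z :: real
      using abs_le_square_iff[of z 1] by auto
    have ge: "1 / 2 \<le> z\<^sup>2 \<longleftrightarrow> z \<le> - s \<or> s \<le> z" for z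
      using abs_le_square_iff[of s z] s by auto
    have i1: "(g has_integral pi * (s ^ 3 / 3 - (- s) ^ 3 / 3)) {- s..s}"
    proof (rule has_integral_eq[OF _ has_integral_mult_right[OF inner]])
      fix z assume "z \<in> {- s..s}"
      then have "z\<^sup>2 \<le> 1 / 2" using le by auto
      then show "pi * z\<^sup>2 = g z" by (simp add: g_def min_def)
    qed
    have i2: "(g has_integral pi * ((1 - 1 ^ 3 / 3) - (s - s ^ 3 / 3))) {s..1}"
    proof (rule has_integral_eq[OF _ has_integral_mult_right[OF outer]])
      fix z assume "z \<in> {s..1}"
      then have "1 / 2 \<le> z\<^sup>2" "z\<^sup>2 \<le> 1" using ge le1 s(1) by auto
      then show "pi * (1 - z\<^sup>2) = g z" by (simp add: g_def min_def)
    qed (use s in simp)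
    have i3: "(g has_integral pi * (((- s) - (- s) ^ 3 / 3) - ((- 1) - (- 1) ^ 3 / 3))) {- 1..- s}"
    proof (rule has_integral_eq[OF _ has_integral_mult_right[OF outer]])
      fix z assume "z \<in> {- 1..- s}"
      then have "1 / 2 \<le> z\<^sup>2" "z\<^sup>2 \<le> 1" using ge le1 s(1) by auto
      then show "pi * (1 - z\<^sup>2) = g z" by (simp add: g_def min_def)
    qed (use s in simp)
    have "s ^ 3 = s / 2" using s(3) by (simp add: power3_eq_cube power2_eq_square)
    then have total: "pi * (((- s) - (- s) ^ 3 / 3) - ((- 1) - (- 1) ^ 3 / 3)) + pi * (s ^ 3 / 3 - (- s) ^ 3 / 3)
        + pi * ((1 - 1 ^ 3 / 3) - (s - s ^ 3 / 3)) = 4 / 3 * pi * (1 - 1 / sqrt 2)"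
      by (simp add: s_def[symmetric] field_simps)
    have "(g has_integral pi * (((- s) - (- s) ^ 3 / 3) - ((- 1) - (- 1) ^ 3 / 3)) + pi * (s ^ 3 / 3 - (- s) ^ 3 / 3)
        + pi * ((1 - 1 ^ 3 / 3) - (s - s ^ 3 / 3))) {- 1..1}"
      by (intro has_integral_combine[OF _ _ has_integral_combine[OF _ _ i3 i1] i2]) (use s in auto)
    then have "(g has_integral 4 / 3 * pi * (1 - 1 / sqrt 2)) {- 1..1}" by (simp only: total)
    then show "(g has_integral 4 / 3 * pi * (1 - 1 / sqrt 2)) UNIV"
    proof (rule has_integral_on_superset)
      fix z :: real assume "z \<notin> {- 1..1}"
      then have "1 < z\<^sup>2" using le1[of z] by auto
      then show "g z = 0" by (simp add: g_def)
    qed auto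
  qed
  finally have "emeasure lborel (sector (axis 3 1)) = ennreal (4 / 3 * pi * (1 - 1 / sqrt 2))" .
  then have "measure lborel (sector (axis 3 1)) = 4 / 3 * pi * (1 - 1 / sqrt 2)"
    by (intro measure_eq_emeasure_eq_ennreal) (auto simp: real_le_rsqrt)
  then show ?thesis by (simp add: borel_open open_sector measure_completion)
qed

text \<open>Some orthogonal transformation takes the third axis to \<open>u\<close>, and it
  preserves volume.\<close>

lemma sector_volume_unit:
  assumes "norm u = 1"
  shows "measure lebesgue (sector u) = 4 / 3 * pi * (1 - 1 / sqrt 2)"
proof -
  obtain f :: "real^3 \<Rightarrow> real^3" where f: "orthogonal_transformation f" "f (axis 3 1) = u"
    using orthogonal_transformation_exists_1[of "axis 3 1 :: real^3" u] assms by (auto simp: norm_axis_1)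
  show ?thesis
    using measure_orthogonal_image[OF f(1) sector_measurable, of "axis 3 1"] sector_volume
    by (simp add: sector_image f)
qed

section \<open>Union bound over eight triangles\<close>

lemma bessel2:
  fixes x y p :: "'b::real_inner"
  assumes "norm x = 1" "norm y = 1" "x \<bullet> y = 0"
  shows "(p \<bullet> x)\<^sup>2 + (p \<bullet> y)\<^sup>2 \<le> (norm p)\<^sup>2"
proof -
  have "x \<bullet> x = 1" "y \<bullet> y = 1" using assms by (simp_all add: norm_eq_1)
  then have "(norm (p - (p \<bullet> x) *\<^sub>R x - (p \<bullet> y) *\<^sub>R y))\<^sup>2 = (norm p)\<^sup>2 - (p \<bullet> x)\<^sup>2 - (p \<bullet> y)\<^sup>2"
    using assms(3) unfolding power2_norm_eq_inner
    by (simp add: inner_diff inner_commute[of y x] inner_commute[of x p] inner_commute[of y p]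
        algebra_simps power2_eq_square)
  then show ?thesis by (smt (verit) zero_le_power2)
qed

text \<open>Two squares with sum at most |p|^2 cannot both exceed half of it.\<close>

lemma sector_disjoint:
  assumes "norm x = 1" "norm y = 1" "x \<bullet> y = 0"
  shows "sector x \<inter> sector y = {}"
proof -
  have False if "(norm p)\<^sup>2 < 2 * (p \<bullet> x)\<^sup>2" "(norm p)\<^sup>2 < 2 * (p \<bullet> y)\<^sup>2" for p
    using bessel2[OF assms, of p] that by linarith
  then show ?thesis unfolding sector_def by blast
qed

text \<open>A random unit vector makes an angle of at least 45 degrees with all three members of an orthonormal
  basis with probability $1 - 3 (1 - 1/\sqrt 2) < 1/8$.\<close>

lemma avoid_eight:
  fixes T :: "(real^3) set set"
  assumes "finite T" "card T \<le> 8"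
    and T: "\<And>t. t \<in> T \<Longrightarrow> \<exists>x y z. t = {x, y, z} \<and> norm x = 1 \<and> norm y = 1 \<and> norm z = 1
      \<and> x \<bullet> y = 0 \<and> y \<bullet> z = 0 \<and> x \<bullet> z = 0"
  shows "\<exists>p. \<forall>t\<in>T. \<exists>x\<in>t. (norm p)\<^sup>2 < 2 * (p \<bullet> x)\<^sup>2"
proof -
  let ?B = "ball 0 1 :: (real^3) set"
  define bad where "bad t = ?B - (\<Union>x\<in>t. sector x)" for t
  define c where "c = 4 / 3 * pi * (1 - 1 / sqrt 2)"
  have B: "measure lebesgue ?B = 4 / 3 * pi"
    by (simp add: content_ball unit_ball_vol_3 measure_completion)
  have meas: "bad t \<in> lmeasurable" "measure lebesgue (bad t) = 4 / 3 * pi - 3 * c" if t: "t \<in> T" for t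
  proof -
    obtain x y z where xyz: "t = {x, y, z}" "norm x = 1" "norm y = 1" "norm z = 1"
      "x \<bullet> y = 0" "y \<bullet> z = 0" "x \<bullet> z = 0" using T[OF t] by blast
    have U: "(\<Union>x\<in>t. sector x) = (sector x \<union> sector y) \<union> sector z" by (auto simp: xyz(1))
    have disj: "sector x \<inter> sector y = {}" "(sector x \<union> sector y) \<inter> sector z = {}"
      using sector_disjoint[OF xyz(2,3,5)] sector_disjoint[OF xyz(3,4,6)] sector_disjoint[OF xyz(2,4,7)] by auto
    have m: "sector v \<in> sets lebesgue" "emeasure lebesgue (sector v) \<noteq> \<infinity>" for v
      using fmeasurableD[OF sector_measurable] fmeasurableD2[OF sector_measurable] by auto
    have Um: "(\<Union>x\<in>t. sector x) \<in> lmeasurable" unfolding U by (intro fmeasurable.Un sector_measurable)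
    have xy: "sector x \<union> sector y \<in> lmeasurable" by (intro fmeasurable.Un sector_measurable)
    then have mxy: "sector x \<union> sector y \<in> sets lebesgue" "emeasure lebesgue (sector x \<union> sector y) \<noteq> \<infinity>"
      using fmeasurableD[OF xy] fmeasurableD2[OF xy] by auto
    have v: "measure lebesgue (sector x) = c" "measure lebesgue (sector y) = c" "measure lebesgue (sector z) = c"
      using sector_volume_unit xyz(2-4) by (simp_all only: c_def)
    have "measure lebesgue (\<Union>x\<in>t. sector x) = 3 * c"
      unfolding U measure_Union[OF mxy(2) m(2) mxy(1) m(1) disj(2)] measure_Union[OF m(2) m(2) m(1) m(1) disj(1)] v
      by simp
    moreover have "(\<Union>x\<in>t. sector x) \<subseteq> ?B" by (auto simp: sector_def)
    ultimately show "measure lebesgue (bad t) = 4 / 3 * pi - 3 * c"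
      unfolding bad_def using measurable_measure_Diff[of ?B lebesgue "\<Union>x\<in>t. sector x"] Um B
      by (simp add: fmeasurableD)
    show "bad t \<in> lmeasurable" unfolding bad_def using Um by (intro fmeasurable.Diff) auto
  qed
  show ?thesis
  proof (rule ccontr)
    assume neg: "\<not> ?thesis"
    \<comment> \<open>If every direction misses some triangle, the sets of missing directions cover
      the ball, so their volumes add up to at least that of the ball.\<close>
    have "?B \<subseteq> (\<Union>t\<in>T. bad t)"
    proof
      fix p assume p: "p \<in> ?B"
      obtain t where "t \<in> T" "\<forall>x\<in>t. \<not> (norm p)\<^sup>2 < 2 * (p \<bullet> x)\<^sup>2" using neg by blast
      then show "p \<in> (\<Union>t\<in>T. bad t)" using p by (auto simp: bad_def sector_def)
    qed
    then have "measure lebesgue ?B \<le> measure lebesgue (\<Union>t\<in>T. bad t)"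
      using meas(1) assms(1) by (intro measure_mono_fmeasurable fmeasurable.finite_UN) auto
    also have "\<dots> \<le> (\<Sum>t\<in>T. measure lebesgue (bad t))"
      using meas(1) assms(1) by (intro measure_UNION_le) (auto simp: fmeasurableD)
    also have "\<dots> = card T * (4 / 3 * pi - 3 * c)" by (simp add: meas(2))
    finally have *: "4 / 3 * pi \<le> card T * (4 / 3 * pi - 3 * c)" by (simp only: B)
    define k where "k = 1 - 3 * (1 - 1 / sqrt 2)"
    have ck: "4 / 3 * pi - 3 * c = 4 / 3 * pi * k" 
    proof -
      have "a - 3 * (a * e) = a * (1 - 3 * e)" for a e :: real by (simp add: algebra_simps)
      then show ?thesis unfolding c_def k_def .
    qed
    have "4 / 3 * pi * 1 \<le> 4 / 3 * pi * (card T * k)" using * unfolding ck by (simp add: mult.commute mult.left_commute)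
    then have one: "1 \<le> card T * k" by (subst (asm) mult_le_cancel_left_pos) auto
    then have "0 \<le> k" by (smt (verit) mult_nonneg_nonpos of_nat_0_le_iff)
    then have "card T * k \<le> 8 * k" using assms(2) by (intro mult_right_mono) auto
    \<comment> \<open>Here 8 k = 24/sqrt 2 - 16. The contradiction is narrow: 2 * 17^2 = 578, while
      24^2 = 576.\<close>
    with one have "17 \<le> 24 / sqrt 2" by (simp add: k_def)
    then have "17 * sqrt 2 \<le> 24" by (simp add: field_simps)
    then have "(17 * sqrt 2)\<^sup>2 \<le> 24\<^sup>2" by (intro power_mono) auto
    then show False by (simp add: power_mult_distrib)
  qed
qed

section \<open>The enumeration\<close>

text \<open>The letter $O$ is left out because it denotes the composition of relations.\<close>

datatype pt = A | B | C | D | E | F | G | H | I | J | K | L | M | N | P | Q | R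

definition us3 where "us3 = [A,B,C]"

definition us5 where "us5 = [A,B,C,D,E]"

definition us7 where "us7 = [A,B,C,D,E,F,G]"

definition us9 where "us9 = [A,B,C,D,E,F,G,H,I]"

definition us11 where "us11 = [A,B,C,D,E,F,G,H,I,J,K]"

definition us13 where "us13 = [A,B,C,D,E,F,G,H,I,J,K,L,M]"

definition us15 where "us15 = [A,B,C,D,E,F,G,H,I,J,K,L,M,N,P]"

definition us16 where "us16 = [A,B,C,D,E,F,G,H,I,J,K,L,M,N,P,Q]"

definition us17 where "us17 = [A,B,C,D,E,F,G,H,I,J,K,L,M,N,P,Q,R]"

text \<open>The surviving graph. The first 33 pairs form eleven triangles, in which \<open>A\<close>
  occurs once and each other point twice; the last two pairs are the additional edges at
  \<open>A\<close>.\<close>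

definition pattern17 where
  "pattern17 = [
    (A,B), (B,C), (A,C), (B,D), (D,E), (B,E), (C,F), (F,G), (C,G),
    (D,H), (H,I), (D,I), (E,J), (J,K), (E,K), (F,L), (L,N), (F,N),
    (G,M), (M,P), (G,P), (H,L), (L,Q), (H,Q), (I,M), (M,R), (I,R),
    (J,N), (N,R), (J,R), (K,P), (P,Q), (K,Q), (A,Q), (A,R)]"

section \<open>Representatives and relabellings\<close>

text \<open>The list \<open>reps\<close>$k$ contains the systems of $k$ triples up to isomorphism, as far as they have few enough
  points to be needed; it is cut into rows of ten.  The certificates \<open>isos\<close>$k$ and \<open>trees\<close>$k$ treat, for each
  system in \<open>reps\<close>$(k-1)$, its extensions in the order of \<^term>\<open>exts\<close>; those in \<open>trees11\<close> treat \<open>reps11\<close>.\<close>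

definition reps1_0 where
  "reps1_0 = [
    [(A,B,C)]]"

definition reps1 where
  "reps1 = [reps1_0]"

definition reps2_0 where
  "reps2_0 = [
    [(A,D,E),(A,B,C)]]"

definition reps2 where
  "reps2 = [reps2_0]"

definition isos2_0 where
  "isos2_0 = [
    [(A,A,[]),(A,A,[B,A]),(A,A,[C,B,A])]]"

definition isos2 where
  "isos2 = [isos2_0]"

definition reps3_0 where
  "reps3_0 = [
    [(A,F,G),(A,D,E),(A,B,C)],
    [(B,F,G),(A,D,E),(A,B,C)]]"

definition reps3 where
  "reps3 = [reps3_0]"

definition isos3_0 where
  "isos3_0 = [
    [(A,A,[]),(A,B,[]),(A,B,[A,C,B]),(A,B,[A,D,E,C,B]),(A,B,[A,E,D,C,B])]]"

definition isos3 where
  "isos3 = [isos3_0]"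

definition reps4_0 where
  "reps4_0 = [
    [(A,H,I),(A,F,G),(A,D,E),(A,B,C)],
    [(B,H,I),(A,F,G),(A,D,E),(A,B,C)],
    [(C,H,I),(B,F,G),(A,D,E),(A,B,C)],
    [(D,H,I),(B,F,G),(A,D,E),(A,B,C)]]"

definition reps4 where
  "reps4 = [reps4_0]"

definition isos4_0 where
  "isos4_0 = [
    [(A,A,[]),(A,B,[]),(A,B,[A,C,B]),(A,B,[A,D,E,C,B]),(A,B,[A,E,D,C,B]),(A,B,[A,F,G,D,E,C,B]),
     (A,B,[A,G,F,D,E,C,B])],
    [(A,B,[A,B,C,I,H,E,D,G,F]),(A,B,[B,A,C,I,H,F,G,E,D]),(A,C,[]),(A,D,[]),(A,D,[A,B,C,E,D]),
     (A,D,[B,A,C,F,G,E,D]),(A,D,[B,A,C,G,F,E,D])]]"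

definition isos4 where
  "isos4 = [isos4_0]"

definition reps5_0 where
  "reps5_0 = [
    [(A,J,K),(A,H,I),(A,F,G),(A,D,E),(A,B,C)],
    [(B,J,K),(A,H,I),(A,F,G),(A,D,E),(A,B,C)],
    [(B,J,K),(B,H,I),(A,F,G),(A,D,E),(A,B,C)],
    [(C,J,K),(B,H,I),(A,F,G),(A,D,E),(A,B,C)],
    [(D,J,K),(B,H,I),(A,F,G),(A,D,E),(A,B,C)],
    [(H,J,K),(B,H,I),(A,F,G),(A,D,E),(A,B,C)],
    [(D,J,K),(C,H,I),(B,F,G),(A,D,E),(A,B,C)],
    [(F,J,K),(D,H,I),(B,F,G),(A,D,E),(A,B,C)],
    [(F,H,J),(D,H,I),(B,F,G),(A,D,E),(A,B,C)]]"

definition reps5 where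
  "reps5 = [reps5_0]"

definition isos5_0 where
  "isos5_0 = [
    [(A,A,[]),(A,B,[]),(A,B,[A,C,B]),(A,B,[A,D,E,C,B]),(A,B,[A,E,D,C,B]),(A,B,[A,F,G,D,E,C,B]),
     (A,B,[A,G,F,D,E,C,B]),(A,B,[A,H,I,D,E,F,G,C,B]),(A,B,[A,I,H,D,E,F,G,C,B])],
    [(A,B,[A,B,C,K,J,F,G,E,D,I,H]),(A,C,[]),(A,D,[]),(A,E,[]),(A,E,[A,B,C,E,D]),(A,E,[A,B,C,F,G,E,D]),
     (A,E,[A,B,C,G,F,E,D]),(A,F,[]),(A,F,[A,B,C,D,E,F,G,I,H])],
    [(A,D,[A,C,B,K,J,E,D,H,I,G,F]),(A,D,[B,C,A,K,J,F,G,H,I,E,D]),(A,D,[C,B,A,K,J,I,H,G,F,E,D]),(A,G,[]),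
     (A,G,[A,B,C,E,D]),(A,G,[B,A,C,F,G,E,D]),(A,G,[B,A,C,G,F,E,D]),(A,G,[C,B,A,H,I,F,G,E,D]),
     (A,G,[C,B,A,I,H,F,G,E,D])],
    [(A,E,[A,D,E,B,C,K,J,H,I,G,F]),(A,F,[B,A,C,K,J,F,G,D,E,I,H]),(A,G,[A,C,B,D,E,K,J,G,F,I,H]),
     (A,F,[D,A,E,K,J,I,H,B,C,G,F]),(A,G,[A,E,D,B,C,K,J,H,I,G,F]),(A,H,[]),(A,H,[A,B,C,D,E,G,F]),
     (A,H,[A,D,E,B,C,H,I,G,F]),(A,H,[A,D,E,B,C,I,H,G,F]),(A,I,[]),(A,I,[A,D,E,B,C,I,H,F,G]),
     (A,I,[A,B,C,D,E,G,F]),(A,I,[A,D,E,B,C,I,H,G,F])]]"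

definition isos5 where
  "isos5 = [isos5_0]"

definition reps6_0 where
  "reps6_0 = [
    [(A,L,M),(A,J,K),(A,H,I),(A,F,G),(A,D,E),(A,B,C)],
    [(B,L,M),(A,J,K),(A,H,I),(A,F,G),(A,D,E),(A,B,C)],
    [(B,L,M),(B,J,K),(A,H,I),(A,F,G),(A,D,E),(A,B,C)],
    [(C,L,M),(B,J,K),(A,H,I),(A,F,G),(A,D,E),(A,B,C)],
    [(D,L,M),(B,J,K),(A,H,I),(A,F,G),(A,D,E),(A,B,C)],
    [(J,L,M),(B,J,K),(A,H,I),(A,F,G),(A,D,E),(A,B,C)],
    [(C,L,M),(B,J,K),(B,H,I),(A,F,G),(A,D,E),(A,B,C)],
    [(D,L,M),(B,J,K),(B,H,I),(A,F,G),(A,D,E),(A,B,C)],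
    [(D,L,M),(C,J,K),(B,H,I),(A,F,G),(A,D,E),(A,B,C)],
    [(H,L,M),(C,J,K),(B,H,I),(A,F,G),(A,D,E),(A,B,C)]]"

definition reps6_1 where
  "reps6_1 = [
    [(F,L,M),(D,J,K),(B,H,I),(A,F,G),(A,D,E),(A,B,C)],
    [(H,L,M),(D,J,K),(B,H,I),(A,F,G),(A,D,E),(A,B,C)],
    [(H,L,M),(H,J,K),(B,H,I),(A,F,G),(A,D,E),(A,B,C)],
    [(I,L,M),(H,J,K),(B,H,I),(A,F,G),(A,D,E),(A,B,C)],
    [(J,L,M),(H,J,K),(B,H,I),(A,F,G),(A,D,E),(A,B,C)],
    [(E,L,M),(D,J,K),(C,H,I),(B,F,G),(A,D,E),(A,B,C)],
    [(F,L,M),(D,J,K),(C,H,I),(B,F,G),(A,D,E),(A,B,C)],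
    [(J,L,M),(D,J,K),(C,H,I),(B,F,G),(A,D,E),(A,B,C)],
    [(H,L,M),(F,J,K),(D,H,I),(B,F,G),(A,D,E),(A,B,C)],
    [(H,J,L),(F,J,K),(D,H,I),(B,F,G),(A,D,E),(A,B,C)]]"

definition reps6_2 where
  "reps6_2 = [
    [(K,L,M),(F,H,J),(D,H,I),(B,F,G),(A,D,E),(A,B,C)],
    [(A,K,L),(F,H,J),(D,H,I),(B,F,G),(A,D,E),(A,B,C)],
    [(C,K,L),(F,H,J),(D,H,I),(B,F,G),(A,D,E),(A,B,C)]]"

definition reps6 where
  "reps6 = [reps6_0, reps6_1, reps6_2]"

definition isos6_0 where
  "isos6_0 = [
    [(A,A,[]),(A,B,[]),(A,B,[A,C,B]),(A,B,[A,D,E,C,B]),(A,B,[A,E,D,C,B]),(A,B,[A,F,G,D,E,C,B]),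
     (A,B,[A,G,F,D,E,C,B]),(A,B,[A,H,I,D,E,F,G,C,B]),(A,B,[A,I,H,D,E,F,G,C,B]),(A,B,[A,J,K,D,E,F,G,H,I,C,B]),
     (A,B,[A,K,J,D,E,F,G,H,I,C,B])],
    [(A,B,[A,B,C,M,L,F,G,H,I,E,D,K,J]),(A,C,[]),(A,D,[]),(A,E,[]),(A,E,[A,B,C,E,D]),(A,E,[A,B,C,F,G,E,D]),
     (A,E,[A,B,C,G,F,E,D]),(A,E,[A,B,C,H,I,F,G,E,D]),(A,E,[A,B,C,I,H,F,G,E,D]),(A,F,[]),
     (A,F,[A,B,C,D,E,F,G,H,I,K,J])],
    [(A,C,[A,B,C,M,L,F,G,E,D,J,K,I,H]),(A,C,[B,A,C,M,L,K,J,H,I,G,F,E,D]),(A,G,[]),(A,H,[]),(A,H,[A,B,C,E,D]),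
     (A,H,[A,B,C,F,G,E,D]),(A,H,[A,B,C,G,F,E,D]),(A,H,[B,A,C,H,I,K,J,G,F,E,D]),(A,H,[B,A,C,I,H,K,J,G,F,E,D]),
     (A,H,[B,A,C,J,K,I,H,G,F,E,D]),(A,H,[B,A,C,K,J,I,H,G,F,E,D])],
    [(A,D,[A,C,B,M,L,F,G,E,D,J,K,I,H]),(A,G,[B,A,C,M,L,I,H,G,F,E,D,K,J]),(A,G,[A,C,B,D,E,F,G,M,L,J,K,I,H]),
     (A,I,[]),(A,I,[A,B,C,E,D]),(A,I,[A,B,C,F,G,E,D]),(A,I,[A,B,C,G,F,E,D]),(A,J,[]),(A,J,[A,B,C,D,E,F,G,I,H]),
     (A,J,[A,C,B,D,E,F,G,J,K,I,H]),(A,J,[A,C,B,D,E,F,G,K,J,I,H])],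
    [(A,E,[A,D,E,B,C,M,L,G,F,J,K,I,H]),(A,H,[A,B,C,D,E,F,G,M,L,I,H,K,J]),(A,I,[A,C,B,D,E,F,G,M,L,I,H,K,J]),
     (A,H,[A,D,E,B,C,F,G,M,L,J,K,I,H]),(A,I,[A,E,D,B,C,F,G,M,L,J,K,I,H]),(B,A,[]),(B,A,[A,B,C,D,E,G,F]),
     (B,B,[]),(B,B,[A,B,C,D,E,F,G,I,H]),(B,B,[A,D,E,B,C,F,G,J,K,I,H]),(B,B,[A,D,E,B,C,F,G,K,J,I,H])],
    [(A,F,[A,B,C,M,L,F,G,E,D,H,I,K,J]),(A,H,[B,A,C,H,I,M,L,G,F,E,D,K,J]),(A,J,[A,B,C,D,E,F,G,H,I,M,L,K,J]),
     (B,B,[A,B,C,D,E,F,G,H,I,M,L,K,J]),(B,B,[A,B,C,E,D,F,G,H,I,M,L,K,J]),(B,B,[A,B,C,F,G,E,D,H,I,M,L,K,J]),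
     (B,B,[A,B,C,G,F,E,D,H,I,M,L,K,J]),(B,C,[]),(B,D,[]),(B,E,[]),(B,E,[A,B,C,D,E,F,G,H,I,K,J])],
    [(A,I,[A,C,B,D,E,M,L,H,I,G,F,K,J]),(A,J,[B,A,C,M,L,F,G,D,E,I,H,K,J]),(A,J,[C,A,B,M,L,I,H,D,E,G,F,K,J]),
     (B,D,[D,A,E,M,L,K,J,C,B,I,H,G,F]),(B,F,[]),(B,G,[]),(B,G,[A,B,C,D,E,G,F]),(B,G,[A,C,B,D,E,H,I,G,F]),
     (B,G,[A,C,B,D,E,I,H,G,F]),(B,H,[]),(B,H,[A,B,C,D,E,F,G,H,I,K,J])],
    [(B,B,[A,B,C,D,E,M,L,F,G,I,H,K,J]),(B,B,[B,A,C,F,G,M,L,D,E,J,K,I,H]),(B,G,[B,A,C,F,G,D,E,M,L,J,K,I,H]),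
     (B,E,[D,A,E,M,L,I,H,B,C,F,G,K,J]),(B,H,[A,E,D,B,C,M,L,H,I,F,G,K,J]),(B,E,[F,B,G,M,L,K,J,A,C,D,E,I,H]),
     (B,H,[B,G,F,A,C,M,L,K,J,D,E,I,H]),(B,I,[]),(B,I,[A,B,C,D,E,F,G,I,H]),(B,I,[B,A,C,F,G,D,E,J,K,I,H]),
     (B,I,[B,A,C,F,G,D,E,K,J,I,H]),(B,J,[]),(B,J,[B,A,C,F,G,D,E,K,J,H,I]),(B,J,[A,B,C,D,E,F,G,I,H]),
     (B,J,[B,A,C,F,G,D,E,K,J,I,H])],
    [(C,A,[]),(C,B,[]),(C,B,[B,F,G,A,C,H,J,D,E,I]),(C,C,[]),(C,B,[D,H,I,A,E,F,J,B,C,G]),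
     (C,C,[A,D,E,B,C,H,I,F,G]),(C,B,[F,B,G,H,J,A,C,D,I,E]),(C,C,[F,B,G,H,J,A,C,D,I,E]),
     (C,B,[H,F,J,D,I,B,G,A,E,C]),(C,C,[H,D,I,F,J,A,E,B,G,C]),(C,C,[H,F,J,D,I,B,G,A,E,C])]]"

definition isos6 where
  "isos6 = [isos6_0]"

definition reps7_0 where
  "reps7_0 = [
    [(A,N,P),(A,L,M),(A,J,K),(A,H,I),(A,F,G),(A,D,E),(A,B,C)],
    [(B,N,P),(A,L,M),(A,J,K),(A,H,I),(A,F,G),(A,D,E),(A,B,C)],
    [(B,N,P),(B,L,M),(A,J,K),(A,H,I),(A,F,G),(A,D,E),(A,B,C)],
    [(C,N,P),(B,L,M),(A,J,K),(A,H,I),(A,F,G),(A,D,E),(A,B,C)],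
    [(D,N,P),(B,L,M),(A,J,K),(A,H,I),(A,F,G),(A,D,E),(A,B,C)],
    [(L,N,P),(B,L,M),(A,J,K),(A,H,I),(A,F,G),(A,D,E),(A,B,C)],
    [(B,N,P),(B,L,M),(B,J,K),(A,H,I),(A,F,G),(A,D,E),(A,B,C)],
    [(C,N,P),(B,L,M),(B,J,K),(A,H,I),(A,F,G),(A,D,E),(A,B,C)],
    [(D,N,P),(B,L,M),(B,J,K),(A,H,I),(A,F,G),(A,D,E),(A,B,C)],
    [(J,N,P),(B,L,M),(B,J,K),(A,H,I),(A,F,G),(A,D,E),(A,B,C)]]"

definition reps7_1 where
  "reps7_1 = [
    [(D,N,P),(C,L,M),(B,J,K),(A,H,I),(A,F,G),(A,D,E),(A,B,C)],
    [(J,N,P),(C,L,M),(B,J,K),(A,H,I),(A,F,G),(A,D,E),(A,B,C)],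
    [(F,N,P),(D,L,M),(B,J,K),(A,H,I),(A,F,G),(A,D,E),(A,B,C)],
    [(J,N,P),(D,L,M),(B,J,K),(A,H,I),(A,F,G),(A,D,E),(A,B,C)],
    [(J,N,P),(J,L,M),(B,J,K),(A,H,I),(A,F,G),(A,D,E),(A,B,C)],
    [(K,N,P),(J,L,M),(B,J,K),(A,H,I),(A,F,G),(A,D,E),(A,B,C)],
    [(L,N,P),(J,L,M),(B,J,K),(A,H,I),(A,F,G),(A,D,E),(A,B,C)],
    [(C,N,P),(C,L,M),(B,J,K),(B,H,I),(A,F,G),(A,D,E),(A,B,C)],
    [(D,N,P),(C,L,M),(B,J,K),(B,H,I),(A,F,G),(A,D,E),(A,B,C)],
    [(L,N,P),(C,L,M),(B,J,K),(B,H,I),(A,F,G),(A,D,E),(A,B,C)]]"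

definition reps7_2 where
  "reps7_2 = [
    [(D,N,P),(D,L,M),(B,J,K),(B,H,I),(A,F,G),(A,D,E),(A,B,C)],
    [(E,N,P),(D,L,M),(B,J,K),(B,H,I),(A,F,G),(A,D,E),(A,B,C)],
    [(F,N,P),(D,L,M),(B,J,K),(B,H,I),(A,F,G),(A,D,E),(A,B,C)],
    [(H,N,P),(D,L,M),(B,J,K),(B,H,I),(A,F,G),(A,D,E),(A,B,C)],
    [(L,N,P),(D,L,M),(B,J,K),(B,H,I),(A,F,G),(A,D,E),(A,B,C)],
    [(E,N,P),(D,L,M),(C,J,K),(B,H,I),(A,F,G),(A,D,E),(A,B,C)],
    [(F,N,P),(D,L,M),(C,J,K),(B,H,I),(A,F,G),(A,D,E),(A,B,C)],
    [(H,N,P),(D,L,M),(C,J,K),(B,H,I),(A,F,G),(A,D,E),(A,B,C)],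
    [(L,N,P),(D,L,M),(C,J,K),(B,H,I),(A,F,G),(A,D,E),(A,B,C)],
    [(H,N,P),(H,L,M),(C,J,K),(B,H,I),(A,F,G),(A,D,E),(A,B,C)]]"

definition reps7_3 where
  "reps7_3 = [
    [(I,N,P),(H,L,M),(C,J,K),(B,H,I),(A,F,G),(A,D,E),(A,B,C)],
    [(J,N,P),(H,L,M),(C,J,K),(B,H,I),(A,F,G),(A,D,E),(A,B,C)],
    [(L,N,P),(H,L,M),(C,J,K),(B,H,I),(A,F,G),(A,D,E),(A,B,C)],
    [(H,N,P),(F,L,M),(D,J,K),(B,H,I),(A,F,G),(A,D,E),(A,B,C)],
    [(H,N,P),(H,L,M),(D,J,K),(B,H,I),(A,F,G),(A,D,E),(A,B,C)],
    [(I,N,P),(H,L,M),(D,J,K),(B,H,I),(A,F,G),(A,D,E),(A,B,C)],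
    [(J,N,P),(H,L,M),(D,J,K),(B,H,I),(A,F,G),(A,D,E),(A,B,C)],
    [(L,N,P),(H,L,M),(D,J,K),(B,H,I),(A,F,G),(A,D,E),(A,B,C)],
    [(J,N,P),(I,L,M),(H,J,K),(B,H,I),(A,F,G),(A,D,E),(A,B,C)],
    [(J,N,P),(J,L,M),(H,J,K),(B,H,I),(A,F,G),(A,D,E),(A,B,C)]]"

definition reps7_4 where
  "reps7_4 = [
    [(K,N,P),(J,L,M),(H,J,K),(B,H,I),(A,F,G),(A,D,E),(A,B,C)],
    [(L,N,P),(J,L,M),(H,J,K),(B,H,I),(A,F,G),(A,D,E),(A,B,C)],
    [(F,N,P),(E,L,M),(D,J,K),(C,H,I),(B,F,G),(A,D,E),(A,B,C)],
    [(H,N,P),(F,L,M),(D,J,K),(C,H,I),(B,F,G),(A,D,E),(A,B,C)],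
    [(J,N,P),(F,L,M),(D,J,K),(C,H,I),(B,F,G),(A,D,E),(A,B,C)],
    [(K,N,P),(J,L,M),(D,J,K),(C,H,I),(B,F,G),(A,D,E),(A,B,C)],
    [(L,N,P),(J,L,M),(D,J,K),(C,H,I),(B,F,G),(A,D,E),(A,B,C)],
    [(J,N,P),(H,L,M),(F,J,K),(D,H,I),(B,F,G),(A,D,E),(A,B,C)],
    [(J,L,N),(H,L,M),(F,J,K),(D,H,I),(B,F,G),(A,D,E),(A,B,C)],
    [(M,N,P),(H,J,L),(F,J,K),(D,H,I),(B,F,G),(A,D,E),(A,B,C)]]"

definition reps7_5 where
  "reps7_5 = [
    [(A,M,N),(H,J,L),(F,J,K),(D,H,I),(B,F,G),(A,D,E),(A,B,C)],
    [(C,M,N),(H,J,L),(F,J,K),(D,H,I),(B,F,G),(A,D,E),(A,B,C)],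
    [(C,L,M),(H,J,L),(F,J,K),(D,H,I),(B,F,G),(A,D,E),(A,B,C)],
    [(K,N,P),(K,L,M),(F,H,J),(D,H,I),(B,F,G),(A,D,E),(A,B,C)],
    [(M,N,P),(A,K,L),(F,H,J),(D,H,I),(B,F,G),(A,D,E),(A,B,C)],
    [(A,M,N),(A,K,L),(F,H,J),(D,H,I),(B,F,G),(A,D,E),(A,B,C)],
    [(B,M,N),(A,K,L),(F,H,J),(D,H,I),(B,F,G),(A,D,E),(A,B,C)],
    [(C,M,N),(A,K,L),(F,H,J),(D,H,I),(B,F,G),(A,D,E),(A,B,C)],
    [(F,M,N),(A,K,L),(F,H,J),(D,H,I),(B,F,G),(A,D,E),(A,B,C)],
    [(G,M,N),(A,K,L),(F,H,J),(D,H,I),(B,F,G),(A,D,E),(A,B,C)]]"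

definition reps7_6 where
  "reps7_6 = [
    [(J,M,N),(A,K,L),(F,H,J),(D,H,I),(B,F,G),(A,D,E),(A,B,C)],
    [(K,M,N),(A,K,L),(F,H,J),(D,H,I),(B,F,G),(A,D,E),(A,B,C)],
    [(J,K,M),(A,K,L),(F,H,J),(D,H,I),(B,F,G),(A,D,E),(A,B,C)],
    [(M,N,P),(C,K,L),(F,H,J),(D,H,I),(B,F,G),(A,D,E),(A,B,C)],
    [(C,M,N),(C,K,L),(F,H,J),(D,H,I),(B,F,G),(A,D,E),(A,B,C)],
    [(E,M,N),(C,K,L),(F,H,J),(D,H,I),(B,F,G),(A,D,E),(A,B,C)],
    [(I,M,N),(C,K,L),(F,H,J),(D,H,I),(B,F,G),(A,D,E),(A,B,C)],
    [(K,M,N),(C,K,L),(F,H,J),(D,H,I),(B,F,G),(A,D,E),(A,B,C)]]"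

definition reps7 where
  "reps7 = [reps7_0, reps7_1, reps7_2, reps7_3, reps7_4, reps7_5, reps7_6]"

definition isos7_0 where
  "isos7_0 = [
    [(A,A,[]),(A,B,[]),(A,B,[A,C,B]),(A,B,[A,D,E,C,B]),(A,B,[A,E,D,C,B]),(A,B,[A,F,G,D,E,C,B]),
     (A,B,[A,G,F,D,E,C,B]),(A,B,[A,H,I,D,E,F,G,C,B]),(A,B,[A,I,H,D,E,F,G,C,B]),(A,B,[A,J,K,D,E,F,G,H,I,C,B]),
     (A,B,[A,K,J,D,E,F,G,H,I,C,B]),(A,B,[A,L,M,D,E,F,G,H,I,J,K,C,B]),(A,B,[A,M,L,D,E,F,G,H,I,J,K,C,B])],
    [(A,B,[A,B,C,P,N,F,G,H,I,J,K,E,D,M,L]),(A,C,[]),(A,D,[]),(A,E,[]),(A,E,[A,B,C,E,D]),(A,E,[A,B,C,F,G,E,D]),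
     (A,E,[A,B,C,G,F,E,D]),(A,E,[A,B,C,H,I,F,G,E,D]),(A,E,[A,B,C,I,H,F,G,E,D]),(A,E,[A,B,C,J,K,F,G,H,I,E,D]),
     (A,E,[A,B,C,K,J,F,G,H,I,E,D]),(A,F,[]),(A,F,[A,B,C,D,E,F,G,H,I,J,K,M,L])],
    [(A,C,[A,B,C,P,N,F,G,H,I,E,D,L,M,K,J]),(A,G,[]),(A,H,[]),(A,I,[]),(A,I,[A,B,C,E,D]),(A,I,[A,B,C,F,G,E,D]),
     (A,I,[A,B,C,G,F,E,D]),(A,I,[A,B,C,H,I,F,G,E,D]),(A,I,[A,B,C,I,H,F,G,E,D]),(A,J,[]),
     (A,J,[A,B,C,D,E,F,G,H,I,K,J]),(A,J,[A,B,C,D,E,F,G,H,I,L,M,K,J]),(A,J,[A,B,C,D,E,F,G,H,I,M,L,K,J])],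
    [(A,D,[A,C,B,P,N,F,G,H,I,E,D,L,M,K,J]),(A,H,[A,B,C,D,E,F,G,H,I,P,N,K,J,M,L]),
     (A,H,[A,C,B,D,E,F,G,H,I,P,N,L,M,K,J]),(B,A,[]),(B,A,[A,B,C,E,D]),(B,A,[A,B,C,F,G,E,D]),
     (B,A,[A,B,C,G,F,E,D]),(B,A,[A,B,C,H,I,F,G,E,D]),(B,A,[A,B,C,I,H,F,G,E,D]),(B,B,[]),
     (B,B,[A,B,C,D,E,F,G,H,I,K,J]),(B,B,[A,C,B,D,E,F,G,H,I,L,M,K,J]),(B,B,[A,C,B,D,E,F,G,H,I,M,L,K,J])],
    [(A,E,[A,D,E,B,C,P,N,H,I,G,F,L,M,K,J]),(A,I,[A,B,C,D,E,F,G,H,I,P,N,K,J,M,L]),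
     (B,A,[A,C,B,D,E,F,G,H,I,P,N,K,J,M,L]),(A,I,[A,D,E,B,C,F,G,H,I,P,N,L,M,K,J]),
     (B,A,[A,E,D,B,C,F,G,H,I,P,N,L,M,K,J]),(B,C,[]),(B,C,[A,B,C,D,E,G,F]),(B,C,[A,B,C,D,E,H,I,G,F]),
     (B,C,[A,B,C,D,E,I,H,G,F]),(B,D,[]),(B,D,[A,B,C,D,E,F,G,H,I,K,J]),(B,D,[A,D,E,B,C,F,G,H,I,L,M,K,J]),
     (B,D,[A,D,E,B,C,F,G,H,I,M,L,K,J])],
    [(A,F,[A,B,C,P,N,F,G,H,I,E,D,J,K,M,L]),(A,J,[A,B,C,D,E,F,G,H,I,J,K,P,N,M,L]),
     (B,B,[A,B,C,D,E,F,G,H,I,J,K,P,N,M,L]),(B,D,[A,B,C,D,E,F,G,H,I,J,K,P,N,M,L]),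
     (B,D,[A,B,C,E,D,F,G,H,I,J,K,P,N,M,L]),(B,D,[A,B,C,F,G,E,D,H,I,J,K,P,N,M,L]),
     (B,D,[A,B,C,G,F,E,D,H,I,J,K,P,N,M,L]),(B,D,[A,B,C,H,I,F,G,E,D,J,K,P,N,M,L]),
     (B,D,[A,B,C,I,H,F,G,E,D,J,K,P,N,M,L]),(B,E,[]),(B,F,[]),(B,G,[]),(B,G,[A,B,C,D,E,F,G,H,I,J,K,M,L])],
    [(A,H,[A,B,C,P,N,F,G,E,D,J,K,I,H,M,L]),(A,H,[B,A,C,P,N,K,J,H,I,G,F,E,D,M,L]),(B,H,[]),(B,I,[]),
     (B,I,[A,B,C,E,D]),(B,I,[A,B,C,F,G,E,D]),(B,I,[A,B,C,G,F,E,D]),(B,I,[B,A,C,H,I,K,J,G,F,E,D]),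
     (B,I,[B,A,C,I,H,K,J,G,F,E,D]),(B,I,[B,A,C,J,K,I,H,G,F,E,D]),(B,I,[B,A,C,K,J,I,H,G,F,E,D]),(B,J,[]),
     (B,J,[A,B,C,D,E,F,G,H,I,J,K,M,L])],
    [(A,I,[A,B,C,D,E,P,N,G,F,J,K,I,H,M,L]),(A,J,[B,A,C,P,N,K,J,H,I,D,E,G,F,M,L]),
     (B,I,[A,B,C,D,E,F,G,H,I,J,K,P,N,M,L]),(C,A,[]),(C,B,[]),(C,C,[]),(C,C,[A,B,C,D,E,G,F]),(C,D,[]),
     (C,D,[A,B,C,D,E,F,G,I,H]),(C,D,[A,B,C,D,E,F,G,J,K,I,H]),(C,D,[A,B,C,D,E,F,G,K,J,I,H]),(C,E,[]),
     (C,E,[A,B,C,D,E,F,G,H,I,J,K,M,L])],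
    [(B,A,[A,C,B,D,E,P,N,G,F,J,K,I,H,M,L]),(B,I,[A,B,C,D,E,F,G,P,N,I,H,K,J,M,L]),
     (B,I,[A,C,B,D,E,F,G,P,N,J,K,I,H,M,L]),(C,B,[A,D,E,C,B,F,G,P,N,M,L,K,J,I,H]),(C,F,[]),(C,G,[]),
     (C,G,[A,B,C,D,E,G,F]),(C,H,[]),(C,H,[A,B,C,D,E,F,G,I,H]),(C,H,[A,C,B,D,E,F,G,J,K,I,H]),
     (C,H,[A,C,B,D,E,F,G,K,J,I,H]),(C,I,[]),(C,I,[A,B,C,D,E,F,G,H,I,J,K,M,L])],
    [(B,B,[A,B,C,P,N,F,G,E,D,H,I,K,J,M,L]),(B,I,[B,A,C,H,I,P,N,G,F,E,D,K,J,M,L]),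
     (B,J,[A,C,B,D,E,F,G,P,N,J,K,H,I,M,L]),(C,H,[A,B,C,D,E,F,G,H,I,J,K,P,N,M,L]),
     (C,H,[A,B,C,E,D,F,G,H,I,J,K,P,N,M,L]),(C,H,[A,B,C,F,G,E,D,H,I,J,K,P,N,M,L]),
     (C,H,[A,B,C,G,F,E,D,H,I,J,K,P,N,M,L]),(C,J,[]),(D,A,[]),(D,B,[]),(D,B,[A,B,C,D,E,F,G,H,I,K,J]),(D,C,[]),
     (D,C,[A,B,C,D,E,F,G,H,I,J,K,M,L])]]"

definition isos7_1 where
  "isos7_1 = [
    [(B,C,[A,D,E,F,G,B,C,P,N,J,K,L,M,I,H]),(C,C,[A,B,C,F,G,D,E,P,N,I,H,L,M,K,J]),
     (C,G,[A,C,B,F,G,D,E,P,N,I,H,L,M,K,J]),(C,C,[A,D,E,F,G,B,C,P,N,J,K,L,M,I,H]),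
     (C,G,[A,E,D,F,G,B,C,P,N,J,K,L,M,I,H]),(C,C,[A,F,G,D,E,B,C,P,N,M,L,K,J,I,H]),
     (C,G,[A,G,F,D,E,B,C,P,N,M,L,K,J,I,H]),(D,D,[]),(D,D,[A,B,C,D,E,F,G,I,H]),(D,D,[A,D,E,B,C,F,G,J,K,I,H]),
     (D,D,[A,D,E,B,C,F,G,K,J,I,H]),(D,D,[A,F,G,D,E,B,C,L,M,J,K,I,H]),(D,D,[A,F,G,D,E,B,C,M,L,J,K,I,H])],
    [(B,D,[A,B,C,D,E,P,N,G,F,H,I,K,J,M,L]),(C,D,[B,A,C,H,I,P,N,D,E,G,F,L,M,K,J]),
     (C,H,[A,B,C,D,E,F,G,H,I,P,N,K,J,M,L]),(C,E,[A,D,E,B,C,F,G,P,N,J,K,H,I,M,L]),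
     (C,I,[A,E,D,B,C,F,G,P,N,J,K,H,I,M,L]),(D,D,[A,B,C,F,G,D,E,H,I,P,N,K,J,M,L]),
     (D,D,[A,B,C,G,F,D,E,H,I,P,N,K,J,M,L]),(D,E,[]),(D,F,[]),(D,G,[]),(D,G,[A,B,C,D,E,F,G,H,I,K,J]),(D,H,[]),
     (D,H,[A,B,C,D,E,F,G,H,I,J,K,M,L])],
    [(B,E,[A,B,C,P,N,F,G,E,D,H,I,L,M,K,J]),(C,A,[B,H,I,A,C,P,N,M,L,J,K,G,F,E,D]),
     (C,J,[A,B,C,D,E,F,G,H,I,P,N,L,M,K,J]),(D,E,[A,B,C,D,E,F,G,H,I,P,N,L,M,K,J]),
     (D,E,[A,B,C,E,D,F,G,H,I,P,N,L,M,K,J]),(D,E,[A,B,C,F,G,E,D,H,I,P,N,L,M,K,J]),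
     (D,E,[A,B,C,G,F,E,D,H,I,P,N,L,M,K,J]),(B,E,[H,B,I,P,N,M,L,K,J,A,C,G,F,E,D]),
     (C,J,[H,B,I,M,L,K,J,A,C,P,N,G,F,E,D]),(D,E,[H,B,I,J,K,M,L,A,C,P,N,G,F,E,D]),
     (D,E,[H,B,I,K,J,M,L,A,C,P,N,G,F,E,D]),(D,E,[H,B,I,L,M,K,J,A,C,P,N,G,F,E,D]),
     (D,E,[H,B,I,M,L,K,J,A,C,P,N,G,F,E,D])],
    [(B,F,[A,B,C,P,N,F,G,E,D,I,H,L,M,K,J]),(C,B,[B,A,C,I,H,P,N,G,F,E,D,L,M,K,J]),
     (D,A,[A,B,C,D,E,F,G,I,H,P,N,L,M,K,J]),(D,F,[A,B,C,D,E,F,G,I,H,P,N,L,M,K,J]),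
     (D,F,[A,B,C,E,D,F,G,I,H,P,N,L,M,K,J]),(D,F,[A,B,C,F,G,E,D,I,H,P,N,L,M,K,J]),
     (D,F,[A,B,C,G,F,E,D,I,H,P,N,L,M,K,J]),(C,J,[H,B,I,P,N,K,J,A,C,M,L,G,F,E,D]),
     (C,J,[I,B,H,P,N,M,L,A,C,J,K,G,F,E,D]),(D,I,[]),(D,I,[A,B,C,D,E,F,G,H,I,K,J]),
     (D,I,[A,B,C,D,E,F,G,I,H,L,M,K,J]),(D,I,[A,B,C,D,E,F,G,I,H,M,L,K,J])],
    [(B,G,[A,B,C,P,N,F,G,E,D,H,I,J,K,M,L]),(C,E,[B,A,C,H,I,P,N,G,F,E,D,J,K,M,L]),
     (D,C,[A,B,C,D,E,F,G,H,I,P,N,J,K,M,L]),(D,H,[A,B,C,D,E,F,G,H,I,P,N,J,K,M,L]),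
     (D,H,[A,B,C,E,D,F,G,H,I,P,N,J,K,M,L]),(D,H,[A,B,C,F,G,E,D,H,I,P,N,J,K,M,L]),
     (D,H,[A,B,C,G,F,E,D,H,I,P,N,J,K,M,L]),(D,E,[H,B,I,J,K,P,N,A,C,M,L,G,F,E,D]),
     (D,I,[A,B,C,D,E,F,G,H,I,J,K,P,N,M,L]),(D,J,[]),(E,A,[]),(E,B,[]),(E,B,[A,B,C,D,E,F,G,H,I,J,K,M,L])],
    [(C,F,[A,E,D,C,B,P,N,M,L,J,K,I,H,G,F]),(D,A,[B,A,C,P,N,F,G,E,D,I,H,L,M,K,J]),
     (D,A,[C,A,B,P,N,I,H,E,D,G,F,L,M,K,J]),(D,A,[D,A,E,P,N,K,J,C,B,M,L,I,H,G,F]),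
     (D,A,[E,A,D,P,N,M,L,C,B,J,K,I,H,G,F]),(E,C,[]),(E,C,[A,B,C,D,E,G,F]),(E,C,[A,C,B,D,E,H,I,G,F]),
     (E,C,[A,C,B,D,E,I,H,G,F]),(E,C,[A,D,E,C,B,J,K,M,L,I,H,G,F]),(E,C,[A,D,E,C,B,K,J,M,L,I,H,G,F]),
     (E,C,[A,E,D,C,B,L,M,K,J,I,H,G,F]),(E,C,[A,E,D,C,B,M,L,K,J,I,H,G,F])],
    [(C,H,[A,B,C,D,E,P,N,F,G,I,H,K,J,M,L]),(C,H,[B,A,C,F,G,P,N,D,E,I,H,L,M,K,J]),
     (D,B,[C,B,A,P,N,I,H,F,G,D,E,L,M,K,J]),(D,I,[D,A,E,P,N,K,J,B,C,F,G,I,H,M,L]),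
     (E,C,[A,B,C,E,D,F,G,H,I,P,N,K,J,M,L]),(D,I,[F,B,G,P,N,M,L,A,C,D,E,I,H,K,J]),
     (E,C,[B,A,C,G,F,D,E,H,I,P,N,L,M,K,J]),(E,D,[]),(E,D,[A,B,C,D,E,F,G,I,H]),(E,E,[]),
     (E,E,[A,B,C,D,E,F,G,H,I,K,J]),(E,E,[B,A,C,F,G,D,E,H,I,L,M,K,J]),(E,E,[B,A,C,F,G,D,E,H,I,M,L,K,J])],
    [(C,I,[A,C,B,D,E,P,N,H,I,G,F,J,K,M,L]),(D,C,[B,A,C,P,N,F,G,D,E,I,H,J,K,M,L]),
     (D,C,[C,A,B,P,N,I,H,D,E,G,F,J,K,M,L]),(D,F,[D,A,E,J,K,P,N,C,B,M,L,I,H,G,F]),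
     (E,C,[A,D,E,C,B,J,K,P,N,I,H,G,F,M,L]),(E,E,[A,B,C,D,E,F,G,H,I,J,K,P,N,M,L]),
     (E,E,[A,B,C,D,E,G,F,H,I,J,K,P,N,M,L]),(E,E,[A,C,B,D,E,H,I,G,F,J,K,P,N,M,L]),
     (E,E,[A,C,B,D,E,I,H,G,F,J,K,P,N,M,L]),(E,A,[J,D,K,P,N,M,L,A,E,C,B,I,H,G,F]),(E,F,[]),(E,G,[]),
     (E,G,[A,B,C,D,E,F,G,H,I,J,K,M,L])],
    [(D,G,[A,D,E,B,C,P,N,H,I,F,G,L,M,K,J]),(D,H,[B,A,C,F,G,P,N,D,E,J,K,H,I,M,L]),
     (E,E,[A,B,C,D,E,F,G,P,N,H,I,K,J,M,L]),(D,H,[D,A,E,H,I,P,N,B,C,M,L,F,G,K,J]),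
     (E,E,[A,D,E,B,C,H,I,P,N,F,G,L,M,K,J]),(E,B,[F,B,G,P,N,K,J,A,C,D,E,H,I,M,L]),
     (E,G,[B,G,F,A,C,P,N,K,J,D,E,H,I,M,L]),(E,B,[H,D,I,P,N,M,L,A,E,B,C,F,G,K,J]),
     (E,G,[D,I,H,A,E,P,N,M,L,B,C,F,G,K,J]),(E,H,[]),(E,H,[A,B,C,D,E,F,G,H,I,K,J]),
     (E,H,[A,D,E,B,C,H,I,F,G,L,M,K,J]),(E,H,[A,D,E,B,C,H,I,F,G,M,L,K,J]),(E,I,[]),
     (E,I,[A,D,E,B,C,H,I,F,G,M,L,J,K]),(E,I,[A,B,C,D,E,F,G,H,I,K,J]),(E,I,[A,D,E,B,C,H,I,F,G,M,L,K,J])],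
    [(E,J,[]),(F,A,[]),(F,A,[B,A,C,F,G,D,E,J,K,H,I]),(F,B,[]),(F,A,[D,H,I,A,E,J,L,B,C,F,K,G]),
     (F,B,[D,A,E,H,I,B,C,J,L,F,G,K]),(F,A,[F,J,K,B,G,H,L,A,C,D,I,E]),(F,B,[F,B,G,J,K,A,C,H,L,D,E,I]),
     (F,A,[H,J,L,D,I,F,K,A,E,B,G,C]),(F,B,[D,H,I,A,E,J,L,B,C,F,K,G]),(F,A,[J,H,L,F,K,D,I,B,G,A,E,C]),
     (F,B,[J,F,K,H,L,B,G,D,I,A,C,E]),(F,B,[J,H,L,F,K,D,I,B,G,A,E,C]),(F,C,[]),(F,C,[J,F,K,H,L,B,G,D,I,A,C,E]),
     (F,C,[D,H,I,A,E,J,L,B,C,F,K,G])]]"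

definition isos7_2 where
  "isos7_2 = [
    [(F,D,[]),(F,D,[A,B,C,D,E,F,G,H,I,J,L,K]),(F,D,[A,B,C,D,E,F,G,H,I,J,M,L,K])],
    [(F,E,[]),(F,F,[]),(F,G,[]),(F,H,[]),(F,G,[A,D,E,B,C,H,I,F,G]),(F,H,[A,D,E,B,C,H,I,F,G]),(F,I,[]),(F,J,[]),
     (F,I,[A,D,E,B,C,H,I,F,G]),(F,J,[A,D,E,B,C,H,I,F,G]),(G,A,[]),(G,B,[]),(G,B,[A,B,C,D,E,F,G,H,I,J,L,K]),
     (G,C,[]),(G,C,[A,B,C,D,E,F,G,H,I,J,L,K])],
    [(G,D,[]),(F,H,[A,B,C,D,E,F,G,H,I,J,N,M,L,K]),(F,H,[B,A,C,F,G,D,E,H,J,I,N,M,L,K]),(G,E,[]),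
     (F,J,[D,A,E,H,I,B,C,F,J,G,N,M,L,K]),(G,F,[]),(F,J,[F,B,G,H,J,A,C,D,I,E,N,M,L,K]),
     (G,F,[B,A,C,F,G,D,E,H,J,I]),(G,A,[H,F,J,D,I,B,G,A,E,C,N,M,L,K]),(G,G,[]),(G,G,[B,A,C,F,G,D,E,H,J,I]),
     (G,H,[]),(G,H,[A,B,C,D,E,F,G,H,I,J,L,K]),(G,C,[H,K,M,F,J,C,L,B,G,A,D,I,E]),
     (G,C,[H,L,M,F,J,C,K,B,G,A,D,I,E]),(F,C,[I,H,D,K,M,F,J,C,L,B,G,A,E]),(F,C,[H,I,D,F,J,L,M,B,G,C,K,A,E]),
     (F,C,[J,H,F,K,M,D,I,C,L,A,E,B,G]),(F,C,[H,J,F,D,I,L,M,A,E,C,K,B,G])]]"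

definition isos7 where
  "isos7 = [isos7_0, isos7_1, isos7_2]"

definition reps8_0 where
  "reps8_0 = [
    [(L,N,Q),(J,N,P),(H,L,M),(F,J,K),(D,H,I),(B,F,G),(A,D,E),(A,B,C)],
    [(A,P,Q),(J,L,N),(H,L,M),(F,J,K),(D,H,I),(B,F,G),(A,D,E),(A,B,C)],
    [(C,P,Q),(J,L,N),(H,L,M),(F,J,K),(D,H,I),(B,F,G),(A,D,E),(A,B,C)],
    [(A,N,P),(J,L,N),(H,L,M),(F,J,K),(D,H,I),(B,F,G),(A,D,E),(A,B,C)],
    [(C,M,P),(J,L,N),(H,L,M),(F,J,K),(D,H,I),(B,F,G),(A,D,E),(A,B,C)],
    [(A,P,Q),(A,M,N),(H,J,L),(F,J,K),(D,H,I),(B,F,G),(A,D,E),(A,B,C)],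
    [(B,P,Q),(A,M,N),(H,J,L),(F,J,K),(D,H,I),(B,F,G),(A,D,E),(A,B,C)],
    [(C,P,Q),(A,M,N),(H,J,L),(F,J,K),(D,H,I),(B,F,G),(A,D,E),(A,B,C)],
    [(F,P,Q),(A,M,N),(H,J,L),(F,J,K),(D,H,I),(B,F,G),(A,D,E),(A,B,C)],
    [(G,P,Q),(A,M,N),(H,J,L),(F,J,K),(D,H,I),(B,F,G),(A,D,E),(A,B,C)]]"

definition reps8_1 where
  "reps8_1 = [
    [(J,P,Q),(A,M,N),(H,J,L),(F,J,K),(D,H,I),(B,F,G),(A,D,E),(A,B,C)],
    [(K,P,Q),(A,M,N),(H,J,L),(F,J,K),(D,H,I),(B,F,G),(A,D,E),(A,B,C)],
    [(M,P,Q),(A,M,N),(H,J,L),(F,J,K),(D,H,I),(B,F,G),(A,D,E),(A,B,C)],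
    [(J,M,P),(A,M,N),(H,J,L),(F,J,K),(D,H,I),(B,F,G),(A,D,E),(A,B,C)],
    [(K,M,P),(A,M,N),(H,J,L),(F,J,K),(D,H,I),(B,F,G),(A,D,E),(A,B,C)],
    [(C,P,Q),(C,M,N),(H,J,L),(F,J,K),(D,H,I),(B,F,G),(A,D,E),(A,B,C)],
    [(E,P,Q),(C,M,N),(H,J,L),(F,J,K),(D,H,I),(B,F,G),(A,D,E),(A,B,C)],
    [(I,P,Q),(C,M,N),(H,J,L),(F,J,K),(D,H,I),(B,F,G),(A,D,E),(A,B,C)],
    [(L,P,Q),(C,M,N),(H,J,L),(F,J,K),(D,H,I),(B,F,G),(A,D,E),(A,B,C)],
    [(M,P,Q),(C,M,N),(H,J,L),(F,J,K),(D,H,I),(B,F,G),(A,D,E),(A,B,C)]]"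

definition reps8_2 where
  "reps8_2 = [
    [(L,M,P),(C,M,N),(H,J,L),(F,J,K),(D,H,I),(B,F,G),(A,D,E),(A,B,C)],
    [(N,P,Q),(C,L,M),(H,J,L),(F,J,K),(D,H,I),(B,F,G),(A,D,E),(A,B,C)],
    [(A,N,P),(C,L,M),(H,J,L),(F,J,K),(D,H,I),(B,F,G),(A,D,E),(A,B,C)],
    [(C,N,P),(C,L,M),(H,J,L),(F,J,K),(D,H,I),(B,F,G),(A,D,E),(A,B,C)],
    [(D,N,P),(C,L,M),(H,J,L),(F,J,K),(D,H,I),(B,F,G),(A,D,E),(A,B,C)],
    [(E,N,P),(C,L,M),(H,J,L),(F,J,K),(D,H,I),(B,F,G),(A,D,E),(A,B,C)],
    [(M,N,P),(C,L,M),(H,J,L),(F,J,K),(D,H,I),(B,F,G),(A,D,E),(A,B,C)],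
    [(E,K,N),(C,L,M),(H,J,L),(F,J,K),(D,H,I),(B,F,G),(A,D,E),(A,B,C)],
    [(A,P,Q),(A,M,N),(A,K,L),(F,H,J),(D,H,I),(B,F,G),(A,D,E),(A,B,C)],
    [(B,P,Q),(A,M,N),(A,K,L),(F,H,J),(D,H,I),(B,F,G),(A,D,E),(A,B,C)]]"

definition reps8_3 where
  "reps8_3 = [
    [(C,P,Q),(A,M,N),(A,K,L),(F,H,J),(D,H,I),(B,F,G),(A,D,E),(A,B,C)],
    [(F,P,Q),(A,M,N),(A,K,L),(F,H,J),(D,H,I),(B,F,G),(A,D,E),(A,B,C)],
    [(G,P,Q),(A,M,N),(A,K,L),(F,H,J),(D,H,I),(B,F,G),(A,D,E),(A,B,C)],
    [(J,P,Q),(A,M,N),(A,K,L),(F,H,J),(D,H,I),(B,F,G),(A,D,E),(A,B,C)],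
    [(K,P,Q),(A,M,N),(A,K,L),(F,H,J),(D,H,I),(B,F,G),(A,D,E),(A,B,C)],
    [(C,P,Q),(B,M,N),(A,K,L),(F,H,J),(D,H,I),(B,F,G),(A,D,E),(A,B,C)],
    [(D,P,Q),(B,M,N),(A,K,L),(F,H,J),(D,H,I),(B,F,G),(A,D,E),(A,B,C)],
    [(E,P,Q),(B,M,N),(A,K,L),(F,H,J),(D,H,I),(B,F,G),(A,D,E),(A,B,C)],
    [(H,P,Q),(B,M,N),(A,K,L),(F,H,J),(D,H,I),(B,F,G),(A,D,E),(A,B,C)],
    [(I,P,Q),(B,M,N),(A,K,L),(F,H,J),(D,H,I),(B,F,G),(A,D,E),(A,B,C)]]"

definition reps8_4 where
  "reps8_4 = [
    [(K,P,Q),(B,M,N),(A,K,L),(F,H,J),(D,H,I),(B,F,G),(A,D,E),(A,B,C)],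
    [(C,P,Q),(C,M,N),(A,K,L),(F,H,J),(D,H,I),(B,F,G),(A,D,E),(A,B,C)],
    [(E,P,Q),(C,M,N),(A,K,L),(F,H,J),(D,H,I),(B,F,G),(A,D,E),(A,B,C)],
    [(F,P,Q),(C,M,N),(A,K,L),(F,H,J),(D,H,I),(B,F,G),(A,D,E),(A,B,C)],
    [(G,P,Q),(C,M,N),(A,K,L),(F,H,J),(D,H,I),(B,F,G),(A,D,E),(A,B,C)],
    [(H,P,Q),(C,M,N),(A,K,L),(F,H,J),(D,H,I),(B,F,G),(A,D,E),(A,B,C)],
    [(I,P,Q),(C,M,N),(A,K,L),(F,H,J),(D,H,I),(B,F,G),(A,D,E),(A,B,C)],
    [(J,P,Q),(C,M,N),(A,K,L),(F,H,J),(D,H,I),(B,F,G),(A,D,E),(A,B,C)],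
    [(K,P,Q),(C,M,N),(A,K,L),(F,H,J),(D,H,I),(B,F,G),(A,D,E),(A,B,C)],
    [(M,P,Q),(C,M,N),(A,K,L),(F,H,J),(D,H,I),(B,F,G),(A,D,E),(A,B,C)]]"

definition reps8_5 where
  "reps8_5 = [
    [(I,P,Q),(F,M,N),(A,K,L),(F,H,J),(D,H,I),(B,F,G),(A,D,E),(A,B,C)],
    [(K,P,Q),(F,M,N),(A,K,L),(F,H,J),(D,H,I),(B,F,G),(A,D,E),(A,B,C)],
    [(G,P,Q),(G,M,N),(A,K,L),(F,H,J),(D,H,I),(B,F,G),(A,D,E),(A,B,C)],
    [(I,P,Q),(G,M,N),(A,K,L),(F,H,J),(D,H,I),(B,F,G),(A,D,E),(A,B,C)],
    [(J,P,Q),(G,M,N),(A,K,L),(F,H,J),(D,H,I),(B,F,G),(A,D,E),(A,B,C)],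
    [(K,P,Q),(G,M,N),(A,K,L),(F,H,J),(D,H,I),(B,F,G),(A,D,E),(A,B,C)],
    [(M,P,Q),(G,M,N),(A,K,L),(F,H,J),(D,H,I),(B,F,G),(A,D,E),(A,B,C)],
    [(J,P,Q),(J,M,N),(A,K,L),(F,H,J),(D,H,I),(B,F,G),(A,D,E),(A,B,C)],
    [(K,P,Q),(J,M,N),(A,K,L),(F,H,J),(D,H,I),(B,F,G),(A,D,E),(A,B,C)],
    [(M,P,Q),(J,M,N),(A,K,L),(F,H,J),(D,H,I),(B,F,G),(A,D,E),(A,B,C)]]"

definition reps8_6 where
  "reps8_6 = [
    [(K,P,Q),(K,M,N),(A,K,L),(F,H,J),(D,H,I),(B,F,G),(A,D,E),(A,B,C)],
    [(L,P,Q),(K,M,N),(A,K,L),(F,H,J),(D,H,I),(B,F,G),(A,D,E),(A,B,C)],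
    [(M,P,Q),(K,M,N),(A,K,L),(F,H,J),(D,H,I),(B,F,G),(A,D,E),(A,B,C)],
    [(N,P,Q),(J,K,M),(A,K,L),(F,H,J),(D,H,I),(B,F,G),(A,D,E),(A,B,C)],
    [(A,N,P),(J,K,M),(A,K,L),(F,H,J),(D,H,I),(B,F,G),(A,D,E),(A,B,C)],
    [(B,N,P),(J,K,M),(A,K,L),(F,H,J),(D,H,I),(B,F,G),(A,D,E),(A,B,C)],
    [(C,N,P),(J,K,M),(A,K,L),(F,H,J),(D,H,I),(B,F,G),(A,D,E),(A,B,C)],
    [(F,N,P),(J,K,M),(A,K,L),(F,H,J),(D,H,I),(B,F,G),(A,D,E),(A,B,C)],
    [(G,N,P),(J,K,M),(A,K,L),(F,H,J),(D,H,I),(B,F,G),(A,D,E),(A,B,C)],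
    [(C,P,Q),(C,M,N),(C,K,L),(F,H,J),(D,H,I),(B,F,G),(A,D,E),(A,B,C)]]"

definition reps8_7 where
  "reps8_7 = [
    [(E,P,Q),(C,M,N),(C,K,L),(F,H,J),(D,H,I),(B,F,G),(A,D,E),(A,B,C)],
    [(I,P,Q),(C,M,N),(C,K,L),(F,H,J),(D,H,I),(B,F,G),(A,D,E),(A,B,C)],
    [(K,P,Q),(C,M,N),(C,K,L),(F,H,J),(D,H,I),(B,F,G),(A,D,E),(A,B,C)],
    [(G,P,Q),(E,M,N),(C,K,L),(F,H,J),(D,H,I),(B,F,G),(A,D,E),(A,B,C)],
    [(J,P,Q),(E,M,N),(C,K,L),(F,H,J),(D,H,I),(B,F,G),(A,D,E),(A,B,C)],
    [(K,P,Q),(E,M,N),(C,K,L),(F,H,J),(D,H,I),(B,F,G),(A,D,E),(A,B,C)],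
    [(K,M,P),(E,M,N),(C,K,L),(F,H,J),(D,H,I),(B,F,G),(A,D,E),(A,B,C)],
    [(K,P,Q),(I,M,N),(C,K,L),(F,H,J),(D,H,I),(B,F,G),(A,D,E),(A,B,C)],
    [(K,P,Q),(K,M,N),(C,K,L),(F,H,J),(D,H,I),(B,F,G),(A,D,E),(A,B,C)],
    [(L,P,Q),(K,M,N),(C,K,L),(F,H,J),(D,H,I),(B,F,G),(A,D,E),(A,B,C)]]"

definition reps8_8 where
  "reps8_8 = [
    [(M,P,Q),(K,M,N),(C,K,L),(F,H,J),(D,H,I),(B,F,G),(A,D,E),(A,B,C)]]"

definition reps8 where
  "reps8 = [reps8_0, reps8_1, reps8_2, reps8_3, reps8_4, reps8_5, reps8_6, reps8_7, reps8_8]"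

text \<open>An empty list belongs to a system without admissible extension on 16 points. The first
  system, seven triples through one point, is an example: any two of its points are at distance at
  most two, and only one fresh point is available.\<close>

definition isos8_0 where
  "isos8_0 = [
    [],
    [],
    [],
    [],
    [],
    [],
    [],
    [],
    [],
    []]"

definition isos8_1 where
  "isos8_1 = [
    [],
    [],
    [],
    [],
    [],
    [],
    [],
    [],
    [],
    []]"

definition isos8_2 where
  "isos8_2 = [
    [],
    [],
    [],
    [],
    [],
    [],
    [],
    [],
    [],
    []]"

definition isos8_3 where
  "isos8_3 = [
    [],
    [],
    [],
    [],
    [],
    [],
    [],
    [],
    [],
    []]"

definition isos8_4 where
  "isos8_4 = [
    [],
    [],
    [],
    [],
    [],
    [],
    [],
    [(A,A,[]),(A,A,[B,A,C,F,G,D,E,J,K,H,I,P,N,L,M]),(A,A,[A,B,C,D,E,F,G,H,I,J,K,M,L]),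
     (A,A,[B,A,C,F,G,D,E,J,K,H,I,P,N,M,L])],
    [(A,B,[]),(A,B,[B,F,G,A,C,J,K,D,E,L,N,H,I,M]),(A,C,[]),(A,B,[D,H,I,A,E,L,M,B,C,J,N,F,G,K]),
     (A,C,[A,D,E,B,C,H,I,F,G,L,M,J,K]),(A,B,[F,B,G,J,K,A,C,L,N,D,E,H,M,I]),(A,C,[F,B,G,J,K,A,C,L,N,D,E,H,M,I]),
     (A,B,[H,L,M,D,I,J,N,A,E,F,K,B,C,G]),(A,C,[H,D,I,L,M,A,E,J,N,B,C,F,K,G]),
     (A,B,[J,L,N,F,K,H,M,B,G,D,I,A,C,E]),(A,C,[J,F,K,L,N,B,G,H,M,A,C,D,I,E]),
     (A,B,[L,J,N,H,M,F,K,D,I,B,G,A,E,C]),(A,C,[L,H,M,J,N,D,I,F,K,A,E,B,G,C]),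
     (A,C,[L,J,N,H,M,F,K,D,I,B,G,A,E,C]),(A,D,[]),(A,D,[B,F,G,A,C,J,K,D,E,L,N,H,I,M]),
     (A,D,[L,J,N,H,M,F,K,D,I,B,G,A,E,C]),(A,E,[]),(A,E,[J,L,N,F,K,H,M,B,G,D,I,A,C,E]),
     (A,D,[D,H,I,A,E,L,M,B,C,J,N,F,G,K]),(A,D,[J,L,N,F,K,H,M,B,G,D,I,A,C,E]),(A,E,[A,D,E,B,C,H,I,F,G,L,M,J,K]),
     (A,E,[L,J,N,H,M,F,K,D,I,B,G,A,E,C]),(A,D,[F,B,G,J,K,A,C,L,N,D,E,H,M,I]),
     (A,D,[H,L,M,D,I,J,N,A,E,F,K,B,C,G]),(A,E,[D,H,I,A,E,L,M,B,C,J,N,F,G,K]),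
     (A,E,[L,H,M,J,N,D,I,F,K,A,E,B,G,C]),(A,E,[J,F,K,L,N,B,G,H,M,A,C,D,I,E])],
    []]"

definition isos8_5 where
  "isos8_5 = [
    [(A,F,[]),(A,G,[]),(A,H,[]),(A,G,[A,D,E,B,C,H,I,F,G,J,L,K]),(A,H,[A,D,E,B,C,H,I,F,G,J,L,K]),(A,I,[]),
     (A,J,[]),(A,I,[A,D,E,B,C,H,I,F,G,J,L,K]),(A,J,[A,D,E,B,C,H,I,F,G,J,L,K]),(B,A,[]),(B,B,[]),
     (B,B,[A,D,E,B,C,H,I,F,G,J,L,K]),(B,C,[]),(B,C,[A,B,C,D,E,F,G,H,I,J,K,L,N,M]),(B,D,[]),
     (B,D,[A,B,C,D,E,F,G,H,I,J,K,L,N,M]),(B,E,[]),(B,E,[A,B,C,D,E,F,G,H,I,J,K,L,N,M]),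
     (B,E,[A,D,E,B,C,H,I,F,G,J,L,K]),(B,E,[A,D,E,B,C,H,I,F,G,J,L,K,N,M])],
    [(A,H,[A,B,C,D,E,F,G,H,I,J,K,L,Q,P,N,M]),(A,H,[B,A,C,F,G,D,E,J,K,H,I,L,Q,P,N,M]),(B,F,[]),
     (A,J,[D,A,E,H,I,B,C,J,L,F,G,K,Q,P,N,M]),(B,G,[]),(A,J,[F,B,G,J,K,A,C,H,L,D,E,I,Q,P,N,M]),
     (B,G,[B,A,C,F,G,D,E,J,K,H,I]),(B,B,[H,D,I,J,L,A,E,F,K,B,C,G,Q,P,N,M]),(B,H,[]),
     (B,B,[J,F,K,H,L,B,G,D,I,A,C,E,Q,P,N,M]),(B,H,[B,A,C,F,G,D,E,J,K,H,I]),(B,I,[]),(B,J,[]),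
     (B,J,[A,B,C,D,E,F,G,H,I,J,K,L,N,M]),(B,E,[H,M,P,J,L,C,N,F,K,B,A,G,D,I,E]),
     (B,E,[H,N,P,J,L,C,M,F,K,B,A,G,D,I,E]),(A,E,[I,H,D,M,P,J,L,C,N,F,K,B,A,G,E]),
     (A,E,[I,H,D,N,P,J,L,C,M,F,K,B,A,G,E]),(B,E,[J,M,P,H,L,C,N,D,I,A,B,E,F,K,G]),
     (B,E,[J,N,P,H,L,C,M,D,I,A,B,E,F,K,G]),(A,E,[K,J,F,M,P,H,L,C,N,D,I,A,B,E,G]),
     (A,E,[K,J,F,N,P,H,L,C,M,D,I,A,B,E,G]),(C,A,[]),(C,A,[A,B,C,D,E,F,G,H,I,J,K,L,N,M])],
    [(C,B,[]),(C,C,[]),(C,C,[B,A,C,F,G,D,E,J,K,H,I]),(C,D,[]),(C,E,[]),(C,F,[]),(C,E,[B,A,C,F,G,D,E,J,K,H,I]),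
     (C,F,[B,A,C,F,G,D,E,J,K,H,I]),(C,C,[H,J,L,D,I,F,K,A,E,B,G,C]),(C,F,[H,J,L,D,I,F,K,A,E,B,G,C]),
     (C,C,[J,H,L,F,K,D,I,B,G,A,E,C]),(C,F,[J,H,L,F,K,D,I,B,G,A,E,C]),(C,D,[J,H,L,F,K,D,I,B,G,A,E,C]),(C,G,[]),
     (C,H,[]),(C,H,[B,A,C,F,G,D,E,J,K,H,I])],
    [],
    [],
    [(C,I,[]),(C,J,[]),(D,A,[]),(C,J,[A,D,E,B,C,H,I,F,G]),(D,A,[A,D,E,B,C,H,I,F,G]),(D,B,[]),(D,C,[]),
     (D,B,[A,D,E,B,C,H,I,F,G]),(D,C,[A,D,E,B,C,H,I,F,G]),(D,D,[]),(D,E,[]),(D,E,[A,B,C,D,E,F,G,H,I,J,L,K]),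
     (D,E,[A,B,C,D,E,F,G,H,I,J,M,N,L,K]),(D,E,[A,B,C,D,E,F,G,H,I,J,N,M,L,K])],
    [(C,J,[A,B,C,D,E,F,G,H,I,J,Q,P,L,K,N,M]),(C,J,[B,A,C,F,G,D,E,H,J,I,Q,P,M,N,L,K]),(D,F,[]),(D,G,[]),(D,H,[]),
     (D,G,[B,A,C,F,G,D,E,H,J,I,N,M,L,K]),(D,H,[B,A,C,F,G,D,E,H,J,I,N,M,L,K]),(D,I,[]),(D,J,[]),
     (D,J,[B,A,C,F,G,D,E,H,J,I,N,M,L,K]),(E,A,[]),(E,A,[A,B,C,D,E,F,G,H,I,J,L,K]),
     (E,A,[B,A,C,F,G,D,E,H,J,I,M,N,L,K]),(E,A,[B,A,C,F,G,D,E,H,J,I,N,M,L,K])],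
    [(D,A,[A,B,C,D,E,F,G,H,I,J,Q,P,L,K,N,M]),(D,F,[B,A,C,F,G,D,E,H,J,I,Q,P,L,K,N,M]),(E,B,[]),
     (D,H,[A,D,E,B,C,H,I,F,G,J,K,L,Q,P,N,M]),(E,C,[]),(E,D,[]),(E,E,[]),(E,F,[]),(E,G,[]),(E,H,[]),(E,I,[]),
     (E,I,[A,B,C,D,E,F,G,H,I,J,L,K]),(E,J,[]),(E,J,[A,B,C,D,E,F,G,H,I,J,K,L,N,M])],
    [(D,B,[A,B,C,D,E,F,G,H,I,J,Q,P,L,K,N,M]),(D,G,[B,F,G,A,C,H,J,D,E,I,Q,P,M,N,L,K]),
     (E,D,[A,B,C,D,E,F,G,H,I,J,K,L,Q,P,N,M]),(D,I,[D,A,E,H,I,B,C,F,J,G,Q,P,L,K,N,M]),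
     (E,F,[A,D,E,B,C,H,I,F,G,J,K,L,Q,P,N,M]),(D,B,[F,B,G,H,J,A,C,D,I,E,Q,P,M,N,L,K]),
     (E,D,[F,B,G,H,J,A,C,D,I,E,N,M,Q,P,L,K]),(D,I,[H,F,J,D,I,B,G,A,E,C,Q,P,M,N,L,K]),(F,A,[]),
     (E,F,[F,H,J,B,G,D,I,A,C,E,N,M,Q,P,L,K]),(F,B,[]),(F,B,[A,B,C,D,E,F,G,H,I,J,L,K]),
     (F,B,[F,B,G,H,J,A,C,D,I,E,M,N,L,K]),(F,B,[F,B,G,H,J,A,C,D,I,E,N,M,L,K]),
     (B,D,[F,H,J,M,N,D,I,K,P,A,E,L,B,G,C]),(B,D,[F,H,J,N,M,D,I,K,P,A,E,L,B,G,C]),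
     (B,D,[F,M,N,H,J,L,P,D,I,A,K,E,B,G,C]),(B,D,[F,N,M,H,J,L,P,D,I,A,K,E,B,G,C])],
    [(D,C,[A,B,C,D,E,F,G,H,I,J,Q,P,L,K,N,M]),(D,H,[B,A,C,F,G,D,E,H,J,I,Q,P,L,K,N,M]),
     (E,E,[A,B,C,D,E,F,G,H,I,J,K,L,Q,P,N,M]),(D,J,[A,D,E,B,C,H,I,F,G,J,K,L,Q,P,N,M]),
     (E,G,[A,D,E,B,C,H,I,F,G,J,K,L,Q,P,N,M]),(E,D,[F,B,G,H,J,A,C,D,I,E,Q,P,M,N,L,K]),(F,C,[]),
     (F,A,[H,D,I,F,J,A,E,B,G,C,Q,P,L,K,N,M]),(F,D,[]),(F,E,[]),(F,F,[]),(F,F,[A,B,C,D,E,F,G,H,I,J,L,K]),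
     (F,G,[]),(F,G,[A,B,C,D,E,F,G,H,I,J,K,L,N,M]),(A,D,[A,K,L,D,E,M,P,H,I,G,N,F,J,B,C]),
     (A,D,[A,D,E,K,L,H,I,N,P,F,J,G,M,B,C]),(A,D,[A,L,K,D,E,M,P,H,I,G,N,F,J,B,C]),
     (A,D,[A,D,E,L,K,H,I,N,P,F,J,G,M,B,C])]]"

definition isos8_6 where
  "isos8_6 = [
    [(D,D,[A,B,C,D,E,F,G,H,I,J,Q,P,L,K,N,M]),(D,J,[B,A,C,F,G,D,E,H,J,I,Q,P,L,K,N,M]),
     (E,H,[A,B,C,D,E,F,G,H,I,J,K,L,Q,P,N,M]),(D,J,[D,A,E,H,I,B,C,F,J,G,Q,P,L,K,N,M]),
     (E,H,[A,D,E,B,C,H,I,F,G,J,K,L,Q,P,N,M]),(E,F,[F,H,J,B,G,D,I,A,C,E,Q,P,M,N,L,K]),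
     (F,E,[A,B,C,D,E,F,G,H,I,J,K,L,Q,P,N,M]),(E,F,[H,F,J,D,I,B,G,A,E,C,Q,P,M,N,L,K]),
     (F,E,[A,D,E,B,C,H,I,F,G,J,K,L,Q,P,N,M]),(F,H,[]),(F,I,[]),(F,I,[A,B,C,D,E,F,G,H,I,J,L,K]),(F,J,[]),
     (F,J,[A,B,C,D,E,F,G,H,I,J,K,L,N,M]),(B,E,[A,D,E,K,L,H,I,M,P,J,F,N,B,C,G]),
     (B,E,[A,D,E,K,L,H,I,N,P,J,F,M,B,C,G]),(B,E,[A,D,E,L,K,H,I,M,P,J,F,N,B,C,G]),
     (B,E,[A,D,E,L,K,H,I,N,P,J,F,M,B,C,G])],
    [(D,E,[A,B,C,D,E,F,G,H,I,J,K,L,Q,P,N,M]),(E,A,[A,B,C,D,E,F,G,H,I,J,K,L,Q,P,N,M]),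
     (E,I,[A,B,C,D,E,F,G,H,I,J,K,L,Q,P,N,M]),(E,A,[A,D,E,B,C,H,I,F,G,J,K,L,Q,P,N,M]),
     (E,I,[A,D,E,B,C,H,I,F,G,J,K,L,Q,P,N,M]),(F,B,[A,B,C,D,E,F,G,H,I,J,K,L,Q,P,N,M]),
     (F,F,[A,B,C,D,E,F,G,H,I,J,K,L,Q,P,N,M]),(F,B,[A,D,E,B,C,H,I,F,G,J,K,L,Q,P,N,M]),
     (F,F,[A,D,E,B,C,H,I,F,G,J,K,L,Q,P,N,M]),(F,I,[A,B,C,D,E,F,G,H,I,J,K,L,Q,P,N,M]),(G,A,[]),(G,B,[]),(G,C,[]),
     (G,C,[A,B,C,D,E,F,G,H,I,J,K,L,N,M]),(B,D,[F,H,J,M,P,D,I,K,N,A,E,L,B,G,C]),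
     (B,D,[F,H,J,N,P,D,I,K,M,A,E,L,B,G,C]),(A,D,[A,K,L,D,E,M,N,H,I,G,P,F,J,B,C]),
     (A,D,[A,K,L,D,E,N,M,H,I,G,P,F,J,B,C]),(B,D,[H,F,J,M,P,B,G,K,N,A,C,L,D,I,E]),
     (B,D,[H,F,J,N,P,B,G,K,M,A,C,L,D,I,E]),(A,D,[A,K,L,B,C,M,N,F,G,I,P,H,J,D,E]),
     (A,D,[A,K,L,B,C,N,M,F,G,I,P,H,J,D,E]),(B,E,[A,D,E,K,L,H,I,M,N,J,F,P,B,C,G]),
     (B,E,[A,D,E,K,L,H,I,N,M,J,F,P,B,C,G])],
    [(G,D,[]),(G,E,[]),(G,F,[]),(G,G,[]),(G,F,[A,D,E,B,C,H,I,F,G]),(G,G,[A,D,E,B,C,H,I,F,G]),(G,H,[]),(G,I,[]),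
     (G,H,[A,D,E,B,C,H,I,F,G]),(G,I,[A,D,E,B,C,H,I,F,G]),(G,H,[A,K,L,D,E,J,M,H,I,F,B,C,G]),
     (G,F,[A,K,L,D,E,J,M,H,I,F,B,C,G]),(G,G,[A,K,L,D,E,J,M,H,I,F,B,C,G]),(G,I,[A,K,L,D,E,J,M,H,I,F,B,C,G])],
    [],
    [(E,B,[A,B,C,D,E,F,G,H,I,J,Q,P,M,N,L,K]),(E,B,[B,A,C,F,G,D,E,H,J,I,Q,P,M,N,L,K]),(G,J,[]),
     (F,C,[D,A,E,H,I,B,C,F,J,G,Q,P,M,N,L,K]),(H,A,[]),(F,C,[F,B,G,H,J,A,C,D,I,E,Q,P,M,N,L,K]),
     (H,A,[B,A,C,F,G,D,E,H,J,I]),(F,H,[H,F,J,D,I,B,G,A,E,C,Q,P,M,N,L,K]),(H,B,[]),(H,B,[B,A,C,F,G,D,E,H,J,I]),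
     (H,C,[]),(H,C,[A,B,C,D,E,F,G,H,I,J,L,K]),(H,C,[A,B,C,D,E,F,G,H,I,J,M,N,L,K]),
     (H,C,[A,B,C,D,E,F,G,H,I,J,N,M,L,K])],
    [(E,C,[A,D,E,B,C,H,I,F,G,J,Q,P,M,N,L,K]),(E,E,[B,A,C,F,G,D,E,H,J,I,Q,P,L,K,N,M]),
     (H,A,[A,B,C,D,E,F,G,H,I,J,Q,P,L,K,N,M]),(E,E,[D,A,E,H,I,B,C,F,J,G,Q,P,M,N,L,K]),
     (H,A,[A,D,E,B,C,H,I,F,G,J,Q,P,M,N,L,K]),(F,E,[F,B,G,H,J,A,C,D,I,E,Q,P,L,K,N,M]),(H,D,[]),
     (F,E,[H,D,I,F,J,A,E,B,G,C,Q,P,M,N,L,K]),(H,D,[A,D,E,B,C,H,I,F,G,J,N,M,L,K]),(H,E,[]),(H,F,[]),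
     (H,F,[A,B,C,D,E,F,G,H,I,J,L,K]),(H,F,[A,D,E,B,C,H,I,F,G,J,M,N,L,K]),(H,F,[A,D,E,B,C,H,I,F,G,J,N,M,L,K]),
     (H,G,[]),(H,G,[A,D,E,B,C,H,I,F,G,J,N,M,K,L]),(H,G,[A,B,C,D,E,F,G,H,I,J,L,K]),
     (H,G,[A,D,E,B,C,H,I,F,G,J,N,M,L,K])],
    [(E,G,[A,B,C,D,E,F,G,H,I,J,Q,P,L,K,N,M]),(E,H,[B,A,C,F,G,D,E,H,J,I,Q,P,L,K,N,M]),
     (H,B,[A,B,C,D,E,F,G,H,I,J,Q,P,L,K,N,M]),(E,G,[D,H,I,A,E,F,J,B,C,G,Q,P,M,N,L,K]),
     (H,D,[D,A,E,H,I,B,C,F,J,G,Q,P,M,N,L,K]),(F,D,[F,H,J,B,G,D,I,A,C,E,Q,P,M,N,L,K]),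
     (H,E,[B,F,G,A,C,H,J,D,E,I,Q,P,L,K,N,M]),(E,H,[H,D,I,F,J,A,E,B,G,C,Q,P,M,N,L,K]),
     (H,B,[D,H,I,A,E,F,J,B,C,G,Q,P,M,N,L,K]),(H,E,[H,F,J,D,I,B,G,A,E,C,Q,P,M,N,L,K]),(H,H,[]),
     (H,H,[A,B,C,D,E,F,G,H,I,J,L,K]),(H,H,[D,H,I,A,E,F,J,B,C,G,M,N,L,K]),(H,H,[D,H,I,A,E,F,J,B,C,G,N,M,L,K]),
     (A,E,[B,C,A,F,G,K,L,H,J,M,P,I,D,N,E]),(A,E,[H,I,D,F,J,N,M,B,G,K,P,C,A,L,E]),
     (A,E,[B,C,A,F,G,L,K,H,J,M,P,I,D,N,E]),(A,E,[H,I,D,F,J,N,M,B,G,L,P,C,A,K,E])],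
    [(E,J,[A,B,C,D,E,F,G,H,I,J,Q,P,K,L,N,M]),(E,J,[B,A,C,F,G,D,E,H,J,I,Q,P,K,L,N,M]),
     (H,C,[A,B,C,D,E,F,G,H,I,J,K,L,Q,P,N,M]),(F,G,[D,A,E,H,I,B,C,F,J,G,Q,P,K,L,N,M]),
     (H,F,[A,B,C,D,E,F,G,H,I,J,K,L,Q,P,N,M]),(F,G,[F,B,G,H,J,A,C,D,I,E,Q,P,K,L,N,M]),
     (H,F,[B,A,C,F,G,D,E,H,J,I,K,L,Q,P,N,M]),(F,J,[H,F,J,D,I,B,G,A,E,C,Q,P,K,L,N,M]),
     (H,H,[A,B,C,D,E,F,G,H,I,J,K,L,Q,P,N,M]),(H,H,[B,A,C,F,G,D,E,H,J,I,K,L,Q,P,N,M]),(H,I,[]),(H,J,[]),(I,A,[]),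
     (I,A,[A,B,C,D,E,F,G,H,I,J,K,L,N,M]),(A,D,[D,M,P,H,I,K,N,F,J,C,L,B,G,A,E]),
     (A,D,[D,N,P,H,I,K,M,F,J,C,L,B,G,A,E]),(H,G,[A,E,D,C,B,M,P,K,L,N,H,I,F,G,J]),
     (H,G,[A,E,D,C,B,N,P,K,L,M,H,I,F,G,J]),(A,D,[F,M,P,H,J,K,N,D,I,C,L,A,E,B,G]),
     (A,D,[F,N,P,H,J,K,M,D,I,C,L,A,E,B,G]),(H,G,[B,G,F,C,A,M,P,K,L,N,H,J,D,E,I]),
     (H,G,[B,G,F,C,A,N,P,K,L,M,H,J,D,E,I]),(B,E,[H,F,J,M,P,B,G,K,N,C,A,L,D,I,E]),
     (B,E,[H,F,J,N,P,B,G,K,M,C,A,L,D,I,E]),(A,E,[H,I,D,F,J,M,P,B,G,K,N,C,A,L,E]),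
     (A,E,[H,I,D,F,J,N,P,B,G,K,M,C,A,L,E]),(A,E,[H,J,F,D,I,M,P,A,E,K,N,C,B,L,G]),
     (A,E,[H,J,F,D,I,N,P,A,E,K,M,C,B,L,G])]]"

definition isos8 where
  "isos8 = [isos8_0, isos8_1, isos8_2, isos8_3, isos8_4, isos8_5, isos8_6]"

definition reps9_0 where
  "reps9_0 = [
    [(B,M,Q),(A,N,P),(J,L,N),(H,L,M),(F,J,K),(D,H,I),(B,F,G),(A,D,E),(A,B,C)],
    [(C,M,Q),(A,N,P),(J,L,N),(H,L,M),(F,J,K),(D,H,I),(B,F,G),(A,D,E),(A,B,C)],
    [(F,I,Q),(A,N,P),(J,L,N),(H,L,M),(F,J,K),(D,H,I),(B,F,G),(A,D,E),(A,B,C)],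
    [(G,I,Q),(A,N,P),(J,L,N),(H,L,M),(F,J,K),(D,H,I),(B,F,G),(A,D,E),(A,B,C)],
    [(G,M,Q),(A,N,P),(J,L,N),(H,L,M),(F,J,K),(D,H,I),(B,F,G),(A,D,E),(A,B,C)],
    [(E,K,Q),(C,M,P),(J,L,N),(H,L,M),(F,J,K),(D,H,I),(B,F,G),(A,D,E),(A,B,C)],
    [(E,N,Q),(C,M,P),(J,L,N),(H,L,M),(F,J,K),(D,H,I),(B,F,G),(A,D,E),(A,B,C)],
    [(K,P,Q),(C,M,P),(J,L,N),(H,L,M),(F,J,K),(D,H,I),(B,F,G),(A,D,E),(A,B,C)],
    [(C,L,Q),(J,M,P),(A,M,N),(H,J,L),(F,J,K),(D,H,I),(B,F,G),(A,D,E),(A,B,C)],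
    [(C,L,Q),(K,M,P),(A,M,N),(H,J,L),(F,J,K),(D,H,I),(B,F,G),(A,D,E),(A,B,C)]]"

definition reps9_1 where
  "reps9_1 = [
    [(M,N,Q),(D,N,P),(C,L,M),(H,J,L),(F,J,K),(D,H,I),(B,F,G),(A,D,E),(A,B,C)],
    [(M,N,Q),(E,N,P),(C,L,M),(H,J,L),(F,J,K),(D,H,I),(B,F,G),(A,D,E),(A,B,C)],
    [(A,P,Q),(E,K,N),(C,L,M),(H,J,L),(F,J,K),(D,H,I),(B,F,G),(A,D,E),(A,B,C)],
    [(B,P,Q),(E,K,N),(C,L,M),(H,J,L),(F,J,K),(D,H,I),(B,F,G),(A,D,E),(A,B,C)],
    [(G,P,Q),(E,K,N),(C,L,M),(H,J,L),(F,J,K),(D,H,I),(B,F,G),(A,D,E),(A,B,C)],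
    [(G,I,P),(E,K,N),(C,L,M),(H,J,L),(F,J,K),(D,H,I),(B,F,G),(A,D,E),(A,B,C)]]"

definition reps9 where
  "reps9 = [reps9_0, reps9_1]"

definition isos9_0 where
  "isos9_0 = [
    [],
    [],
    [],
    [(A,A,[]),(A,B,[]),(A,A,[A,D,E,B,C,H,I,F,G,L,M,J,K]),(A,B,[A,D,E,B,C,H,I,F,G,L,M,J,K]),(A,C,[]),
     (A,C,[A,D,E,B,C,H,I,F,G,L,M,J,K]),(A,D,[]),(A,E,[]),(A,E,[A,D,E,B,C,H,I,F,G,L,M,J,K])],
    [(A,B,[A,B,C,D,E,F,G,H,I,J,K,L,M,N,Q,P]),(A,D,[D,A,E,K,Q,C,B,J,F,M,P,L,N,H,I,G]),
     (A,E,[J,L,N,F,K,H,M,B,G,D,I,A,C,E,Q,P]),(A,F,[]),(A,G,[]),(A,E,[F,B,G,J,K,A,C,L,N,D,E,H,M,I,Q,P]),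
     (A,B,[H,L,M,D,I,J,N,A,E,F,K,B,C,G,Q,P]),(A,G,[H,L,M,D,I,J,N,A,E,F,K,B,C,G]),
     (A,F,[H,L,M,D,I,J,N,A,E,F,K,B,C,G]),(A,H,[])],
    [],
    [],
    [],
    [],
    []]"

definition isos9_1 where
  "isos9_1 = [
    [],
    [],
    [],
    [(A,I,[]),(A,I,[A,D,E,B,C,H,I,F,G,J,L,K]),(A,C,[J,M,P,F,K,A,N,G,B,D,E,I,Q,H,L,C])],
    [(A,J,[]),(A,E,[A,D,E,M,N,I,H,K,P,G,Q,F,J,B,C,L]),(A,E,[A,D,E,B,C,I,H,F,G,P,Q,K,J,M,N,L]),
     (A,J,[A,M,N,D,E,K,P,H,I,J,F,L,B,C,G])],
    [],
    [],
    [],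
    [],
    []]"

definition isos9_2 where
  "isos9_2 = [
    [(A,G,[J,L,H,K,F,M,P,E,Q,C,N,A,D,B,I,G]),(A,G,[A,B,C,E,D,F,G,P,Q,J,K,L,M,H,N,I]),
     (A,G,[H,L,J,I,D,M,P,G,Q,C,N,B,F,A,K,E]),(A,G,[B,A,C,G,F,D,E,P,Q,H,I,L,M,J,N,K]),
     (A,G,[H,J,L,I,D,F,K,N,Q,B,G,C,M,A,P,E]),(A,G,[J,H,L,K,F,D,I,N,Q,A,E,C,M,B,P,G])],
    [],
    [(A,I,[J,H,L,F,K,D,I,B,G,A,E,C,N,Q,P,M]),(A,I,[J,H,L,F,K,D,I,B,G,A,E,C,P,Q,N,M]),
     (A,J,[A,C,B,N,P,L,M,K,Q,J,H,F,D,E,I,G]),(A,J,[A,C,B,P,N,L,M,K,Q,J,H,F,D,E,I,G])],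
    [(A,B,[C,B,A,N,P,F,G,I,Q,J,K,H,D,L,M,E]),(A,B,[C,B,A,P,N,F,G,I,Q,J,K,H,D,L,M,E]),
     (A,B,[C,A,B,N,P,D,E,K,Q,H,I,J,F,L,M,G]),(A,B,[C,A,B,P,N,D,E,K,Q,H,I,J,F,L,M,G])],
    [(A,C,[F,N,Q,B,G,D,P,C,A,H,I,L,M,J,K,E]),(A,C,[F,P,Q,B,G,D,N,C,A,H,I,L,M,J,K,E]),
     (A,E,[D,H,I,N,P,L,J,G,Q,C,M,B,F,A,E,K]),(A,E,[D,H,I,P,N,L,J,G,Q,C,M,B,F,A,E,K]),
     (A,E,[D,A,E,N,P,C,B,K,Q,L,M,J,F,H,I,G]),(A,E,[D,A,E,P,N,C,B,K,Q,L,M,J,F,H,I,G]),(B,A,[]),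
     (B,A,[A,B,C,D,E,F,G,H,I,J,K,L,M,P,N])],
    [(A,E,[F,J,K,N,Q,L,H,E,P,C,M,A,D,B,G,I]),(A,E,[F,J,K,P,Q,L,H,E,N,C,M,A,D,B,G,I]),
     (A,H,[G,F,B,N,Q,J,K,E,P,H,L,D,A,I,C,M]),(A,H,[G,F,B,P,Q,J,K,E,N,H,L,D,A,I,C,M]),
     (A,J,[J,L,H,N,Q,C,M,E,P,A,B,D,F,K,G,I]),(A,J,[J,L,H,P,Q,C,M,E,N,A,B,D,F,K,G,I]),
     (A,G,[A,E,D,C,B,N,P,L,M,K,Q,J,H,F,I,G]),(A,G,[A,E,D,C,B,P,N,L,M,K,Q,J,H,F,I,G]),
     (A,B,[L,J,H,N,Q,F,K,E,P,B,G,A,D,C,M,I]),(A,B,[L,J,H,P,Q,F,K,E,N,B,G,A,D,C,M,I]),(B,B,[]),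
     (B,B,[A,B,C,D,E,F,G,H,I,J,K,L,M,P,N])],
    [(B,A,[A,B,C,D,E,F,G,H,I,J,K,L,M,N,Q,P]),(B,A,[A,B,C,D,E,F,G,H,I,J,K,L,M,P,Q,N]),
     (B,B,[L,M,C,H,J,N,P,D,I,E,Q,A,B,F,K,G]),(B,B,[L,M,C,H,J,P,N,D,I,E,Q,A,B,F,K,G]),
     (B,A,[B,A,C,F,G,D,E,J,K,H,I,L,M,N,Q,P]),(B,A,[B,A,C,F,G,D,E,J,K,H,I,L,M,P,Q,N]),
     (B,B,[L,M,C,J,H,N,P,F,K,G,Q,B,A,D,I,E]),(B,B,[L,M,C,J,H,P,N,F,K,G,Q,B,A,D,I,E]),
     (B,B,[C,M,L,A,B,N,P,D,E,I,Q,H,J,F,G,K]),(B,B,[C,M,L,A,B,P,N,D,E,I,Q,H,J,F,G,K]),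
     (B,B,[C,M,L,B,A,N,P,F,G,K,Q,J,H,D,E,I]),(B,B,[C,M,L,B,A,P,N,F,G,K,Q,J,H,D,E,I])],
    [(B,C,[]),(B,D,[]),(B,D,[A,C,B,E,D,L,M,K,N,J,H,F,G,I]),(B,D,[A,D,E,B,C,H,I,F,G,J,L,K,N,M]),
     (B,D,[A,E,D,C,B,K,N,L,M,J,F,H,I,G]),(B,D,[J,F,K,H,L,B,G,D,I,A,C,E,N,M]),(B,E,[]),
     (B,D,[J,H,L,F,K,D,I,B,G,A,E,C]),(B,E,[J,H,L,F,K,D,I,B,G,A,E,C]),(B,C,[J,H,L,F,K,D,I,B,G,A,E,C]),
     (B,D,[J,K,F,L,H,E,N,C,M,A,D,B,G,I]),(B,D,[J,L,H,K,F,C,M,E,N,A,B,D,I,G]),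
     (B,E,[J,L,H,K,F,C,M,E,N,A,B,D,I,G]),(B,E,[A,E,D,C,B,K,N,L,M,J,F,H,I,G]),(B,F,[]),
     (B,F,[J,L,H,K,F,C,M,E,N,A,B,D,I,G])],
    [],
    []]"

definition isos9_3 where
  "isos9_3 = [
    [],
    [],
    [],
    [],
    [],
    [],
    [],
    [],
    [],
    []]"

definition isos9_4 where
  "isos9_4 = [
    [],
    [],
    [],
    [],
    [],
    [],
    [],
    [],
    [],
    []]"

definition isos9_5 where
  "isos9_5 = [
    [],
    [],
    [],
    [],
    [],
    [],
    [],
    [],
    [],
    []]"

definition isos9_6 where
  "isos9_6 = [
    [],
    [],
    [],
    [],
    [],
    [(A,A,[B,A,C,N,P,K,L,I,Q,J,M,H,D,F,G,E]),(A,A,[B,A,C,P,N,K,L,I,Q,J,M,H,D,F,G,E]),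
     (A,A,[A,B,C,D,E,N,P,H,I,M,Q,J,F,K,L,G]),(A,A,[A,B,C,D,E,P,N,H,I,M,Q,J,F,K,L,G])],
    [(A,I,[H,J,F,N,Q,K,M,C,P,A,L,B,D,I,E,G]),(A,I,[H,J,F,P,Q,K,M,C,N,A,L,B,D,I,E,G]),
     (A,B,[A,C,B,K,L,N,P,J,M,I,Q,H,F,D,E,G]),(A,B,[A,C,B,K,L,P,N,J,M,I,Q,H,F,D,E,G]),
     (A,I,[J,H,F,N,Q,D,I,C,P,A,E,B,K,M,L,G]),(A,I,[J,H,F,P,Q,D,I,C,N,A,E,B,K,M,L,G]),
     (A,B,[A,C,B,D,E,N,P,H,I,M,Q,J,F,K,L,G]),(A,B,[A,C,B,D,E,P,N,H,I,M,Q,J,F,K,L,G])],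
    [(A,I,[F,J,H,N,P,K,M,E,Q,A,L,D,B,G,C,I]),(A,I,[F,J,H,P,N,K,M,E,Q,A,L,D,B,G,C,I]),
     (A,I,[F,H,J,N,P,D,I,L,Q,A,E,K,B,G,C,M]),(A,I,[F,H,J,P,N,D,I,L,Q,A,E,K,B,G,C,M])],
    [(A,A,[D,A,E,N,Q,K,L,G,P,J,M,F,B,H,I,C]),(A,A,[D,A,E,P,Q,K,L,G,N,J,M,F,B,H,I,C]),
     (A,B,[A,E,D,K,L,N,Q,J,M,G,P,F,H,B,C,I]),(A,B,[A,E,D,K,L,P,Q,J,M,G,N,F,H,B,C,I]),
     (B,A,[D,I,H,A,E,N,Q,B,C,G,P,F,J,K,L,M]),(B,A,[D,I,H,A,E,P,Q,B,C,G,N,F,J,K,L,M]),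
     (A,A,[K,A,L,N,Q,D,E,G,P,H,I,F,B,J,M,C]),(A,A,[K,A,L,P,Q,D,E,G,N,H,I,F,B,J,M,C]),
     (A,B,[A,L,K,D,E,N,Q,H,I,G,P,F,J,B,C,M]),(A,B,[A,L,K,D,E,P,Q,H,I,G,N,F,J,B,C,M]),
     (B,A,[K,M,J,A,L,N,Q,B,C,G,P,F,H,D,E,I]),(B,A,[K,M,J,A,L,P,Q,B,C,G,N,F,H,D,E,I])],
    []]"

definition isos9_7 where
  "isos9_7 = [
    [],
    [],
    [],
    [],
    [],
    [],
    [(A,A,[M,F,Q,K,P,H,J,C,L,D,I,A,B,E,N,G]),(B,A,[N,M,E,F,Q,K,P,B,G,C,L,A,D,H,J,I]),
     (A,E,[F,P,Q,H,J,K,M,D,I,C,L,A,E,B,G,N]),(B,A,[G,F,B,M,Q,H,J,E,N,D,I,A,C,K,P,L]),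
     (B,B,[B,C,A,G,F,K,L,N,Q,M,P,E,D,H,J,I]),(A,H,[F,G,B,H,J,P,Q,D,I,M,K,E,A,N,C,L]),
     (A,A,[K,H,Q,M,P,F,J,E,N,B,G,A,D,C,L,I]),(B,A,[L,K,C,H,Q,M,P,D,I,E,N,A,B,F,J,G]),
     (A,E,[H,P,Q,F,J,M,K,B,G,E,N,A,C,D,I,L]),(B,A,[I,H,D,K,Q,F,J,C,L,B,G,A,E,M,P,N]),
     (B,B,[D,E,A,I,H,M,N,L,Q,K,P,C,B,F,J,G]),(A,H,[H,I,D,F,J,P,Q,B,G,K,M,C,A,L,E,N]),
     (A,E,[K,J,Q,M,P,F,H,E,N,B,G,A,D,C,L,I]),(A,H,[K,L,C,M,P,J,Q,E,N,H,F,D,A,I,B,G]),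
     (A,E,[M,J,Q,K,P,H,F,C,L,D,I,A,B,E,N,G]),(A,H,[M,N,E,K,P,J,Q,C,L,F,H,B,A,G,D,I]),
     (A,F,[A,D,E,C,B,H,I,K,L,J,F,P,M,Q,N,G])],
    [],
    [],
    []]"

definition isos9_8 where
  "isos9_8 = [
    []]"

definition isos9 where
  "isos9 = [isos9_0, isos9_1, isos9_2, isos9_3, isos9_4, isos9_5, isos9_6, isos9_7, isos9_8]"

definition reps10_0 where
  "reps10_0 = [
    [(M,N,Q),(G,I,P),(E,K,N),(C,L,M),(H,J,L),(F,J,K),(D,H,I),(B,F,G),(A,D,E),(A,B,C)],
    [(M,N,P),(G,I,P),(E,K,N),(C,L,M),(H,J,L),(F,J,K),(D,H,I),(B,F,G),(A,D,E),(A,B,C)]]"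

definition reps10 where
  "reps10 = [reps10_0]"

definition isos10_0 where
  "isos10_0 = [
    [],
    [],
    [],
    [],
    [],
    [],
    [],
    [],
    [],
    []]"

definition isos10_1 where
  "isos10_1 = [
    [],
    [],
    [],
    [],
    [],
    [(A,A,[]),(A,A,[H,D,I,J,L,A,E,F,K,B,C,G,P,M,N]),(A,A,[D,H,I,A,E,J,L,B,C,F,K,G,P,N,M]),(A,B,[])]]"

definition isos10 where
  "isos10 = [isos10_0, isos10_1]"

definition reps11_0 where
  "reps11_0 = [
    [(G,Q,R),(M,N,Q),(G,I,P),(E,K,N),(C,L,M),(H,J,L),(F,J,K),(D,H,I),(B,F,G),(A,D,E),(A,B,C)],
    [(P,Q,R),(M,N,Q),(G,I,P),(E,K,N),(C,L,M),(H,J,L),(F,J,K),(D,H,I),(B,F,G),(A,D,E),(A,B,C)],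
    [(A,Q,R),(M,N,P),(G,I,P),(E,K,N),(C,L,M),(H,J,L),(F,J,K),(D,H,I),(B,F,G),(A,D,E),(A,B,C)]]"

definition reps11 where
  "reps11 = [reps11_0]"

definition isos11_0 where
  "isos11_0 = [
    [(A,A,[]),(A,A,[J,H,L,F,K,D,I,B,G,A,E,C]),(A,A,[J,L,H,K,F,C,M,E,N,A,B,D,I,G,Q,P]),
     (A,A,[A,E,D,C,B,K,N,L,M,J,F,H,I,G,Q,P]),(A,B,[])],
    [(A,C,[]),(A,C,[B,F,G,C,A,K,J,M,L,N,E,P,I,D,H]),(A,C,[C,M,L,B,A,N,P,F,G,K,E,J,H,D,I]),
     (A,C,[D,H,I,E,A,L,J,N,K,M,C,P,G,B,F]),(A,C,[E,N,K,D,A,M,P,H,I,L,C,J,F,B,G]),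
     (A,C,[F,J,K,G,B,L,H,P,I,M,C,N,E,A,D]),(A,C,[G,B,F,I,P,C,A,H,D,L,M,J,K,N,E]),
     (A,C,[H,J,L,I,D,K,F,P,G,N,E,M,C,A,B]),(A,C,[I,P,G,H,D,N,M,J,L,K,E,F,B,A,C]),
     (A,C,[J,H,L,F,K,D,I,B,G,A,E,C]),(A,C,[K,J,F,N,E,H,L,P,M,I,D,G,B,A,C]),
     (A,C,[L,H,J,C,M,I,D,B,A,G,P,F,K,N,E]),(A,C,[M,P,N,L,C,G,I,J,H,F,B,K,E,A,D]),
     (A,C,[N,P,M,K,E,I,G,J,F,H,D,L,C,A,B]),(A,C,[P,N,M,I,G,K,E,H,D,J,F,L,C,B,A])]]"

definition isos11 where
  "isos11 = [isos11_0]"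

section \<open>Refutation trees\<close>

definition trees9_0 where
  "trees9_0 = [
    [Hang R [],Hang R [Split [A,F,H,N] [Hang I []]],Hang R [Split [A,F,H,N] [Hang G []]],Hang R [],
     Hang R [Split [B,D,J,L] [Hang K []]],Hang R [Split [B,D,J,L] [Hang E []]],
     Hang R [Split [C,D,F,M,N] [Split [A,F,H,N,R] []]],Split [C,D,G,J,L] [Split [C,E,F,H,N] [],
     Split [C,E,F,H,N] [Hang Q []]],Hang R [Split [C,D,F,L,P] [Split [B,D,J,L,R] []]],
     Split [C,D,G,J,L] [Split [C,E,F,H,N] [],Split [C,E,F,H,N] [Hang Q []]],
     Split [C,D,F,L,P] [Split [B,E,H,J,Q] []],Hang R [],Hang R [Split [B,D,J,L] [Hang M []]],
     Hang R [Split [B,D,J,L] [Hang C []]],Hang R [Split [B,E,H,K,N] [Split [A,F,H,N,R] []]],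
     Split [B,E,I,J,L] [Split [C,E,F,H,N] [],Split [C,E,F,H,N] [Hang P []]],
     Hang R [Split [B,E,H,J,Q] [Split [B,D,J,L,R] []]],Split [B,E,H,K,N] [Split [A,F,I,L,P] []],
     Split [B,E,I,J,L] [Split [C,E,F,H,N] [],Split [C,E,F,H,N] [Hang P []]],Hang R [],
     Hang R [Split [A,F,H,N] [Hang P []]],Hang R [Split [A,F,H,N] [Hang C []]],
     Hang R [Split [A,G,I,J,L] [Split [B,D,J,L,R] []]],Split [C,D,G,J,L] [Split [A,G,H,K,N] [Hang M []],
     Split [A,G,H,K,N] []],Hang R [Split [A,G,H,J,Q] [Split [A,F,H,N,R] []]],
     Split [A,G,I,J,L] [Split [B,D,K,M,N] []],Split [C,D,G,J,L] [Split [A,G,H,K,N] [Hang M []],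
     Split [A,G,H,K,N] []],Hang R [Split [A,F,H,N] [Hang E []]],
     Hang R [Split [A,F,I,L,P] [Split [A,F,H,N,R] []]],Split [A,G,I,J,L] [Split [B,D,K,M,N] []],
     Split [B,E,I,J,L] [Split [A,F,I,M,N] [],Split [A,F,I,M,N] [Hang K []]],
     Split [B,D,K,L,P] [Split [A,G,H,K,N] [],Split [B,E,H,K,N] [Split [A,F,H,N,R] []]]],
    [Split [B,E,H,J,Q] [],Split [B,E,H,J,P] [],Split [B,D,K,L,Q] [Split [C,D,F,L,P] []],
     Split [B,D,K,L,P] [Split [C,D,F,L,Q] []],Split [C,D,F,L,Q] [],Split [C,D,F,L,P] [],
     Split [B,D,J,M,Q] [Split [B,E,H,J,P] []],Split [B,D,J,M,P] [Split [B,E,H,J,Q] []],Split [A,F,H,N] [],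
     Split [A,F,H,N] []],
    [Split [B,D,J,M,P] [Split [C,E,G,H,J] [Split [C,E,F,H,N] [Split [A,G,H,J,Q] []]]],
     Split [B,D,J,M,Q] [Split [C,E,G,H,J] [Split [C,E,F,H,N] [Split [A,G,H,J,P] []]]],
     Split [C,E,F,I,L] [Split [B,D,J,M,P] [],Split [A,G,H,J,P] []],Split [C,E,F,I,L] [Split [B,D,J,M,Q] [],
     Split [A,G,H,J,Q] []],Split [B,D,K,L,P] [Split [C,D,F,L,R] []],Split [B,D,K,L,Q] [Split [C,D,F,L,R] []],
     Split [C,D,G,K,L] [Split [B,D,J,M,P] [],Split [B,E,H,J,P] []],Split [C,D,G,K,L] [Split [B,D,J,M,Q] [],
     Split [B,E,H,J,Q] []],Split [C,D,F,L] [],Split [C,D,F,L] [],Split [C,D,G,J,M] [Split [A,G,H,J,P] []],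
     Split [C,D,G,J,M] [Split [A,G,H,J,Q] []],Split [C,E,F,H,N] [Split [B,E,H,J,P] []],
     Split [C,E,F,H,N] [Split [B,E,H,J,Q] []]],
    [Hang P [],Hang P [],Hang P [],Hang P [],Hang P [],Split [C,E,F,H,N] [],
     Hang C [Split [A,G,H,J] [Split [A,G,I,J,M] []]],Split [C,E,F,H,N] [],
     Hang E [Split [A,F,I,L] [Split [A,G,I,K,L] []]],Hang P [],Split [B,E,H,K,N] [Split [B,D,K,L,P] []],
     Hang P [],Split [C,D,F,M,N] [Split [B,D,J,M,P] []],Hang P [],Split [B,E,H,J,P] [],Hang C [],Hang P [],
     Hang E [],Hang P [],Split [C,E,F,H,N] [],Split [A,G,I,J,M] [],Split [A,G,H,J] [],Hang C [],Hang E []],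
    [Hang P [Split [A,G,I,J,M] [Split [A,G,H,J,P] []]],Split [B,D,J,M] [],Split [C,D,F,L] [],Split [C,D,F,L] [],
     Split [C,E,F,I,L] [Split [C,E,G,H,J] [Hang N []]],Split [C,D,F,L] [],
     Split [C,D,G,K,L] [Split [C,E,G,H,J] [Hang I []]],Hang P [Split [C,E,F,H,N] [Split [B,E,H,J,P] []]],
     Split [C,E,F,I,L] [Hang G []],Split [B,D,J,M] [],
     Split [C,D,G,K,L] [Hang E [Hang I [Split [B,E,I,K,L,P] [Hang Q []]]]],Split [C,D,F,L] [],
     Split [B,D,J,M] [],Split [C,E,F,H,N] [Split [A,F,H,N,P] []],Split [B,E,H,J,P] [Split [A,F,H,N,P] []],
     Hang Q [],Split [C,D,F,L] [],Hang N [],Split [C,E,F,H,N] [],Split [B,E,I,J,M] [],Hang G [],Hang Q [],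
     Split [A,G,H,J,P] [],Split [C,E,F,I,L] [],Split [C,D,G,K,L] [Hang Q []]],
    [],
    [],
    [],
    [Split [C,E,F,H,M] [],Split [C,E,F,H,M] [],Split [C,E,F,H,N] [],Split [C,E,F,H,N] []],
    [Hang C [Split [C,D,G,J,M] [Hang N []]],Hang C [Split [C,D,G,J,M] [Hang N []]],
     Hang C [Split [C,D,G,J,N] [Hang M []]],Hang C [Split [C,D,G,J,N] [Hang M []]]]]"

definition trees9_1 where
  "trees9_1 = [
    [Split [B,D,J,M] [],Split [B,D,J,M] [],Split [B,D,J,N] [],Split [B,D,J,N] []],
    [Split [A,F,H,P] [],Split [A,F,H,Q] [],Split [A,F,H,P] [],Split [A,F,H,Q] []],
    [Split [C,E,F,H,M] [],Split [C,E,F,H,M] [],Hang C [Split [C,D,G,J,M] [Hang N []]],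
     Hang C [Split [C,D,G,J,M] [Hang N []]],Split [C,E,F,H,M] [],Split [C,E,F,H,M] [],
     Hang E [Split [B,E,I,J,M] [Hang N []]],Hang E [Split [B,E,I,J,M] [Hang N []]],Split [B,D,J,M] [],
     Split [B,D,J,M] [],Split [A,F,H,P] [],Split [A,F,H,Q] [],Split [A,F,H,P] [],Split [A,F,H,Q] []],
    [Hang N [],Hang N [],Hang N [],Hang N [],Hang N [],Hang P [],Split [C,D,G,J,N] [],Hang P [],
     Split [B,E,I,J,N] [],Hang N [],Hang P [],Hang P [],Hang N [],Hang P [],Hang N [],Hang N [],Hang N [],
     Split [C,D,G,J,N] []],
    [Hang E [],Hang E [],Hang E [],Hang E [],Split [B,E,H,K,N] [],Split [C,E,F,H,M] [],Split [A,G,H,K] [],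
     Hang E [],Hang E [],Split [B,D,J,M] [],Split [A,G,H,K] [],
     Split [A,G,I,K,L] [Split [B,D,K,L,N] [Split [C,D,F,L,M] []]],Hang E [],Hang E [],Split [A,F,H,P] [],
     Hang E [],Hang E [],Hang E [],Hang C []],
    [],
    [Split [B,E,I,J,M] [Split [A,F,H,M,Q] [Split [B,D,J,M,Q] []],Split [C,D,F,L,P] []],
     Split [B,E,I,J,M] [Split [A,F,H,M,P] [Split [B,D,J,M,P] []],Split [C,D,F,L,Q] []],
     Split [B,E,I,J,N] [Split [A,F,H,N,Q] [Split [B,D,J,N,Q] []],Split [C,D,F,L,P] []],
     Split [B,E,I,J,N] [Split [A,F,H,N,P] [Split [B,D,J,N,P] []],Split [C,D,F,L,Q] []]],
    [Split [B,E,I,J,M] [Hang L []],Split [B,E,I,J,M] [Hang L []],Split [B,E,I,J,N] [Hang L []],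
     Split [B,E,I,J,N] [Hang L []]],
    [Split [A,F,I,L,M] [Split [A,F,H,N,P] []],Split [A,F,I,L,M] [Split [A,F,H,N,Q] []],
     Split [A,F,I,L,N] [Split [A,F,H,M,P] []],Split [A,F,I,L,N] [Split [A,F,H,M,Q] []]],
    [Hang E [Split [B,D,J,M] [Hang L []]],Hang E [Split [B,D,J,M] [Hang L []]],
     Split [B,E,I,J,M] [Split [C,E,F,H,Q] [Split [C,D,G,J,P] []],Split [C,E,F,H,Q] []],
     Split [B,E,I,J,M] [Split [C,E,F,H,P] [Split [C,D,G,J,Q] []],Split [C,E,F,H,P] []],
     Hang G [Split [A,F,H,M] [Hang L []]],Hang G [Split [A,F,H,M] [Hang L []]],
     Split [A,G,H,K,M] [Split [C,D,G,J,Q] [],Split [C,D,G,J,Q] [Split [C,E,F,H,P] []]],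
     Split [A,G,H,K,M] [Split [C,D,G,J,P] [],Split [C,D,G,J,P] [Split [C,E,F,H,Q] []]],Split [A,F,H,M] [],
     Split [A,F,H,M] [],Split [B,E,I,J,M] [Hang L []],Split [B,E,I,J,M] [Hang L []],Split [B,D,J,M] [],
     Split [B,D,J,M] [],Split [A,G,H,K,M] [Hang L []],Split [A,G,H,K,M] [Hang L []],
     Split [A,F,I,L,M] [Split [A,F,H,N,P] []],Split [A,F,I,L,M] [Split [A,F,H,N,Q] []]]]"

definition trees9_2 where
  "trees9_2 = [
    [Split [A,F,H,M] [],Split [B,D,J,M] [],Split [C,D,F,L] [],Split [C,D,F,L] [],Split [C,E,F,I,L] [],
     Split [C,D,F,L] [],Split [C,D,G,K,L] [],Split [A,F,H,M] [],Split [C,E,F,I,L] [],Split [B,D,J,M] [],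
     Split [C,D,G,K,L] [],Split [C,D,F,L] [],Split [A,F,H,M] [],Split [A,F,H,N,P] [],Split [A,F,H,N,P] [],
     Split [C,E,F,I,L] [],Split [C,E,F,I,L] [],Split [C,D,G,K,L] [],Split [C,D,G,K,L] [],Split [C,E,F,I,L] [],
     Split [C,D,G,K,L] []],
    [],
    [Hang M [],Hang M [],Hang M [],Hang E [Split [B,D,K,L,N] []],Split [C,E,F,H,N] [],Split [A,F,I,L] [],
     Split [A,G,H,K,M] [],Hang M [],Split [A,F,I,L] [],Hang M [],Split [A,G,H,K,M] [],Hang M [],
     Split [A,F,H,M] [],Split [C,E,F,H,N] [],Split [C,E,F,H,P] [],Hang M [],Hang M [],Hang E [],Hang E []],
    [Hang M [],Hang M [],Hang M [],Split [C,D,G,J] [],Split [C,E,F,H] [],Split [C,E,F,H] [],Split [C,D,G,J] [],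
     Hang M [],Hang E [Split [C,E,G,I,J] [Split [A,F,I,L,N] [Split [A,F,I,L,P] []]]],Hang M [],
     Hang G [Split [C,E,G,H,K] [Split [B,D,K,L,N] [Split [B,D,K,L,P] []]]],Hang M [],Split [A,F,H,M,N] [],
     Hang M [],Hang M [],Hang M [],Hang M [],Hang M [],Hang M []],
    [Hang E [Split [B,D,K,L,Q] []],Split [B,D,K,L] [],Split [C,D,G,J] [],Split [C,D,G,J] [],
     Hang I [Split [C,E,F,H,N] [Split [C,E,F,H,P] []]],Split [C,E,F,H,N] [Split [C,E,F,H,P] []],
     Split [C,D,G,J] [],Hang E [Hang I [Split [C,D,G,J,Q] []]],
     Hang E [Split [A,F,I,L,N] [Split [A,F,I,L,P] []]],Split [C,D,G,J] [],Split [B,D,K,L] [],Split [B,D,K,L] [],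
     Split [B,D,J,M] [],Hang E [Hang I [Split [C,E,F,H,N] [Hang P [Split [A,G,H,K,M,N] []]]]],
     Hang E [Hang I [Split [C,E,F,H,P] [Hang N [Split [A,G,H,K,M,P] []]]]],Split [C,E,F,H,P] [],
     Split [C,E,F,H,N] [],Hang I [],Hang I [],Hang E [],Hang E [],Split [B,D,J,M] [],Split [B,D,J,M] []],
    [Split [C,E,F,H,Q] [],Split [B,E,I,J,M] [],Split [C,E,F,H] [],
     Hang I [Split [C,E,F,H,Q] [Split [C,E,F,H,R] []]],Split [C,E,F,H] [],Split [C,E,F,H] [],
     Split [C,E,G,H,K] [Split [C,E,G,I,J] [Split [C,D,G,J,N] [Split [C,D,G,J,P] []]]],Split [C,E,F,H] [],
     Split [B,E,I,J,M] [],Split [B,E,I,J,M] [],Split [C,E,G,H,K] [Split [B,D,K,L,N] [Split [B,D,K,L,P] []]],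
     Hang I [Split [B,E,I,K,L] [Split [A,F,I,L,N] [Hang M []]]],Split [B,E,I,J,M] [],
     Split [C,D,G,J,N] [Split [A,F,I,L,N] [Hang M []],Hang K []],
     Split [C,D,G,J,P] [Split [A,F,I,L,P] [Hang M []],Hang K []],Hang K [],Hang K [],
     Split [C,E,G,H,K] [Split [C,D,G,J,P] []],Split [C,E,G,H,K] [Split [C,D,G,J,N] []],Hang K [],Hang K [],
     Split [C,E,G,H,K] [],Split [C,E,G,H,K] [],Hang M [],Hang M [],Split [B,E,I,J,M] [],Split [B,E,I,J,M] []],
    [Split [A,F,H,M] [],Split [B,D,J,M] [],Split [A,F,H,M,Q] [],Split [B,D,J,M] [],Split [B,E,I,J,M] [],
     Split [A,F,H,M] [],Split [A,G,H,K,M] [],Split [A,F,H,M] [],Split [B,E,I,J,M] [],Split [B,D,J,M] [],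
     Split [A,G,H,K,M] [],Split [A,F,H,M,Q] [],Split [A,F,H,M] [],
     Split [C,E,F,H,N] [Split [C,D,G,J,N] [Split [A,F,I,L,N] []],
     Hang G [Hang K [Split [C,D,G,J,N] [Hang P []]]]],
     Split [C,E,F,H,P] [Split [C,D,G,J,P] [Split [A,F,I,L,P] []],
     Hang G [Hang K [Split [C,D,G,J,P] [Hang N []]]]],Split [B,D,J,M] [],Split [B,D,J,M] [],
     Split [B,E,I,J,M] [],Split [B,E,I,J,M] [],Split [A,F,H,M] [],Split [A,F,H,M] [],Split [A,G,H,K,M] [],
     Split [A,G,H,K,M] [],Split [B,E,I,J,M] [],Split [B,E,I,J,M] [],Split [A,G,H,K,M] [],Split [A,G,H,K,M] []],
    [Hang G [Hang M [Split [C,E,F,H,P] [Split [B,E,I,J,M,P] [Split [B,D,K,L,P] [Hang Q []]],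
     Split [B,D,K,L,P] [Split [A,G,H,K,M,P] [Hang Q []]],Split [B,E,I,J,M,P] [Split [B,D,K,L,P] [Hang Q []]],
     Split [B,E,I,J,M,P] [Split [C,D,G,J,N,P] [Hang Q []]]],Split [C,E,F,H,P] [Hang N [],
     Split [B,D,K,L,P] [Split [C,E,F,H,Q] []]],Split [C,E,F,H,Q] [Hang N [],
     Split [B,D,K,L,P] [Split [C,E,F,H,P] []]],Split [C,E,F,H,R] [Hang N [],
     Split [B,D,K,L,P] [Split [C,E,F,H,P] []]]],
     Split [C,E,F,H,P] [Hang N [Split [B,D,K,L,P] [Split [C,E,F,H,Q] []]],Hang I []],
     Split [C,E,F,H,Q] [Hang N [Split [B,D,K,L,P] [Split [C,E,F,H,P] []]],Hang I []],
     Split [C,E,F,H,R] [Hang N [Split [B,D,K,L,P] [Split [C,E,F,H,P] []]],Hang I []]],Split [A,G,H,K,M] [],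
     Split [B,E,I,J,M] [],Split [C,E,F,H] [],Split [B,D,K,L] [],Split [C,E,F,H] [],Split [C,E,F,H] [],
     Split [A,G,H,K,M] [],Split [C,E,F,H] [],Split [B,E,I,J,M] [],Split [B,E,I,J,M] [],Split [B,D,K,L] [],
     Split [B,D,K,L] [],Split [B,E,I,J,M] [],Split [C,D,G,J,N] [],Split [A,G,H,K,M] [],Split [B,E,I,J,M] []],
    [],
    []]"

definition trees9_3 where
  "trees9_3 = [
    [],
    [],
    [],
    [],
    [],
    [],
    [],
    [],
    [],
    []]"

definition trees9_4 where
  "trees9_4 = [
    [Hang C [],Hang C [],Hang C [],Hang C []],
    [],
    [],
    [],
    [],
    [],
    [],
    [],
    [Hang E [Hang L [Split [B,E,H,K,M] [Hang N []]]],Hang E [Hang L [Split [B,E,H,K,M] [Hang N []]]],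
     Hang E [Hang L [Split [B,E,H,K,N] [Hang M []]]],Hang E [Hang L [Split [B,E,H,K,N] [Hang M []]]]],
    [Hang E [Hang L [Split [B,E,H,K,M] [Hang N []]]],Hang E [Hang L [Split [B,E,H,K,M] [Hang N []]]],
     Hang E [Hang K [Split [B,E,H,L,M] [Hang N []]]],Hang E [Hang K [Split [B,E,H,L,M] [Hang N []]]]]]"

definition trees9_5 where
  "trees9_5 = [
    [],
    [Split [C,D,F,L,P] [],Split [C,D,F,L,Q] [],Split [C,D,F,L,P] [],Split [C,D,F,L,Q] []],
    [],
    [],
    [],
    [Hang C [Split [C,D,F,K,M] [Hang E []]],Hang C [Split [C,D,F,K,M] [Hang E []]],
     Hang C [Split [C,D,F,K,N] [Hang E []]],Hang C [Split [C,D,F,K,N] [Hang E []]]],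
    [Hang C [Split [C,D,F,K,M] [Hang E []]],Hang C [Split [C,D,F,K,M] [Hang E []]],
     Hang C [Split [C,D,F,L,M] [Hang E []]],Hang C [Split [C,D,F,L,M] [Hang E []]]],
    [],
    [Split [C,D,F,K,M] [Split [B,E,H,K,M] []],Split [C,D,F,K,M] [Split [B,E,H,K,M] []],
     Split [C,D,F,K,N] [Split [B,E,H,K,N] []],Split [C,D,F,K,N] [Split [B,E,H,K,N] []]],
    [Split [C,D,F,K,M] [Split [B,E,H,K,M] []],Split [C,D,F,K,M] [Split [B,E,H,K,M] []],
     Split [C,D,F,L,M] [Split [B,E,H,L,M] []],Split [C,D,F,L,M] [Split [B,E,H,L,M] []]]]"

definition trees9_6 where
  "trees9_6 = [
    [],
    [],
    [Hang C [],Hang C [],Hang E [Hang L [Split [C,D,F,L,M] [Hang G []]]],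
     Hang E [Hang L [Split [C,D,F,L,M] [Hang G []]]],Hang E [],Hang E [],
     Hang C [Hang L [Split [B,E,H,L,M] [Hang I []]]],Hang C [Hang L [Split [B,E,H,L,M] [Hang I []]]],
     Split [C,D,F,L,M] [],Split [C,D,F,L,M] [],Hang C [Split [A,G,H,M] [Hang N []]],
     Hang C [Split [A,G,H,M] [Hang N []]],Split [B,E,H,L,M] [],Split [B,E,H,L,M] [],
     Hang E [Split [A,F,I,M] [Hang N []]],Hang E [Split [A,F,I,M] [Hang N []]],
     Split [B,D,J,L,M] [Split [C,D,F,K,P] [Split [B,E,H,K,P] []]],
     Split [B,D,J,L,M] [Split [C,D,F,K,Q] [Split [B,E,H,K,Q] []]]],
    [],
    [Hang C [],Hang C [],Hang E [],Hang C [],Hang C [],Hang C [],Hang C [],Hang E [],Hang E [],Hang G [],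
     Hang C [],Hang C [],Hang L [],Hang C [],Hang C []],
    [Hang C [],Hang C [],Hang E [],Hang C [],Hang C [],Hang C [],Hang C [],Hang E [],Hang E [],Hang G [],
     Hang C [],Hang C [],Hang L [],Hang C [],Hang C [],Hang C [],Hang C [],Hang C [],Hang C []],
    [Hang E [],Hang E [],Hang E [],Hang E [],Hang L [],Hang G [],Split [C,D,G,J,L] [],Hang E [],Hang E [],
     Hang G [],Hang E [],Hang E [],Hang L [],Split [B,D,J,L,N] [Hang M []],Split [B,D,J,L,P] [Hang M []],
     Hang E [],Hang E [],Hang E [],Hang E [],Hang G [],Hang G [],Hang L [],Hang L []],
    [Hang C [],Hang C [],Hang G [],Hang C [],Hang C [],Hang C [],Hang C [],Hang G [],Split [C,E,F,I,K] [],
     Hang G [],Hang C [],Hang C [],Split [A,F,I,M] [],Hang G [],Hang G [],Hang C [],Hang C [],Hang C [],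
     Hang C []],
    [Hang C [],Hang C [],Split [C,D,G,J,L] [],Hang C [],Hang C [],Hang C [],Hang C [],Split [C,E,G,H,K] [],
     Split [A,G,I,J] [],Split [A,G,I,J] [],Hang C [],Hang C [],Split [A,G,H,M] [],
     Hang C [Split [B,D,J,L,N] [Hang E [],Split [C,D,F,K,N] []],Split [B,D,J,L,N] [Hang E [],
     Split [C,D,F,K,N] []]],Hang C [Split [B,D,J,L,P] [Hang E [],Split [C,D,F,K,P] []],
     Split [B,D,J,L,P] [Hang E [],Split [C,D,F,K,P] []]],Hang C [],Hang C [],Hang C [],Hang C [],
     Split [A,G,I,J] [],Split [A,G,I,J] [],Hang C [],Hang C [],Hang C [],Hang C [],Split [A,G,H,M] [],
     Split [A,G,H,M] []],
    []]"

definition trees9_7 where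
  "trees9_7 = [
    [],
    [],
    [],
    [],
    [],
    [Split [A,F,I,K,M] [Split [C,E,G,H,P] [],Split [B,E,H,L,P] []],Split [A,F,I,K,M] [Split [C,E,G,H,Q] [],
     Split [B,E,H,L,Q] []],Split [A,F,I,K,N] [Split [C,E,G,H,P] [],Split [B,E,H,L,P] []],
     Split [A,F,I,K,N] [Split [C,E,G,H,Q] [],Split [B,E,H,L,Q] []]],
    [Split [B,E,H,K,Q] [Hang I []],Split [B,E,H,K] [Hang L []],Split [C,D,F,M] [Hang G []],
     Split [C,D,F,M] [Hang N []],Split [B,E,H,K] [Hang I []],Split [C,D,F,M] [Hang G []],
     Split [A,G,H,K,N] [Split [C,D,G,J,M] [Split [C,E,G,H,P] []],Hang J [Split [C,D,G,J,M] [Hang P []]]],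
     Split [B,E,H,K] [Hang I []],Split [B,E,I,J,K] [Hang L [Split [A,F,I,L,M] [Hang P []]],
     Split [A,F,I,K,N] [Split [A,F,I,L,M] [Split [C,E,F,I,P] []]]],
     Split [B,E,I,J,K] [Split [B,D,J,K,N] [Split [C,D,G,J,M] [Split [C,E,G,I,J,P] []]],Split [B,D,J,L,M] []],
     Split [B,E,H,K] [Hang I []],Split [A,F,I,L,M] [Hang P [Split [A,G,H,L,M] [Hang J []]],
     Split [A,G,H,L,M] [Split [B,D,J,L,M] []]],Split [C,D,F,M] [Hang G []],
     Split [A,F,I,K,N] [Hang G [Split [A,G,H,K,N] [Hang J []]],Split [A,G,H,K,N] [Split [B,D,J,K,N] []]],
     Split [C,E,F,I,P] [Split [C,E,G,H,P] [],Split [C,E,G,H,P] [Split [B,E,H,K,Q] []]],Hang G [],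
     Split [C,D,F,M] [],Hang Q [],Split [C,D,F,M] [],Split [C,D,F,M,Q] [],Split [A,G,H,K,N] [Hang L []],
     Hang I [],Split [B,E,H,K] [],Hang Q [],Split [B,E,H,K] [],Split [B,E,H,K,Q] [],
     Split [B,E,I,J,K] [Hang L []],Hang Q [],Split [B,E,I,J,K] [Split [B,E,H,L,P] []],Hang Q [],
     Split [B,E,I,J,K] [Split [A,G,H,K,N] []],Split [B,D,J,K,N] []],
    [Split [B,E,H,K,M] [Split [C,D,F,N,P] [],Split [C,D,F,M,Q] []],Split [B,E,H,K,M] [Split [C,D,F,N,Q] [],
     Split [C,D,F,M,P] []],Split [B,E,H,K,N] [Split [C,D,F,M,P] [],Split [C,D,F,N,Q] []],
     Split [B,E,H,K,N] [Split [C,D,F,M,Q] [],Split [C,D,F,N,P] []]],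
    [],
    []]"

definition trees9_8 where
  "trees9_8 = [
    [Hang E [Hang R [Split [B,E,H,K,P] [Hang L []]]],Hang E [Hang R [Split [B,E,H,K,Q] [Hang L []]]],
     Hang G [Hang R [Split [A,F,I,K,P] [Split [A,G,H,K,P] []]]],
     Hang G [Hang R [Split [A,F,I,K,Q] [Split [A,G,H,K,Q] []]]],Hang E [Split [C,D,F,M] [Hang Q []]],
     Hang E [Split [C,D,F,M] [Hang P []]],Split [C,E,F,I,M] [Split [C,E,G,H,M] [],
     Split [C,E,G,H,M] [Split [B,E,H,K,Q] []]],Split [C,E,F,I,M] [Split [C,E,G,H,M] [],
     Split [C,E,G,H,M] [Split [B,E,H,K,P] []]],Hang G [Split [C,D,F,M] [Hang Q []]],
     Hang G [Split [C,D,F,M] [Hang P []]],Split [C,E,G,H,M] [Split [C,D,G,J,M] [Split [A,G,H,K,Q] []],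
     Split [C,D,G,J,M] []],Split [C,E,G,H,M] [Split [C,D,G,J,M] [Split [A,G,H,K,P] []],Split [C,D,G,J,M] []],
     Split [A,F,I,K,P] [Split [B,D,J,K,P] []],Split [A,F,I,K,Q] [Split [B,D,J,K,Q] []],
     Split [C,E,F,I,M] [Split [A,F,I,K,Q] [Split [C,D,F,N,P] []],Split [B,E,H,K,P] []],
     Split [C,E,F,I,M] [Split [A,F,I,K,P] [Split [C,D,F,N,Q] []],Split [B,E,H,K,Q] []],
     Split [C,D,G,J,M] [Split [A,F,I,K,P] [],Split [B,D,J,K,Q] [Split [C,D,F,N,P] []]],
     Split [C,D,G,J,M] [Split [A,F,I,K,Q] [],Split [B,D,J,K,P] [Split [C,D,F,N,Q] []]]]]"

definition trees9 where
  "trees9 = [trees9_0, trees9_1, trees9_2, trees9_3, trees9_4, trees9_5, trees9_6, trees9_7, trees9_8]"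

definition trees10_0 where
  "trees10_0 = [
    [Hang C [],Hang C [],Hang C [],Hang C [],Hang E []],
    [Hang E [],Hang P [],Hang G [],Split [A,G,I,J,M] [],Split [C,E,G,H,J,P] [],Hang E [],
     Split [B,E,H,J,P,Q] []],
    [Hang C [],Hang G [],Split [C,E,F,H,N] [],Hang C [],Split [C,D,F,L,P] []],
    [Hang C [],Split [C,E,G,H,J,P] [],Hang E [],Split [C,E,G,H,J,P] [],Hang P [],Split [C,E,G,H,J,P] []],
    [Hang C [],Hang C [],Hang C [],Hang C [],Split [C,E,F,I,M,N] [],Hang C []],
    [Hang R [],Hang G [],Hang I [],Split [C,E,G,H,J] [],Hang Q [],Hang P [],Split [B,E,H,J,P] []],
    [Split [C,D,F,L,Q] [],Split [A,F,H,N,P] [],Split [B,E,H,J,P] [],Split [C,E,G,H,J] [],Split [C,D,F,L,Q] [],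
     Split [C,E,F,I,L] [],Split [B,E,H,J,P] [],Split [B,E,H,J,P] []],
    [Split [B,E,H,J,P,R] [],Hang Q [],Split [C,D,G,K,L] [],Hang N [],Hang R [],Split [B,E,H,J,P] [],
     Split [B,E,H,J,P] [],Hang G [],Split [A,F,I,L,P,R] [],Split [A,G,H,J,P] [],Hang R [],Split [A,F,I,L,P] []],
    [Hang N [],Split [C,D,G,J,N] []],
    [Hang E [],Hang E [],Hang N []]]"

definition trees10_1 where
  "trees10_1 = [
    [Split [B,E,I,J,M,P] [],Hang P [],Hang R [],Split [A,F,H,M,P] [],Split [B,E,I,J,M,P] [],Hang I [],Hang I [],
     Split [B,D,K,L,Q] [],Hang E [],Hang E [],Split [C,D,G,J,Q] []],
    [Hang R [],Hang K [],Split [A,F,I,L,N] [],Split [A,F,H,M,P] [],Split [B,E,I,J,M] [],Split [A,F,I,L,N] [],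
     Split [C,D,G,J,N] [],Split [C,D,G,J,N] [],Split [B,E,I,J,M] [],Hang R [],Split [B,E,H,K,M] [],
     Split [B,E,H,K,M] [],Split [B,E,H,K,M] []],
    [Hang Q [],Hang P []],
    [Split [C,E,F,H,Q] [],Split [C,E,F,H,P] [],Hang G [],Hang G [],Split [C,D,G,J,N,Q] [],
     Split [C,D,G,J,N,P] []],
    [Hang I [],Hang I [],Split [C,D,G,J,N,R] [],Split [C,D,G,J,N,R] [],Hang I [],Hang I [],Split [C,E,G,I,J] [],
     Split [C,E,G,I,J] [],Split [A,G,H,K,M,R] [],Split [A,G,H,K,M,R] [],Split [A,G,H,K,M] [],
     Split [A,G,H,K,M] [],Split [C,D,G,J,N] [],Split [C,D,G,J,N] []],
    [Split [A,G,H,K,M] [],Split [B,E,I,J,M] [],Split [C,D,G,J,N] [],Split [C,D,G,J,N] [],Split [B,E,I,J,M] [],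
     Split [A,F,I,L,N] [],Split [A,G,H,K,M] [],Split [A,G,H,K,M] [],Split [B,E,I,J,M] [],Split [C,D,G,J,N] [],
     Split [A,G,H,K,M] [],Split [A,F,I,L,N] [],Split [A,G,H,K,M] [],Split [C,D,G,J,N] [],Split [C,E,F,H,P] [],
     Split [A,G,H,K,M] [],Split [A,G,H,K,M] [],Split [C,D,G,J,N] [],Split [A,G,H,K,M] []]]"

definition trees10 where
  "trees10 = [trees10_0, trees10_1]"

text \<open>In the second system \<open>R\<close> lies in one triple only. Within the first set, the
  only points far enough apart are \<open>R\<close> and \<open>A\<close>; within the second set they
  are \<open>R\<close> and \<open>J\<close>. Adding these two edges produces the pattern, with
  \<open>R\<close> in the role of its point \<open>A\<close>.\<close>

definition trees11 where
  "trees11 = [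
    Hang P [],
    Split [A,G,H,K,M,R] [Split [B,E,I,J,M,R] [Rigid [R,P,Q,G,I,M,N,B,F,H,D,C,K,L,E,A,J]]],
    Split [A,G,H,K,M] []]"

text \<open>In the main theorem, $K$ is a variable.\<close>

hide_const (open) A B C D E F G H I J K L M N P Q R

section \<open>Evaluation of the certificates\<close>

lemmas us_defs =
  us3_def us5_def us7_def us9_def us11_def us13_def us15_def us16_def us17_def

lemma wf1: "list_all (wf_triples us3) (concat reps1)"
  by code_simp

lemma wf2: "list_all (wf_triples us5) (concat reps2)"
  by code_simp

lemma wf3: "list_all (wf_triples us7) (concat reps3)"
  by code_simp

lemma wf4: "list_all (wf_triples us9) (concat reps4)"
  by code_simp

lemma wf5: "list_all (wf_triples us11) (concat reps5)"
  by code_simp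

lemma wf6: "list_all (wf_triples us13) (concat reps6)"
  by code_simp

lemma wf7: "list_all (wf_triples us15) (concat reps7)"
  by code_simp

lemma wf8: "list_all (wf_triples us16) (concat reps8)"
  by code_simp

lemma wf9: "list_all (wf_triples us16) (concat reps9)"
  by code_simp

lemma wf10: "list_all (wf_triples us16) (concat reps10)"
  by code_simp

lemma wf11: "list_all (wf_triples us17) (concat reps11)"
  by code_simp

lemma isos2_0: "all_isos us17 us5 reps2 reps1_0 isos2_0"
  by code_simp

lemma isos2: "list_all2 (all_isos us17 us5 reps2) reps1 isos2"
  unfolding reps1_def isos2_def
  by (simp add: isos2_0)

lemma isos3_0: "all_isos us17 us7 reps3 reps2_0 isos3_0"
  by code_simp

lemma isos3: "list_all2 (all_isos us17 us7 reps3) reps2 isos3"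
  unfolding reps2_def isos3_def
  by (simp add: isos3_0)

lemma isos4_0: "all_isos us17 us9 reps4 reps3_0 isos4_0"
  by code_simp

lemma isos4: "list_all2 (all_isos us17 us9 reps4) reps3 isos4"
  unfolding reps3_def isos4_def
  by (simp add: isos4_0)

lemma isos5_0: "all_isos us17 us11 reps5 reps4_0 isos5_0"
  by code_simp

lemma isos5: "list_all2 (all_isos us17 us11 reps5) reps4 isos5"
  unfolding reps4_def isos5_def
  by (simp add: isos5_0)

lemma isos6_0: "all_isos us17 us13 reps6 reps5_0 isos6_0"
  by code_simp

lemma isos6: "list_all2 (all_isos us17 us13 reps6) reps5 isos6"
  unfolding reps5_def isos6_def
  by (simp add: isos6_0)

lemma isos7_0: "all_isos us17 us15 reps7 reps6_0 isos7_0"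
  by code_simp

lemma isos7_1: "all_isos us17 us15 reps7 reps6_1 isos7_1"
  by code_simp

lemma isos7_2: "all_isos us17 us15 reps7 reps6_2 isos7_2"
  by code_simp

lemma isos7: "list_all2 (all_isos us17 us15 reps7) reps6 isos7"
  unfolding reps6_def isos7_def
  by (simp add: isos7_0 isos7_1 isos7_2)

lemma isos8_0: "all_isos us17 us16 reps8 reps7_0 isos8_0"
  by code_simp

lemma isos8_1: "all_isos us17 us16 reps8 reps7_1 isos8_1"
  by code_simp

lemma isos8_2: "all_isos us17 us16 reps8 reps7_2 isos8_2"
  by code_simp

lemma isos8_3: "all_isos us17 us16 reps8 reps7_3 isos8_3"
  by code_simp

lemma isos8_4: "all_isos us17 us16 reps8 reps7_4 isos8_4"
  by code_simp

lemma isos8_5: "all_isos us17 us16 reps8 reps7_5 isos8_5"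
  by code_simp

lemma isos8_6: "all_isos us17 us16 reps8 reps7_6 isos8_6"
  by code_simp

lemma isos8: "list_all2 (all_isos us17 us16 reps8) reps7 isos8"
  unfolding reps7_def isos8_def
  by (simp add: isos8_0 isos8_1 isos8_2 isos8_3 isos8_4 isos8_5 isos8_6)

lemma isos9_0: "all_isos us17 us16 reps9 reps8_0 isos9_0"
  by code_simp

lemma isos9_1: "all_isos us17 us16 reps9 reps8_1 isos9_1"
  by code_simp

lemma isos9_2: "all_isos us17 us16 reps9 reps8_2 isos9_2"
  by code_simp

lemma isos9_3: "all_isos us17 us16 reps9 reps8_3 isos9_3"
  by code_simp

lemma isos9_4: "all_isos us17 us16 reps9 reps8_4 isos9_4"
  by code_simp

lemma isos9_5: "all_isos us17 us16 reps9 reps8_5 isos9_5"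
  by code_simp

lemma isos9_6: "all_isos us17 us16 reps9 reps8_6 isos9_6"
  by code_simp

lemma isos9_7: "all_isos us17 us16 reps9 reps8_7 isos9_7"
  by code_simp

lemma isos9_8: "all_isos us17 us16 reps9 reps8_8 isos9_8"
  by code_simp

lemma isos9: "list_all2 (all_isos us17 us16 reps9) reps8 isos9"
  unfolding reps8_def isos9_def
  by (simp add: isos9_0 isos9_1 isos9_2 isos9_3 isos9_4 isos9_5 isos9_6 isos9_7
      isos9_8)

lemma isos10_0: "all_isos us17 us16 reps10 reps9_0 isos10_0"
  by code_simp

lemma isos10_1: "all_isos us17 us16 reps10 reps9_1 isos10_1"
  by code_simp

lemma isos10: "list_all2 (all_isos us17 us16 reps10) reps9 isos10"
  unfolding reps9_def isos10_def
  by (simp add: isos10_0 isos10_1)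

lemma isos11_0: "all_isos us17 us17 reps11 reps10_0 isos11_0"
  by code_simp

lemma isos11: "list_all2 (all_isos us17 us17 reps11) reps10 isos11"
  unfolding reps10_def isos11_def
  by (simp add: isos11_0)

lemma trees9_0: "all_shut pattern17 us17 reps8_0 trees9_0"
  by code_simp

lemma trees9_1: "all_shut pattern17 us17 reps8_1 trees9_1"
  by code_simp

lemma trees9_2: "all_shut pattern17 us17 reps8_2 trees9_2"
  by code_simp

lemma trees9_3: "all_shut pattern17 us17 reps8_3 trees9_3"
  by code_simp

lemma trees9_4: "all_shut pattern17 us17 reps8_4 trees9_4"
  by code_simp

lemma trees9_5: "all_shut pattern17 us17 reps8_5 trees9_5"
  by code_simp

lemma trees9_6: "all_shut pattern17 us17 reps8_6 trees9_6"
  by code_simp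

lemma trees9_7: "all_shut pattern17 us17 reps8_7 trees9_7"
  by code_simp

lemma trees9_8: "all_shut pattern17 us17 reps8_8 trees9_8"
  by code_simp

lemma trees9: "list_all2 (all_shut pattern17 us17) reps8 trees9"
  unfolding reps8_def trees9_def
  by (simp add: trees9_0 trees9_1 trees9_2 trees9_3 trees9_4 trees9_5 trees9_6 trees9_7
      trees9_8)

lemma trees10_0: "all_shut pattern17 us17 reps9_0 trees10_0"
  by code_simp

lemma trees10_1: "all_shut pattern17 us17 reps9_1 trees10_1"
  by code_simp

lemma trees10: "list_all2 (all_shut pattern17 us17) reps9 trees10"
  unfolding reps9_def trees10_def
  by (simp add: trees10_0 trees10_1)

lemma trees11: "list_all2 (closes0 pattern17 us17) (concat reps11) trees11"
  by code_simp

lemma no_exts11: "list_all (\<lambda>hs. is_nil (exts us17 hs)) (concat reps11)"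
  by code_simp

section \<open>From one triangle to eleven\<close>

context square_free_graph
begin

lemma covers_next:
  fixes Hss L :: "pt triple list list list"
  assumes "covers k M (concat Hss)" "list_all (wf_triples vs) (concat Hss)"
    and "list_all2 (all_isos us17 us L) Hss css" "list_all (wf_triples us) (concat L)"
    and "set vs \<subseteq> set us" "distinct us" "length us = N" "k' = Suc k"
    and "\<And>m. m \<le> N \<Longrightarrow> M < m \<Longrightarrow> 3 * Suc k + Suc k * (m - Suc M) < 2 * m"
  shows "covers k' N (concat L)"
  using covers_step[OF assms(1,9,2,5,6,7,3,4)] assms(8) by simp

lemma covers_mono: "covers k N L \<Longrightarrow> N' \<le> N \<Longrightarrow> covers k N' L"
  unfolding covers_def by (elim all_forward imp_forward) auto

lemma covers1: "covers 1 3 (concat reps1)"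
  using covers_base[of pt.A pt.B pt.C] by (simp add: reps1_def reps1_0_def)

lemma covers2: "covers 2 5 (concat reps2)"
  by (rule covers_next[OF covers1 wf1 isos2 wf2]) (auto simp: us_defs)

lemma covers3: "covers 3 7 (concat reps3)"
  by (rule covers_next[OF covers2 wf2 isos3 wf3]) (auto simp: us_defs)

lemma covers4: "covers 4 9 (concat reps4)"
  by (rule covers_next[OF covers3 wf3 isos4 wf4]) (auto simp: us_defs)

lemma covers5: "covers 5 11 (concat reps5)"
  by (rule covers_next[OF covers4 wf4 isos5 wf5]) (auto simp: us_defs)

lemma covers6: "covers 6 13 (concat reps6)"
  by (rule covers_next[OF covers5 wf5 isos6 wf6]) (auto simp: us_defs)

lemma covers7: "covers 7 15 (concat reps7)"
  by (rule covers_next[OF covers6 wf6 isos7 wf7]) (auto simp: us_defs)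

text \<open>From here on the bound no longer grows by two: what follows needs eight triangles on 16
  points only. The bound 15 for seven triangles is sharp for this step, because eight triangles with
  one private point each may have (24 + 8) / 2 = 16 points.\<close>

lemma covers8: "covers 8 16 (concat reps8)"
  by (rule covers_next[OF covers7 wf7 isos8 wf8]) (auto simp: us_defs)

text \<open>Nine triangles on 16 points have 27 < 32 incidences, so one of them has a private point,
  and 15 points suffice for the rest. With ten triangles the count is 30 < 32.\<close>

lemma covers9: "covers 9 16 (concat reps9)"
  by (rule covers_next[OF covers_mono[OF covers8, of 15] wf8 isos9 wf9]) (auto simp: us_defs)

lemma covers10: "covers 10 16 (concat reps10)"
  by (rule covers_next[OF covers_mono[OF covers9, of 15] wf9 isos10 wf10]) (auto simp: us_defs)

text \<open>On 17 points, 33 < 34 still guarantees a private point, so the list of ten triples on 16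
  points is enough.\<close>

lemma covers11: "covers 11 17 (concat reps11)"
  by (rule covers_next[OF covers10 wf10 isos11 wf11]) (auto simp: us_defs)

text \<open>Exactly nine, ten or eleven triangles are excluded by trees. More than eleven would
  contain twelve, and eleven of these form a listed system; this is where the list for eleven must
  reach up to 17 points.\<close>

theorem no_critical_17:
  assumes crit: "critical pattern17" and V: "card V \<le> 17"
  shows "card triangles \<le> 8"
proof -
  have "card triangles \<noteq> Suc 8"
    by (rule no_critical[OF covers8 _ wf8 _ _ _ trees9 crit V]) (auto simp: us_defs)
  moreover have "card triangles \<noteq> Suc 9"
    by (rule no_critical[OF covers9 _ wf9 _ _ _ trees10 crit V]) (auto simp: us_defs)
  moreover have "card triangles \<noteq> 11"
    by (rule no_critical_listed[OF covers11 wf11 trees11 crit V])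
  moreover have "card triangles \<le> 11"
    by (rule no_more[OF covers11 _ wf11 _ _ _ no_exts11 V]) (auto simp: us_defs)
  ultimately show ?thesis by linarith
qed

end

section \<open>Geometry of the exceptional graph and conclusion\<close>

lemma orthonormal_expansion:
  fixes x y :: "real^3"
  assumes n: "norm a = 1" "norm b = 1" "norm c = 1" and o: "a \<bullet> b = 0" "b \<bullet> c = 0" "a \<bullet> c = 0"
  shows "x \<bullet> y = (x \<bullet> a) * (y \<bullet> a) + (x \<bullet> b) * (y \<bullet> b) + (x \<bullet> c) * (y \<bullet> c)"
proof -
  have n': "a \<bullet> a = 1" "b \<bullet> b = 1" "c \<bullet> c = 1" using n by (simp_all add: norm_eq_1)
  have o': "b \<bullet> a = 0" "c \<bullet> b = 0" "c \<bullet> a = 0" using o by (simp_all add: inner_commute)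
  have ne: "a \<noteq> b" "b \<noteq> c" "a \<noteq> c" "0 \<notin> {a, b, c}" using n' o by auto
  have "pairwise orthogonal {a, b, c}" using o o' by (auto simp: pairwise_def orthogonal_def)
  then have ind: "independent {a, b, c}" using ne(4) by (rule pairwise_orthogonal_independent)
  have "card {a, b, c} = 3" using ne by simp
  then have sp: "span {a, b, c} = (UNIV :: (real^3) set)"
    using card_eq_dim[of "{a, b, c}" UNIV] ind by auto
  define r where "r = y - (y \<bullet> a) *\<^sub>R a - (y \<bullet> b) *\<^sub>R b - (y \<bullet> c) *\<^sub>R c"
  have "r \<bullet> a = 0" "r \<bullet> b = 0" "r \<bullet> c = 0"
    unfolding r_def by (simp_all add: inner_diff_left n' o o')
  then have "orthogonal r v" if "v \<in> {a, b, c}" for v using that by (auto simp: orthogonal_def)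
  moreover have "r \<in> span {a, b, c}" unfolding sp by (rule UNIV_I)
  ultimately have "orthogonal r r" by (rule orthogonal_to_span[rotated])
  then have "r = 0" by (simp add: orthogonal_def)
  then have "y = (y \<bullet> a) *\<^sub>R a + (y \<bullet> b) *\<^sub>R b + (y \<bullet> c) *\<^sub>R c" by (simp add: r_def algebra_simps)
  then have "x \<bullet> y = x \<bullet> ((y \<bullet> a) *\<^sub>R a + (y \<bullet> b) *\<^sub>R b + (y \<bullet> c) *\<^sub>R c)" by simp
  then show ?thesis by (simp add: inner_add_right mult.commute)
qed

lemma both_zero:
  fixes p q t :: real
  assumes "p = q * t" "q = p * t" "t\<^sup>2 \<noteq> 1"
  shows "p = 0" "q = 0"
proof -
  have "p * (1 - t\<^sup>2) = 0" using assms(1,2) by (simp add: algebra_simps power2_eq_square)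
  then show "p = 0" using assms(3) by simp
  then show "q = 0" using assms(2) by simp
qed

text \<open>In an orthonormal basis $h, l, q$ with $d \perp h$ and $f \perp l$ only one term of the expansion of
  $d \cdot f$ survives.  The pattern yields four such relations, which are incompatible.\<close>

lemma pattern17_not_realizable:
  fixes g :: "pt \<Rightarrow> real^3"
  assumes norm: "\<And>x. norm (g x) = 1" and orth: "\<And>x y. (x, y) \<in> set pattern17 \<Longrightarrow> g x \<bullet> g y = 0"
  shows False
proof -
  obtain a b c d e f p h i j k l m n o' q r where
    defs: "a = g pt.A" "b = g pt.B" "c = g pt.C" "d = g pt.D" "e = g pt.E" "f = g pt.F" "p = g pt.G"
    "h = g pt.H" "i = g pt.I" "j = g pt.J" "k = g pt.K" "l = g pt.L" "m = g pt.M" "n = g pt.N"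
    "o' = g pt.P" "q = g pt.Q" "r = g pt.R" by blast
  have nrm: "norm a = 1" "norm b = 1" "norm c = 1" "norm d = 1" "norm e = 1" "norm f = 1" "norm p = 1"
    "norm h = 1" "norm i = 1" "norm j = 1" "norm k = 1" "norm l = 1" "norm m = 1" "norm n = 1"
    "norm o' = 1" "norm q = 1" "norm r = 1" by (simp_all add: defs norm)
  have o: "a \<bullet> b = 0" "b \<bullet> c = 0" "a \<bullet> c = 0" "b \<bullet> d = 0" "b \<bullet> e = 0" "d \<bullet> e = 0"
    "c \<bullet> f = 0" "c \<bullet> p = 0" "f \<bullet> p = 0" "d \<bullet> h = 0" "d \<bullet> i = 0" "e \<bullet> j = 0" "e \<bullet> k = 0"
    "f \<bullet> l = 0" "f \<bullet> n = 0" "p \<bullet> m = 0" "p \<bullet> o' = 0" "h \<bullet> l = 0" "l \<bullet> q = 0" "h \<bullet> q = 0"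
    "i \<bullet> m = 0" "m \<bullet> r = 0" "i \<bullet> r = 0" "j \<bullet> n = 0" "n \<bullet> r = 0" "j \<bullet> r = 0"
    "k \<bullet> o' = 0" "o' \<bullet> q = 0" "k \<bullet> q = 0" "a \<bullet> q = 0" "a \<bullet> r = 0"
    unfolding defs by (rule orth, simp add: pattern17_def)+
  \<comment> \<open>In the basis a, b, c each of d, e, f, p, q, r has a vanishing coordinate. For q
    and r, which are perpendicular to a, this is the effect of the two additional edges.\<close>
  have o2: "d \<bullet> b = 0" "e \<bullet> b = 0" "f \<bullet> c = 0" "p \<bullet> c = 0" "q \<bullet> a = 0" "r \<bullet> a = 0"
    using o by (simp_all add: inner_commute)
  note abc = orthonormal_expansion[OF nrm(1-3) o(1-3)]
  have unit: "x \<bullet> x = 1" if "norm x = 1" for x :: "real^3" using that by (simp add: norm_eq_1)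
  define da dc ea ec fa fb pa pb qb qc rb rc where coord: "da = d \<bullet> a" "dc = d \<bullet> c" "ea = e \<bullet> a" "ec = e \<bullet> c"
    "fa = f \<bullet> a" "fb = f \<bullet> b" "pa = p \<bullet> a" "pb = p \<bullet> b" "qb = q \<bullet> b" "qc = q \<bullet> c" "rb = r \<bullet> b" "rc = r \<bullet> c"
  \<comment> \<open>The four bases are h, l, q; then k, o', q; then i, m, r; and j, n, r. In each of
    them, every vector of the pair is perpendicular to a different one of the first two
    members.\<close>
  have "d \<bullet> f = (d \<bullet> q) * (f \<bullet> q)" "e \<bullet> p = (e \<bullet> q) * (p \<bullet> q)"
    "d \<bullet> p = (d \<bullet> r) * (p \<bullet> r)" "e \<bullet> f = (e \<bullet> r) * (f \<bullet> r)"
    using orthonormal_expansion[OF nrm(8,12,16) o(18-20), of d f] orthonormal_expansion[OF nrm(11,15,16) o(27-29), of e p]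
      orthonormal_expansion[OF nrm(9,13,17) o(21-23), of d p] orthonormal_expansion[OF nrm(10,14,17) o(24-26), of e f] o
    by simp_all
  then have eqs: "da * fa = (dc * qc) * (fb * qb)" "ea * pa = (ec * qc) * (pb * qb)"
    "da * pa = (dc * rc) * (pb * rb)" "ea * fa = (ec * rc) * (fb * rb)"
    using abc[of d f] abc[of d q] abc[of f q] abc[of e p] abc[of e q] abc[of p q] abc[of d p] abc[of d r]
      abc[of p r] abc[of e f] abc[of e r] abc[of f r] o2
    by (simp_all add: coord)
  have units: "da\<^sup>2 + dc\<^sup>2 = 1" "ea\<^sup>2 + ec\<^sup>2 = 1" "fa\<^sup>2 + fb\<^sup>2 = 1" "pa\<^sup>2 + pb\<^sup>2 = 1" "qb\<^sup>2 + qc\<^sup>2 = 1" "rb\<^sup>2 + rc\<^sup>2 = 1"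
    using abc[of d d] abc[of e e] abc[of f f] abc[of p p] abc[of q q] abc[of r r] o2 unit nrm
    by (simp_all add: coord power2_eq_square)
  have perp: "da * ea + dc * ec = 0" "fa * pa + fb * pb = 0"
    using abc[of d e] abc[of f p] o o2 by (simp_all add: coord)
  \<comment> \<open>Perpendicular unit vectors of a plane arise from each other by a quarter turn,
    up to sign.\<close>
  have swap: "u\<^sup>2 = y\<^sup>2" if "x\<^sup>2 + y\<^sup>2 = 1" "u\<^sup>2 + v\<^sup>2 = 1" "x * u + y * v = 0" for x y u v :: real
  proof -
    have "x\<^sup>2 * u\<^sup>2 = y\<^sup>2 * v\<^sup>2" using that(3) by (metis add.commute eq_neg_iff_add_eq_0 power2_minus power_mult_distrib)
    then have "x\<^sup>2 * u\<^sup>2 + y\<^sup>2 * u\<^sup>2 = y\<^sup>2 * v\<^sup>2 + y\<^sup>2 * u\<^sup>2" by simp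
    then have "(x\<^sup>2 + y\<^sup>2) * u\<^sup>2 = y\<^sup>2 * (u\<^sup>2 + v\<^sup>2)" by (simp add: algebra_simps)
    then show ?thesis using that(1,2) by simp
  qed
  have e2: "ea\<^sup>2 = dc\<^sup>2" and p2: "pa\<^sup>2 = fb\<^sup>2"
    using swap[OF units(1,2) perp(1)] swap[OF units(3,4) perp(2)] by simp_all
  then have e2': "ec\<^sup>2 = da\<^sup>2" and p2': "pb\<^sup>2 = fa\<^sup>2" using units by linarith+
  \<comment> \<open>The product of the two coordinates of a unit vector in the plane is at most 1/2
    in absolute value, hence far from 1.\<close>
  have small: "((x * y)\<^sup>2)\<^sup>2 \<noteq> 1" if "x\<^sup>2 + y\<^sup>2 = 1" for x y :: real
  proof -
    have "0 \<le> (x\<^sup>2 - y\<^sup>2)\<^sup>2" by simp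
    then have "4 * (x * y)\<^sup>2 \<le> (x\<^sup>2 + y\<^sup>2)\<^sup>2" by (simp add: power2_eq_square algebra_simps)
    then have "(x * y)\<^sup>2 \<le> 1 / 4" using that by simp
    then have "((x * y)\<^sup>2)\<^sup>2 \<le> (1 / 4)\<^sup>2" by (intro power_mono) auto
    then show ?thesis by (auto simp: power2_eq_square)
  qed
  \<comment> \<open>Squaring removes the signs left open by \<open>swap\<close>, so that e and p can
    be expressed by d and f.\<close>
  have sq: "(da * fa)\<^sup>2 = (dc * fb)\<^sup>2 * (qb * qc)\<^sup>2" "(ea * pa)\<^sup>2 = (ec * pb)\<^sup>2 * (qb * qc)\<^sup>2"
    "(da * pa)\<^sup>2 = (dc * pb)\<^sup>2 * (rb * rc)\<^sup>2" "(ea * fa)\<^sup>2 = (ec * fb)\<^sup>2 * (rb * rc)\<^sup>2"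
    unfolding eqs by (simp_all add: power_mult_distrib)
  \<comment> \<open>After the substitution, the two relations with q say that each of two numbers is
    the other one times (qb qc)^2. This factor has square different from 1, so both numbers
    vanish.\<close>
  have "(da * fa)\<^sup>2 = 0" "(dc * fb)\<^sup>2 = 0"
    using both_zero[OF sq(1) _ small[OF units(5)]] sq(2) by (simp_all add: power_mult_distrib e2 e2' p2 p2')
  moreover have "(da * fb)\<^sup>2 = 0" "(dc * fa)\<^sup>2 = 0"
    using both_zero[OF _ _ small[OF units(6)], of "(da * fb)\<^sup>2" "(dc * fa)\<^sup>2"] sq(3,4)
    by (simp_all add: power_mult_distrib e2 e2' p2 p2')
  \<comment> \<open>The four vanishing squares add up to the product of two squared norms, which is
    1.\<close>
  moreover have "(da * fa)\<^sup>2 + (da * fb)\<^sup>2 + (dc * fa)\<^sup>2 + (dc * fb)\<^sup>2 = (da\<^sup>2 + dc\<^sup>2) * (fa\<^sup>2 + fb\<^sup>2)"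
    by (simp add: power_mult_distrib algebra_simps)
  ultimately show False unfolding units by linarith
qed

section \<open>Orthogonality on the open hemisphere\<close>

text \<open>Parallel unit vectors differ at most by a sign, and positive third coordinates fix it.
  Thus each vector stands for a line of its own.\<close>

lemma hemisphere_parallel:
  assumes x: "x \<in> upper_hemisphere" and y: "y \<in> upper_hemisphere" and "cross3 x y = 0"
  shows "x = y"
proof -
  have "x \<noteq> 0" "y \<noteq> 0" using x y by (auto simp: upper_hemisphere_def)
  then obtain c where c: "y = c *\<^sub>R x"
    using assms(3) by (auto simp: cross_eq_0 collinear_lemma)
  have "\<bar>c\<bar> = 1" using x y by (simp add: c upper_hemisphere_def)
  moreover have "0 < c" using x y by (simp add: c upper_hemisphere_def zero_less_mult_iff)
  ultimately show ?thesis by (simp add: c)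
qed

text \<open>Different vectors \<open>w\<close> and \<open>w'\<close> span a plane; both
  \<open>u\<close> and \<open>v\<close> are perpendicular to it, hence parallel to the cross product
  and to each other.\<close>

lemma hemisphere_square_free:
  assumes "u \<in> upper_hemisphere" "v \<in> upper_hemisphere" "w \<in> upper_hemisphere" "w' \<in> upper_hemisphere"
    and "u \<bullet> w = 0" "v \<bullet> w = 0" "u \<bullet> w' = 0" "v \<bullet> w' = 0" "u \<noteq> v"
  shows "w = w'"
proof (rule ccontr)
  assume "w \<noteq> w'"
  then have c0: "cross3 w w' \<noteq> 0" using hemisphere_parallel assms(3,4) by blast
  have par: "\<exists>a. a \<noteq> 0 \<and> cross3 w w' = a *\<^sub>R x" if "x \<in> upper_hemisphere" "x \<bullet> w = 0" "x \<bullet> w' = 0" for x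
  proof -
    \<comment> \<open>The double cross product is a combination of \<open>w\<close> and
      \<open>w'\<close> with coefficients \<open>x \<bullet> w'\<close> and, up to sign,
      \<open>x \<bullet> w\<close>.\<close>
    have "cross3 x (cross3 w w') = 0" using that(2,3) by (simp add: Lagrange)
    moreover have "x \<noteq> 0" using that(1) by (auto simp: upper_hemisphere_def)
    ultimately obtain a where "cross3 w w' = a *\<^sub>R x" using c0 by (auto simp: cross_eq_0 collinear_lemma)
    then show ?thesis using c0 by auto
  qed
  obtain a b where ab: "a \<noteq> 0" "cross3 w w' = a *\<^sub>R u" "b \<noteq> 0" "cross3 w w' = b *\<^sub>R v"
    using par[OF assms(1,5,7)] par[OF assms(2,6,8)] by blast
  then have "v = (a / b) *\<^sub>R u"
    by (metis divide_inverse_commute scaleR_right_imp_eq scaleR_scaleR vector_fraction_eq_iff)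
  then have "cross3 u v = 0" by (simp add: cross_mult_right)
  then show False using hemisphere_parallel assms(1,2,9) by blast
qed

section \<open>Minimal uncolourable systems\<close>

definition zero_class :: "(real^3) set \<Rightarrow> (real^3) set \<Rightarrow> bool" where
  "zero_class V Z \<longleftrightarrow> Z \<subseteq> V \<and> (\<forall>u\<in>Z. \<forall>v\<in>Z. \<not> orth u v) \<and>
    (\<forall>u\<in>V. \<forall>v\<in>V. \<forall>w\<in>V. orth u v \<and> orth v w \<and> orth u w \<longrightarrow> u \<in> Z \<or> v \<in> Z \<or> w \<in> Z)"

lemma colourable_iff: "colourable_101 V \<longleftrightarrow> (\<exists>Z. zero_class V Z)"
proof
  assume "colourable_101 V"
  then obtain f :: "real^3 \<Rightarrow> nat" where f: "\<forall>v\<in>V. f v \<in> {0, 1}"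
    "\<forall>u\<in>V. \<forall>v\<in>V. orth u v \<longrightarrow> \<not> (f u = 0 \<and> f v = 0)"
    "\<forall>u\<in>V. \<forall>v\<in>V. \<forall>w\<in>V. orth u v \<and> orth v w \<and> orth u w \<longrightarrow> \<not> (f u = 1 \<and> f v = 1 \<and> f w = 1)"
    unfolding colourable_101_def by blast
  let ?Z = "{v \<in> V. f v = 0}"
  have "u \<in> ?Z \<or> v \<in> ?Z \<or> w \<in> ?Z"
    if "u \<in> V" "v \<in> V" "w \<in> V" "orth u v" "orth v w" "orth u w" for u v w
    using bspec[OF f(1) that(1)] bspec[OF f(1) that(2)] bspec[OF f(1) that(3)] f(3) that by simp metis
  moreover have "\<not> orth u v" if "u \<in> ?Z" "v \<in> ?Z" for u v using f(2) that by blast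
  moreover have "?Z \<subseteq> V" by simp
  ultimately have "zero_class V ?Z" unfolding zero_class_def by simp
  then show "\<exists>Z. zero_class V Z" ..
next
  assume "\<exists>Z. zero_class V Z"
  then obtain Z where Z: "zero_class V Z" ..
  then show "colourable_101 V" unfolding colourable_101_def zero_class_def
    by (intro exI[of _ "\<lambda>v. if v \<in> Z then 0 else 1"]) (simp; blast)
qed

locale minimal_uncolourable =
  fixes V :: "(real^3) set"
  assumes fin: "finite V" and hemi: "V \<subseteq> upper_hemisphere"
    and uncol: "\<not> colourable_101 V" and minimal: "\<And>v. v \<in> V \<Longrightarrow> colourable_101 (V - {v})"
begin

definition E :: "real^3 \<Rightarrow> real^3 \<Rightarrow> bool" where
  "E u v \<longleftrightarrow> u \<in> V \<and> v \<in> V \<and> orth u v"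

lemma unit: "v \<in> V \<Longrightarrow> norm v = 1"
  using hemi by (auto simp: upper_hemisphere_def)

sublocale square_free_graph V E
proof
  fix u v w w'
  show "\<not> E u u" using unit[of u] by (auto simp: E_def orth_def)
  assume "E u w" "E v w" "E u w'" "E v w'" "u \<noteq> v"
  then show "w = w'" using hemisphere_square_free[of u v w w'] hemi by (auto simp: E_def orth_def)
qed (use fin in \<open>auto simp: E_def orth_def inner_commute\<close>)

lemma triangle_iff: "t \<in> triangles \<longleftrightarrow> (\<exists>u\<in>V. \<exists>v\<in>V. \<exists>w\<in>V. t = {u, v, w} \<and> orth u v \<and> orth v w \<and> orth u w)"
  by (auto simp: triangles_def E_def)

lemma colouringI:
  assumes "Z \<subseteq> V" "\<And>u v. u \<in> Z \<Longrightarrow> v \<in> Z \<Longrightarrow> \<not> E u v" "\<And>t. t \<in> triangles \<Longrightarrow> t \<inter> Z \<noteq> {}"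
  shows False
proof -
  have "zero_class V Z" unfolding zero_class_def
  proof (intro conjI ballI impI)
    fix u v assume "u \<in> Z" "v \<in> Z"
    then show "\<not> orth u v" using assms(1) assms(2)[of u v] by (auto simp: E_def)
  next
    fix u v w assume uvw: "u \<in> V" "v \<in> V" "w \<in> V" "orth u v \<and> orth v w \<and> orth u w"
    then have "{u, v, w} \<in> triangles" unfolding triangle_iff by blast
    then show "u \<in> Z \<or> v \<in> Z \<or> w \<in> Z" using assms(3) by blast
  qed (rule assms(1))
  then show False using uncol colourable_iff by blast
qed

text \<open>The triangles of the system without \<open>v\<close> are those of \<open>V\<close> that
  avoid \<open>v\<close>. So only triangles through \<open>v\<close> may be missed by these
  zeros.\<close>

lemma colouring_minus:
  assumes "v \<in> V"
  obtains Z where "Z \<subseteq> V - {v}" "\<And>u w. u \<in> Z \<Longrightarrow> w \<in> Z \<Longrightarrow> \<not> E u w"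
    "\<And>t. t \<in> triangles \<Longrightarrow> v \<notin> t \<Longrightarrow> t \<inter> Z \<noteq> {}"
proof -
  obtain Z where Z: "zero_class (V - {v}) Z" using minimal[OF assms] colourable_iff by blast
  have hit: "a \<in> Z \<or> b \<in> Z \<or> c \<in> Z"
    if "a \<in> V - {v}" "b \<in> V - {v}" "c \<in> V - {v}" "orth a b" "orth b c" "orth a c" for a b c
    using Z that unfolding zero_class_def by simp
  have ind: "\<not> E u w" if "u \<in> Z" "w \<in> Z" for u w
    using Z that by (simp add: zero_class_def E_def)
  have "t \<inter> Z \<noteq> {}" if t: "t \<in> triangles" "v \<notin> t" for t
  proof -
    obtain a b c where abc: "a \<in> V" "b \<in> V" "c \<in> V" "t = {a, b, c}" "orth a b" "orth b c" "orth a c"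
      using t(1) unfolding triangle_iff by blast
    then have "a \<in> V - {v}" "b \<in> V - {v}" "c \<in> V - {v}" using t(2) by blast+
    from hit[OF this abc(5-7)] show ?thesis unfolding abc(4) by blast
  qed
  moreover have "Z \<subseteq> V - {v}" using Z by (simp add: zero_class_def)
  ultimately show ?thesis using that[of Z] ind by blast
qed

lemma critical_pattern17: "critical pattern17"
  unfolding critical_def
proof (intro conjI allI impI ballI)
  show "V = \<Union>triangles"
  proof
    show "V \<subseteq> \<Union>triangles"
    proof (rule subsetI, rule ccontr)
      fix v assume v: "v \<in> V" "v \<notin> \<Union>triangles"
      obtain Z where Z: "Z \<subseteq> V - {v}" "\<And>u w. u \<in> Z \<Longrightarrow> w \<in> Z \<Longrightarrow> \<not> E u w"
        "\<And>t. t \<in> triangles \<Longrightarrow> v \<notin> t \<Longrightarrow> t \<inter> Z \<noteq> {}" using colouring_minus[OF v(1)] by blast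
      \<comment> \<open>As \<open>v\<close> lies in no triangle, the zeros chosen for the remaining
        vectors already colour all of \<open>V\<close>, with \<open>v\<close> receiving the value
        1.\<close>
      show False by (rule colouringI[of Z]) (use Z v in auto)
    qed
  qed (use triangle_V in auto)
next
  fix Z assume "Z \<subseteq> V" "\<forall>t\<in>triangles. t \<inter> Z \<noteq> {}"
  then show "\<exists>u\<in>Z. \<exists>v\<in>Z. E u v" using colouringI[of Z] by blast
next
  fix t v assume t: "t \<in> triangles" and v: "v \<in> t"
  show "\<exists>u. E v u \<and> u \<notin> t"
  proof (rule ccontr)
    assume "\<not> ?thesis"
    then have nbs: "E v u \<Longrightarrow> u \<in> t" for u by blast
    have vV: "v \<in> V" using t v triangle_V by auto
    obtain Z where Z: "Z \<subseteq> V - {v}" "\<And>u w. u \<in> Z \<Longrightarrow> w \<in> Z \<Longrightarrow> \<not> E u w"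
      "\<And>t. t \<in> triangles \<Longrightarrow> v \<notin> t \<Longrightarrow> t \<inter> Z \<noteq> {}" using colouring_minus[OF vV] by blast
    show False
    proof (cases "t \<inter> Z = {}")
      case True
      \<comment> \<open>The vector \<open>v\<close> may become a zero: all its neighbours lie in
        \<open>t\<close>, which contains no zero. This hits every triangle through
        \<open>v\<close>.\<close>
      show False
      proof (rule colouringI[of "insert v Z"])
        fix u w assume "u \<in> insert v Z" "w \<in> insert v Z"
        then show "\<not> E u w" using Z(2) nbs True E_sym E_irrefl by blast
      next
        fix t' assume "t' \<in> triangles"
        then show "t' \<inter> insert v Z \<noteq> {}" using Z(3)[of t'] by blast
      qed (use Z(1) vV in auto)
    next
      case False
      \<comment> \<open>All neighbours of \<open>v\<close> lie in \<open>t\<close>, so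
        \<open>t\<close> is the only triangle through \<open>v\<close>. It is hit already, and the
        zeros work for \<open>V\<close> unchanged.\<close>
      have "t' = t" if t': "t' \<in> triangles" "v \<in> t'" for t'
      proof -
        have "t' \<subseteq> t"
        proof
          fix u assume u: "u \<in> t'"
          show "u \<in> t"
          proof (cases "u = v")
            case False
            then show ?thesis using nbs triangle_edge[OF t'(1,2) u] by blast
          qed (use v in simp)
        qed
        then show ?thesis
          using card_subset_eq[OF triangle_finite[OF t]] triangle_card t t'(1) by metis
      qed
      then have "t' \<inter> Z \<noteq> {}" if "t' \<in> triangles" for t' using False Z(3) that by blast
      then show False using colouringI[of Z] Z(1,2) by blast
    qed
  qed
next
  fix g :: "pt \<Rightarrow> real^3"
  show "\<exists>(x, y)\<in>set pattern17. \<not> E (g x) (g y)"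
  proof (rule ccontr)
    assume neg: "\<not> ?thesis"
    then have E: "(x, y) \<in> set pattern17 \<Longrightarrow> E (g x) (g y)" for x y by blast
    \<comment> \<open>Each label occurs in some pair of the pattern, so its image belongs to
      \<open>V\<close> and has norm 1.\<close>
    have "\<exists>y. (x, y) \<in> set pattern17 \<or> (y, x) \<in> set pattern17" for x
      by (cases x) (auto simp: pattern17_def)
    then have "norm (g x) = 1" for x using E unit unfolding E_def by metis
    then show False using pattern17_not_realizable[of g] E by (auto simp: E_def orth_def)
  qed
qed

lemma nine_triangles: "8 < card triangles"
proof (rule ccontr)
  assume "\<not> 8 < card triangles"
  then have "\<exists>p. \<forall>t\<in>triangles. \<exists>x\<in>t. (norm p)\<^sup>2 < 2 * (p \<bullet> x)\<^sup>2"
    using finite_triangles unit by (intro avoid_eight) (auto simp: triangle_iff orth_def)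
  then obtain p where p: "\<forall>t\<in>triangles. \<exists>x\<in>t. (norm p)\<^sup>2 < 2 * (p \<bullet> x)\<^sup>2" by blast
  show False
  \<comment> \<open>The zeros are the vectors whose double cone contains the common direction p;
    orthogonal vectors have disjoint cones.\<close>
  proof (rule colouringI[of "{x \<in> V. (norm p)\<^sup>2 < 2 * (p \<bullet> x)\<^sup>2}"])
    fix u v assume uv: "u \<in> {x \<in> V. (norm p)\<^sup>2 < 2 * (p \<bullet> x)\<^sup>2}" "v \<in> {x \<in> V. (norm p)\<^sup>2 < 2 * (p \<bullet> x)\<^sup>2}"
    show "\<not> E u v"
    proof
      assume "E u v"
      then have "(p \<bullet> u)\<^sup>2 + (p \<bullet> v)\<^sup>2 \<le> (norm p)\<^sup>2" by (intro bessel2) (auto simp: E_def orth_def unit)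
      then show False using uv by auto
    qed
  next
    fix t assume t: "t \<in> triangles"
    then show "t \<inter> {x \<in> V. (norm p)\<^sup>2 < 2 * (p \<bullet> x)\<^sup>2} \<noteq> {}" using p triangle_V[OF t] by blast
  qed auto
qed

lemma at_least_18: "18 \<le> card V"
proof (rule ccontr)
  assume "\<not> 18 \<le> card V"
  then have "card triangles \<le> 8" using no_critical_17[OF critical_pattern17] by simp
  then show False using nine_triangles by simp
qed

end

theorem mainTheorem13:
  assumes "KS_system K"
  shows "card K \<ge> 18"
proof -
  have K: "finite K" "K \<subseteq> upper_hemisphere" "\<not> colourable_101 K"
    using assms by (auto simp: KS_system_def vector_system_def)
  \<comment> \<open>Descending to an inclusion-minimal uncolourable subset can only lower the number
    of vectors.\<close>
  have "\<exists>V\<subseteq>K. \<not> colourable_101 V \<and> (\<forall>v\<in>V. colourable_101 (V - {v}))"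
    using K(1,3)
  proof (induction K rule: finite_psubset_induct)
    case (psubset K)
    show ?case
    proof (cases "\<forall>v\<in>K. colourable_101 (K - {v})")
      case False
      then obtain v where "v \<in> K" "\<not> colourable_101 (K - {v})" by blast
      then show ?thesis using psubset.IH[of "K - {v}"] by blast
    qed (use psubset.prems in blast)
  qed
  then obtain V where V: "V \<subseteq> K" "\<not> colourable_101 V" "\<And>v. v \<in> V \<Longrightarrow> colourable_101 (V - {v})" by blast
  interpret minimal_uncolourable V
    by unfold_locales (use V K finite_subset in auto)
  show ?thesis using at_least_18 card_mono[OF K(1) V(1)] by simp
qed

end
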